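(* Let $F_2$ be the free group of rank $2$. Then $\mathrm{Out}(F_2)$ contains only finitely many McCool groups up to conjugacy in $\mathrm{Out}(F_2)$.
   Context: For a family $\mathcal{H}=\{H_i\}$ of subgroups of a group $G$, an automorphism $\varphi\in\mathrm{Aut}(G)$, and its image $\Phi\in\mathrm{Out}(G)$, are said to act trivially on $\mathcal{H}$ if for each $i$ there is $g_i\in G$ such that $\varphi$ restricted to $H_i$ equals conjugation by $g_i$. The group $\mathrm{Mc}(\mathcal{H})\subset\mathrm{Out}(G)$ is the subgroup of all $\Phi$ acting trivially on $\mathcal{H}$. When $\mathcal{H}$ is a finite family of finitely generated subgroups, $\mathrm{Mc}(\mathcal{H})$ is called a McCool group of $G$ (or of $\mathrm{Out}(G)$). *)

theory Defs
  imports "HOL-Algebra.Bij" "HOL-Algebra.Generated_Groups"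
begin

section \<open>Free groups\<close>

text \<open>
  A word over \<open>X\<close> is a list of letters; the letter \<open>(True, x)\<close> stands for \<open>x\<close> and \<open>(False, x)\<close>
  for its inverse.
\<close>

type_synonym 'a letter = "bool \<times> 'a"

definition reduced_word :: "'a letter list \<Rightarrow> bool" where
  "reduced_word = successively (\<lambda>a b. \<not> (snd a = snd b \<and> fst a \<noteq> fst b))"

definition letter_val :: "('a, 'b) monoid_scheme \<Rightarrow> 'a letter \<Rightarrow> 'a" where
  "letter_val G a = (if fst a then snd a else inv\<^bsub>G\<^esub> (snd a))"

definition word_val :: "('a, 'b) monoid_scheme \<Rightarrow> 'a letter list \<Rightarrow> 'a" where
  "word_val G w = foldr (\<lambda>a g. letter_val G a \<otimes>\<^bsub>G\<^esub> g) w \<one>\<^bsub>G\<^esub>"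

definition reduced_words :: "'a set \<Rightarrow> 'a letter list set" where
  "reduced_words X = {w \<in> lists (UNIV \<times> X). reduced_word w}"

text \<open>
  \<open>G\<close> is free on \<open>X\<close> if every element of \<open>G\<close> is the value of exactly one reduced word over \<open>X\<close>,
  i.e. if \<open>G\<close> is, via evaluation, the group of reduced words over \<open>X\<close>.
\<close>

definition free_basis :: "('a, 'b) monoid_scheme \<Rightarrow> 'a set \<Rightarrow> bool" where
  "free_basis G X \<longleftrightarrow>
     group G \<and> X \<subseteq> carrier G \<and> bij_betw (word_val G) (reduced_words X) (carrier G)"

definition free_group_of_rank :: "nat \<Rightarrow> ('a, 'b) monoid_scheme \<Rightarrow> bool" where
  "free_group_of_rank n G \<longleftrightarrow> (\<exists>X. free_basis G X \<and> finite X \<and> card X = n)"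


section \<open>Outer automorphisms\<close>

definition conj_by :: "('a, 'b) monoid_scheme \<Rightarrow> 'a \<Rightarrow> 'a \<Rightarrow> 'a" where
  "conj_by G g = (\<lambda>x\<in>carrier G. g \<otimes>\<^bsub>G\<^esub> x \<otimes>\<^bsub>G\<^esub> inv\<^bsub>G\<^esub> g)"

definition inner_auto :: "('a, 'b) monoid_scheme \<Rightarrow> ('a \<Rightarrow> 'a) set" where
  "inner_auto G = conj_by G ` carrier G"

text \<open>The elements of \<open>Out G\<close> are sets of automorphisms: the cosets of the inner ones.\<close>

definition Out :: "('a, 'b) monoid_scheme \<Rightarrow> ('a \<Rightarrow> 'a) set monoid" where
  "Out G = AutoGroup G Mod inner_auto G"


section \<open>McCool groups\<close>

definition auto_acts_trivially ::
    "('a, 'b) monoid_scheme \<Rightarrow> 'a set set \<Rightarrow> ('a \<Rightarrow> 'a) \<Rightarrow> bool" where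
  "auto_acts_trivially G \<H> \<phi> \<longleftrightarrow>
     (\<forall>H\<in>\<H>. \<exists>g\<in>carrier G. \<forall>h\<in>H. \<phi> h = g \<otimes>\<^bsub>G\<^esub> h \<otimes>\<^bsub>G\<^esub> inv\<^bsub>G\<^esub> g)"

definition Mc :: "('a, 'b) monoid_scheme \<Rightarrow> 'a set set \<Rightarrow> ('a \<Rightarrow> 'a) set set" where
  "Mc G \<H> = {\<Phi> \<in> carrier (Out G). \<exists>\<phi>\<in>\<Phi>. auto_acts_trivially G \<H> \<phi>}"

definition fin_gen_subgroup :: "('a, 'b) monoid_scheme \<Rightarrow> 'a set \<Rightarrow> bool" where
  "fin_gen_subgroup G H \<longleftrightarrow> (\<exists>S. finite S \<and> S \<subseteq> carrier G \<and> H = generate G S)"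

text \<open>
  A family enters \<open>Mc\<close> only through its set of members, so finite families are rendered as finite
  sets of subgroups.
\<close>

definition McCool_group :: "('a, 'b) monoid_scheme \<Rightarrow> ('a \<Rightarrow> 'a) set set \<Rightarrow> bool" where
  "McCool_group G M \<longleftrightarrow> (\<exists>\<H>. finite \<H> \<and> (\<forall>H\<in>\<H>. fin_gen_subgroup G H) \<and> M = Mc G \<H>)"

definition subgroup_conj_class :: "('a, 'b) monoid_scheme \<Rightarrow> 'a set \<Rightarrow> 'a set set" where
  "subgroup_conj_class K M = {k <#\<^bsub>K\<^esub> M #>\<^bsub>K\<^esub> inv\<^bsub>K\<^esub> k | k. k \<in> carrier K}"


section \<open>Basic facts\<close>

context group
begin

lemma inv_cancel:
  assumes "g \<in> carrier G" "x \<in> carrier G"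
  shows "inv g \<otimes> (g \<otimes> x) = x" "g \<otimes> (inv g \<otimes> x) = x"
  using assms by (simp_all add: m_assoc[symmetric])

lemma carrier_AutoGroup: "carrier (AutoGroup G) = auto G"
  by (simp add: AutoGroup_def)

lemma mult_AutoGroup:
  "f \<in> auto G \<Longrightarrow> g \<in> auto G \<Longrightarrow> f \<otimes>\<^bsub>AutoGroup G\<^esub> g = compose (carrier G) f g"
  by (simp add: AutoGroup_def BijGroup_def auto_def)

lemma one_AutoGroup: "\<one>\<^bsub>AutoGroup G\<^esub> = (\<lambda>x\<in>carrier G. x)"
  by (simp add: AutoGroup_def BijGroup_def)

lemma auto_closed: "f \<in> auto G \<Longrightarrow> x \<in> carrier G \<Longrightarrow> f x \<in> carrier G"
  by (auto simp: auto_def hom_def)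

lemma auto_mult:
  "f \<in> auto G \<Longrightarrow> x \<in> carrier G \<Longrightarrow> y \<in> carrier G \<Longrightarrow> f (x \<otimes> y) = f x \<otimes> f y"
  by (auto simp: auto_def hom_def)

lemma auto_inv:
  assumes "f \<in> auto G" "x \<in> carrier G"
  shows "f (inv x) = inv (f x)"
proof -
  interpret f: group_hom G G f
    using assms by unfold_locales (auto simp: auto_def)
  show ?thesis using assms by simp
qed

lemma conj_by_auto:
  assumes g: "g \<in> carrier G"
  shows "conj_by G g \<in> auto G"
proof -
  have "conj_by G g \<in> hom G G"
    using g by (auto simp: conj_by_def hom_def m_assoc inv_cancel)
  moreover have "bij_betw (conj_by G g) (carrier G) (carrier G)"
    by (rule bij_betw_byWitness[where f' = "conj_by G (inv g)"])
       (use g in \<open>auto simp: conj_by_def m_assoc inv_cancel\<close>)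
  ultimately show ?thesis
    by (simp add: auto_def Bij_def conj_by_def)
qed

lemma compose_conj_by:
  assumes "f \<in> auto G" "g \<in> carrier G"
  shows "compose (carrier G) f (conj_by G g) = compose (carrier G) (conj_by G (f g)) f"
  using assms by (auto simp: compose_def conj_by_def auto_closed auto_mult auto_inv)

lemma conj_by_hom: "conj_by G \<in> hom G (AutoGroup G)"
proof (rule homI)
  fix g h assume gh: "g \<in> carrier G" "h \<in> carrier G"
  have "conj_by G (g \<otimes> h) = compose (carrier G) (conj_by G g) (conj_by G h)"
    using gh by (auto simp: compose_def conj_by_def m_assoc inv_mult_group)
  then show "conj_by G (g \<otimes> h) = conj_by G g \<otimes>\<^bsub>AutoGroup G\<^esub> conj_by G h"
    using gh by (simp add: mult_AutoGroup conj_by_auto)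
qed (simp add: carrier_AutoGroup conj_by_auto)

lemma inner_auto_normal: "inner_auto G \<lhd> AutoGroup G"
proof -
  interpret A: group "AutoGroup G" by (rule AutoGroup)
  interpret c: group_hom G "AutoGroup G" "conj_by G"
    by unfold_locales (rule conj_by_hom)
  have "subgroup (inner_auto G) (AutoGroup G)"
    unfolding inner_auto_def by (rule c.img_is_subgroup)
  moreover have "f \<otimes>\<^bsub>AutoGroup G\<^esub> h \<otimes>\<^bsub>AutoGroup G\<^esub> inv\<^bsub>AutoGroup G\<^esub> f \<in> inner_auto G"
    if f: "f \<in> carrier (AutoGroup G)" and h: "h \<in> inner_auto G" for f h
  proof -
    from h obtain g where g: "g \<in> carrier G" "h = conj_by G g"
      by (auto simp: inner_auto_def)
    have fg: "f g \<in> carrier G"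
      using f g by (simp add: carrier_AutoGroup auto_closed)
    have "f \<otimes>\<^bsub>AutoGroup G\<^esub> h = conj_by G (f g) \<otimes>\<^bsub>AutoGroup G\<^esub> f"
      using f g fg by (simp add: carrier_AutoGroup mult_AutoGroup conj_by_auto compose_conj_by)
    then have "f \<otimes>\<^bsub>AutoGroup G\<^esub> h \<otimes>\<^bsub>AutoGroup G\<^esub> inv\<^bsub>AutoGroup G\<^esub> f = conj_by G (f g)"
      using f fg by (simp add: A.m_assoc)
    then show ?thesis using fg by (simp add: inner_auto_def)
  qed
  ultimately show ?thesis by (simp add: A.normal_inv_iff)
qed

lemma group_Out: "group (Out G)"
  unfolding Out_def by (rule normal.factorgroup_is_group[OF inner_auto_normal])

lemma auto_acts_trivially_compose:
  assumes "\<Union> \<H> \<subseteq> carrier G" "\<phi> \<in> auto G" "\<psi> \<in> auto G"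
    and "auto_acts_trivially G \<H> \<phi>" "auto_acts_trivially G \<H> \<psi>"
  shows "auto_acts_trivially G \<H> (compose (carrier G) \<phi> \<psi>)"
  unfolding auto_acts_trivially_def
proof
  fix H assume H: "H \<in> \<H>"
  obtain a where a: "a \<in> carrier G" "\<forall>h\<in>H. \<phi> h = a \<otimes> h \<otimes> inv a"
    using assms H by (auto simp: auto_acts_trivially_def)
  obtain b where b: "b \<in> carrier G" "\<forall>h\<in>H. \<psi> h = b \<otimes> h \<otimes> inv b"
    using assms H by (auto simp: auto_acts_trivially_def)
  have fb: "\<phi> b \<in> carrier G" using assms b by (simp add: auto_closed)
  have "compose (carrier G) \<phi> \<psi> h = (\<phi> b \<otimes> a) \<otimes> h \<otimes> inv (\<phi> b \<otimes> a)" if "h \<in> H" for h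
  proof -
    have h: "h \<in> carrier G" using that H assms(1) by auto
    have "compose (carrier G) \<phi> \<psi> h = \<phi> b \<otimes> \<phi> h \<otimes> inv (\<phi> b)"
      using h b that assms(2) by (simp add: compose_def auto_mult auto_inv)
    then show ?thesis
      using a that h fb by (simp add: m_assoc inv_mult_group)
  qed
  then show "\<exists>g\<in>carrier G. \<forall>h\<in>H. compose (carrier G) \<phi> \<psi> h = g \<otimes> h \<otimes> inv g"
    using a fb by (intro bexI[of _ "\<phi> b \<otimes> a"]) auto
qed

lemma auto_acts_trivially_inner:
  assumes "\<Union> \<H> \<subseteq> carrier G" "g \<in> carrier G"
  shows "auto_acts_trivially G \<H> (conj_by G g)"
  unfolding auto_acts_trivially_def
proof
  fix H assume "H \<in> \<H>"
  then have "\<forall>h\<in>H. conj_by G g h = g \<otimes> h \<otimes> inv g"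
    using assms(1) by (auto simp: conj_by_def)
  then show "\<exists>k\<in>carrier G. \<forall>h\<in>H. conj_by G g h = k \<otimes> h \<otimes> inv k"
    using assms(2) by blast
qed

lemma auto_acts_trivially_inv:
  assumes "\<Union> \<H> \<subseteq> carrier G" "\<phi> \<in> auto G" "auto_acts_trivially G \<H> \<phi>"
  shows "auto_acts_trivially G \<H> (inv\<^bsub>AutoGroup G\<^esub> \<phi>)"
  unfolding auto_acts_trivially_def
proof
  interpret A: group "AutoGroup G" by (rule AutoGroup)
  let ?\<psi> = "inv\<^bsub>AutoGroup G\<^esub> \<phi>"
  have \<psi>: "?\<psi> \<in> auto G" using assms(2) A.inv_closed carrier_AutoGroup by auto
  have "?\<psi> \<otimes>\<^bsub>AutoGroup G\<^esub> \<phi> = \<one>\<^bsub>AutoGroup G\<^esub>"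
    using assms(2) carrier_AutoGroup by simp
  then have "compose (carrier G) ?\<psi> \<phi> = (\<lambda>x\<in>carrier G. x)"
    by (simp only: mult_AutoGroup[OF \<psi> assms(2)] one_AutoGroup)
  then have id: "?\<psi> (\<phi> x) = x" if "x \<in> carrier G" for x
    using that by (metis compose_eq restrict_apply')
  fix H assume H: "H \<in> \<H>"
  obtain a where a: "a \<in> carrier G" "\<forall>h\<in>H. \<phi> h = a \<otimes> h \<otimes> inv a"
    using assms H by (auto simp: auto_acts_trivially_def)
  define b where "b = ?\<psi> a"
  have b: "b \<in> carrier G" using \<psi> a by (simp add: b_def auto_closed)
  have "?\<psi> h = inv b \<otimes> h \<otimes> inv (inv b)" if "h \<in> H" for h
  proof -
    have h: "h \<in> carrier G" using that H assms(1) by auto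
    have ph: "?\<psi> h \<in> carrier G" using \<psi> h by (simp add: auto_closed)
    have "h = ?\<psi> (a \<otimes> h \<otimes> inv a)" using id[OF h] a that by simp
    also have "\<dots> = b \<otimes> ?\<psi> h \<otimes> inv b"
      using a h \<psi> by (simp add: auto_mult auto_inv b_def)
    finally have "inv b \<otimes> h \<otimes> b = inv b \<otimes> (b \<otimes> ?\<psi> h \<otimes> inv b) \<otimes> b"
      by (rule arg_cong[where f = "\<lambda>x. inv b \<otimes> x \<otimes> b"])
    also have "\<dots> = ?\<psi> h" using b ph by (simp add: m_assoc inv_cancel)
    finally show ?thesis using b by simp
  qed
  then show "\<exists>g\<in>carrier G. \<forall>h\<in>H. ?\<psi> h = g \<otimes> h \<otimes> inv g"
    using b by (intro bexI[of _ "inv b"]) auto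
qed

lemma Out_memE:
  assumes "\<Phi> \<in> carrier (Out G)"
  obtains \<phi> where "\<phi> \<in> auto G" "\<Phi> = inner_auto G #>\<^bsub>AutoGroup G\<^esub> \<phi>"
  using assms by (auto simp: Out_def FactGroup_def RCOSETS_def carrier_AutoGroup)

text \<open>
  Acting trivially does not depend on the representative, so the existential quantifier in the
  definition of \<open>Mc\<close> could be replaced by a universal one.
\<close>

lemma auto_acts_trivially_coset:
  assumes "\<Phi> \<in> carrier (Out G)" "\<phi> \<in> \<Phi>" "\<psi> \<in> \<Phi>" "\<Union> \<H> \<subseteq> carrier G"
    and "auto_acts_trivially G \<H> \<phi>"
  shows "auto_acts_trivially G \<H> \<psi>"
proof -
  interpret A: group "AutoGroup G" by (rule AutoGroup)
  interpret N: normal "inner_auto G" "AutoGroup G" by (rule inner_auto_normal)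
  obtain \<phi>0 where \<phi>0: "\<phi>0 \<in> auto G" "\<Phi> = inner_auto G #>\<^bsub>AutoGroup G\<^esub> \<phi>0"
    using Out_memE[OF assms(1)] by metis
  have \<phi>: "\<phi> \<in> auto G"
    using assms(2) \<phi>0 A.r_coset_subset_G[OF N.subset] carrier_AutoGroup by blast
  have "\<Phi> = inner_auto G #>\<^bsub>AutoGroup G\<^esub> \<phi>"
    using A.repr_independence[OF _ _ N.subgroup_axioms] assms(2) \<phi>0 carrier_AutoGroup by simp
  then obtain c where "c \<in> inner_auto G" "\<psi> = c \<otimes>\<^bsub>AutoGroup G\<^esub> \<phi>"
    using assms(3) by (auto simp: r_coset_def)
  then obtain g where "g \<in> carrier G" "\<psi> = compose (carrier G) (conj_by G g) \<phi>"
    using \<phi> by (auto simp: inner_auto_def mult_AutoGroup conj_by_auto)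
  then show ?thesis
    using assms \<phi> by (simp add: auto_acts_trivially_compose auto_acts_trivially_inner conj_by_auto)
qed

lemma subgroup_Mc:
  assumes "\<Union> \<H> \<subseteq> carrier G"
  shows "subgroup (Mc G \<H>) (Out G)"
proof -
  interpret A: group "AutoGroup G" by (rule AutoGroup)
  interpret N: normal "inner_auto G" "AutoGroup G" by (rule inner_auto_normal)
  interpret O: group "Out G" by (rule group_Out)
  let ?q = "\<lambda>\<phi>. inner_auto G #>\<^bsub>AutoGroup G\<^esub> \<phi>"
  interpret q: group_hom "AutoGroup G" "Out G" ?q
    by unfold_locales (simp add: Out_def N.r_coset_hom_Mod)
  define T where "T = {\<phi> \<in> auto G. auto_acts_trivially G \<H> \<phi>}"
  have one: "\<one>\<^bsub>AutoGroup G\<^esub> \<in> T"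
    using assms id_in_auto by (force simp: T_def one_AutoGroup auto_acts_trivially_def)
  have "subgroup T (AutoGroup G)"
    by (rule A.subgroupI)
       (use one assms A.inv_closed A.m_closed in \<open>auto simp: T_def carrier_AutoGroup mult_AutoGroup
          auto_acts_trivially_inv auto_acts_trivially_compose\<close>)
  then have "subgroup (?q ` T) (Out G)"
    by (rule q.subgroup_img_is_subgroup)
  also have "?q ` T = Mc G \<H>"
  proof (intro equalityI subsetI)
    fix \<Phi> assume "\<Phi> \<in> ?q ` T"
    then obtain \<phi> where \<phi>: "\<phi> \<in> T" "\<Phi> = ?q \<phi>" by blast
    then have "\<Phi> \<in> carrier (Out G)" "\<phi> \<in> \<Phi>"
      using A.rcos_self[OF _ N.subgroup_axioms] by (auto simp: T_def carrier_AutoGroup)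
    then show "\<Phi> \<in> Mc G \<H>" using \<phi> by (auto simp: Mc_def T_def)
  next
    fix \<Phi> assume "\<Phi> \<in> Mc G \<H>"
    then obtain \<phi> where \<phi>: "\<Phi> \<in> carrier (Out G)" "\<phi> \<in> \<Phi>" "auto_acts_trivially G \<H> \<phi>"
      by (auto simp: Mc_def)
    obtain \<psi> where \<psi>: "\<psi> \<in> auto G" "\<Phi> = ?q \<psi>" using Out_memE[OF \<phi>(1)] by metis
    have "\<psi> \<in> \<Phi>"
      using A.rcos_self[OF _ N.subgroup_axioms] \<psi> by (auto simp: carrier_AutoGroup)
    then have "\<psi> \<in> T"
      using auto_acts_trivially_coset[OF \<phi>(1,2) _ assms \<phi>(3)] \<psi> by (simp add: T_def)
    then show "\<Phi> \<in> ?q ` T" using \<psi> by blast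
  qed
  finally show ?thesis .
qed

end

subsection \<open>Existence of free groups\<close>

text \<open>
  The group of permutations of the reduced words generated by left multiplication by letters is free.
\<close>

definition letter_act :: "'c set \<Rightarrow> 'c letter \<Rightarrow> 'c letter list \<Rightarrow> 'c letter list" where
  "letter_act X a = (\<lambda>w\<in>reduced_words X.
     if w \<noteq> [] \<and> hd w = (\<not> fst a, snd a) then tl w else a # w)"

lemma reduced_words_Nil: "[] \<in> reduced_words X"
  by (simp add: reduced_words_def reduced_word_def)

lemma reduced_words_Cons:
  "a # w \<in> reduced_words X \<longleftrightarrow>
     snd a \<in> X \<and> w \<in> reduced_words X \<and> (w = [] \<or> hd w \<noteq> (\<not> fst a, snd a))"
  by (cases w) (auto simp: reduced_words_def reduced_word_def prod_eq_iff mem_Times_iff)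

lemma letter_act_closed:
  "snd a \<in> X \<Longrightarrow> w \<in> reduced_words X \<Longrightarrow> letter_act X a w \<in> reduced_words X"
  by (cases w) (auto simp: letter_act_def reduced_words_Cons reduced_words_Nil)

lemma letter_act_cancel:
  "snd a \<in> X \<Longrightarrow> w \<in> reduced_words X \<Longrightarrow> letter_act X (\<not> fst a, snd a) (letter_act X a w) = w"
  by (cases w) (auto simp: letter_act_def reduced_words_Cons reduced_words_Nil prod_eq_iff)

lemma letter_act_Bij: "snd a \<in> X \<Longrightarrow> letter_act X a \<in> Bij (reduced_words X)"
  unfolding Bij_def
  using letter_act_closed[of a X] letter_act_closed[of "(\<not> fst a, snd a)" X]
    letter_act_cancel[of a X] letter_act_cancel[of "(\<not> fst a, snd a)" X]
  by (auto simp: letter_act_def[of X a] extensional_def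
      intro!: bij_betw_byWitness[where f' = "letter_act X (\<not> fst a, snd a)"])

theorem ex_free_group_of_rank:
  "\<exists>G :: (nat letter list \<Rightarrow> nat letter list) monoid. free_group_of_rank n G"
proof -
  define X where "X = {..<n}"
  define S where "S = reduced_words X"
  define B where "B = BijGroup S"
  interpret B: group B unfolding B_def by (rule group_BijGroup)
  let ?act = "letter_act X"
  define gen where "gen x = ?act (True, x)" for x
  define K where "K = generate B (gen ` X)"
  define G where "G = B\<lparr>carrier := K\<rparr>"
  have mult: "f \<otimes>\<^bsub>B\<^esub> g = compose S f g" if "f \<in> carrier B" "g \<in> carrier B" for f g
    using that by (simp add: B_def BijGroup_def)
  have oneB: "\<one>\<^bsub>B\<^esub> = (\<lambda>w\<in>S. w)" by (simp add: B_def BijGroup_def)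
  have act: "?act a \<in> carrier B" if "snd a \<in> X" for a
    using letter_act_Bij[OF that] by (simp add: B_def BijGroup_def S_def)
  have cancel: "?act a \<otimes>\<^bsub>B\<^esub> ?act (\<not> fst a, snd a) = \<one>\<^bsub>B\<^esub>" if "snd a \<in> X" for a
    using that act letter_act_cancel[of "(\<not> fst a, snd a)" X]
    by (auto simp: mult oneB compose_def S_def)
  have inv_act: "inv\<^bsub>B\<^esub> (gen x) = ?act (False, x)" if "x \<in> X" for x
    using cancel[of "(False, x)"] that act by (auto simp: gen_def intro!: B.inv_equality)
  have genB: "gen ` X \<subseteq> carrier B" using act by (auto simp: gen_def)
  have K: "subgroup K B" unfolding K_def by (rule B.generate_is_subgroup[OF genB])
  interpret G: group G unfolding G_def by (rule B.subgroup_imp_group[OF K])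
  define val where "val w = foldr (\<lambda>a g. ?act a \<otimes>\<^bsub>B\<^esub> g) w \<one>\<^bsub>B\<^esub>" for w
  have val_Cons: "val (a # w) = ?act a \<otimes>\<^bsub>B\<^esub> val w" for a w by (simp add: val_def)
  have val_closed: "val w \<in> carrier B" if "w \<in> S" for w
    using that by (induction w) (auto simp: val_def S_def reduced_words_Cons act)
  have val_Nil: "val w [] = w" if "w \<in> S" for w
    using that
  proof (induction w)
    case Nil
    then show ?case by (simp add: val_def oneB)
  next
    case (Cons a w)
    then have "w \<in> S" "snd a \<in> X" by (auto simp: S_def reduced_words_Cons)
    then have "val (a # w) [] = ?act a (val w [])"
      by (simp add: val_Cons mult act val_closed compose_def) (simp add: S_def reduced_words_Nil)
    with Cons show ?case
      by (auto simp: letter_act_def S_def reduced_words_Cons reduced_words_Nil)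
  qed
  have act_val: "?act a \<otimes>\<^bsub>B\<^esub> val w = val (?act a w)" if "snd a \<in> X" "w \<in> S" for a w
  proof (cases "w \<noteq> [] \<and> hd w = (\<not> fst a, snd a)")
    case True
    then obtain v where v: "w = (\<not> fst a, snd a) # v" by (cases w) auto
    then have "v \<in> S" using that by (auto simp: S_def reduced_words_Cons)
    then have "?act a \<otimes>\<^bsub>B\<^esub> val w = val v"
      using that cancel[of a] act by (simp add: v val_Cons val_closed flip: B.m_assoc)
    then show ?thesis using that v by (simp add: letter_act_def S_def)
  next
    case False
    then show ?thesis using that by (auto simp: letter_act_def S_def val_Cons)
  qed
  have K_val: "k w \<in> S \<and> k \<in> carrier B \<and> k \<otimes>\<^bsub>B\<^esub> val w = val (k w)"
    if "k \<in> K" "w \<in> S" for k w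
    using that unfolding K_def
  proof (induction arbitrary: w rule: generate.induct)
    case one
    then show ?case by (simp add: val_closed) (simp add: oneB)
  next
    case (incl h)
    then show ?case using act_val act letter_act_closed by (auto simp: gen_def S_def)
  next
    case (inv h)
    then show ?case using act_val act letter_act_closed by (auto simp: inv_act S_def)
  next
    case (eng h1 h2)
    then show ?case by (simp add: val_closed B.m_assoc) (simp add: mult compose_def)
  qed
  define lift where "lift = map (map_prod (id :: bool \<Rightarrow> bool) gen)"
  have inj_gen: "inj_on gen X"
  proof (rule inj_onI)
    fix x y assume "gen x = gen y"
    then have "gen x [] = gen y []" by simp
    then show "x = y" by (simp add: gen_def letter_act_def reduced_words_Nil)
  qed
  have lift_reduced: "lift w \<in> reduced_words (gen ` X)" if "w \<in> S" for w
    using that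
  proof (induction w)
    case Nil
    then show ?case by (simp add: lift_def reduced_words_Nil)
  next
    case (Cons a w)
    then show ?case
      by (cases w) (auto simp: lift_def S_def reduced_words_Cons reduced_words_Nil prod_eq_iff
          dest: inj_onD[OF inj_gen])
  qed
  have lift_surj: "u \<in> lift ` S" if "u \<in> reduced_words (gen ` X)" for u
    using that
  proof (induction u)
    case Nil
    have "[] \<in> S" "lift [] = []" by (auto simp: S_def reduced_words_Nil lift_def)
    then show ?case by (metis imageI)
  next
    case (Cons a u)
    then obtain w x where w: "w \<in> S" "u = lift w" "x \<in> X" "snd a = gen x"
      by (auto simp: reduced_words_Cons)
    have "(fst a, x) # w \<in> S"
      using w Cons.prems
      by (cases w) (auto simp: lift_def S_def reduced_words_Cons reduced_words_Nil prod_eq_iff)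
    moreover have "lift ((fst a, x) # w) = a # u" using w by (simp add: lift_def prod_eq_iff)
    ultimately show ?case by (metis imageI)
  qed
  have "bij_betw lift S (reduced_words (gen ` X))"
  proof (rule bij_betw_imageI)
    have "\<Union> (set ` S) \<subseteq> UNIV \<times> X"
      by (auto simp: S_def reduced_words_def)
    then show "inj_on lift S"
      unfolding lift_def
      by (intro inj_on_mapI inj_on_subset[OF map_prod_inj_on[OF inj_on_id inj_gen]])
    show "lift ` S = reduced_words (gen ` X)" using lift_reduced lift_surj by blast
  qed
  moreover have "bij_betw (word_val G \<circ> lift) S (carrier G)"
  proof -
    have gen_K: "gen x \<in> K" if "x \<in> X" for x
      using that by (simp add: K_def generate.incl)
    have letter: "letter_val G (e, gen x) = ?act (e, x)" if "x \<in> X" for e x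
      using that gen_K[OF that] B.m_inv_consistent[OF K gen_K[OF that]]
      by (simp add: letter_val_def G_def inv_act) (simp add: gen_def)
    have wv: "word_val G (lift w) = val w" if "w \<in> S" for w
      using that
    proof (induction w)
      case Nil
      then show ?case by (simp add: word_val_def lift_def val_def G_def)
    next
      case (Cons a w)
      then have "w \<in> S" "snd a \<in> X" by (auto simp: S_def reduced_words_Cons)
      then show ?case using Cons letter[of "snd a" "fst a"]
        by (cases a) (auto simp: word_val_def lift_def val_def G_def)
    qed
    have act_K: "?act a \<in> K" if "snd a \<in> X" for a
      using that generate.incl[of "gen (snd a)" "gen ` X" B] generate.inv[of "gen (snd a)" "gen ` X" B]
      by (cases a; cases "fst a") (auto simp: K_def inv_act, auto simp: gen_def)
    have val_K: "val w \<in> K" if "w \<in> S" for w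
      using that
      by (induction w) (auto simp: val_def S_def reduced_words_Cons act_K
          subgroup.one_closed[OF K] subgroup.m_closed[OF K])
    have "bij_betw val S K"
    proof (rule bij_betw_byWitness[where f' = "\<lambda>k. k []"])
      have Nil: "[] \<in> S" by (simp add: S_def reduced_words_Nil)
      show "\<forall>w\<in>S. val w [] = w" by (simp add: val_Nil)
      show "\<forall>k\<in>K. val (k []) = k"
        using K_val[OF _ Nil] by (force simp: val_def)
      show "val ` S \<subseteq> K" using val_K by blast
      show "(\<lambda>k. k []) ` K \<subseteq> S" using K_val[OF _ Nil] by blast
    qed
    moreover have "carrier G = K" by (simp add: G_def)
    ultimately show ?thesis
      using bij_betw_cong[of S "word_val G \<circ> lift" val K] wv by simp
  qed
  ultimately have "bij_betw (word_val G) (reduced_words (gen ` X)) (carrier G)"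
    by (simp add: bij_betw_comp_iff)
  moreover have "gen ` X \<subseteq> carrier G"
    by (auto simp: G_def K_def generate.incl)
  ultimately have "free_basis G (gen ` X)"
    using G.group_axioms by (simp add: free_basis_def)
  moreover have "finite (gen ` X)" "card (gen ` X) = n"
    using inj_gen by (auto simp: X_def card_image)
  ultimately show ?thesis unfolding free_group_of_rank_def by blast
qed

end

theory Submission
  imports Defs
begin

text \<open>
  Acting on the abelianization embeds \<open>Out F\<^sub>2\<close> into the group of integer matrices of determinant
  \<open>\<plusminus>1\<close> (by Nielsen reduction, only inner automorphisms act trivially), so a McCool group is a matrix group \<open>M\<close>,
  and the theorem follows from three facts.
  If \<open>M\<close> contains a hyperbolic matrix, then up to conjugacy it contains a product of the elementary
  automorphisms \<open>a \<mapsto> ab\<close> and \<open>b \<mapsto> ba\<close> in which both occur. Counting letters between the sign changes of a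
  cyclic word shows that such an automorphism preserves only the conjugacy classes of powers of the commutator;
  hence the family is peripheral and \<open>M\<close> contains every matrix of determinant 1.
  If \<open>M\<close> contains a parabolic matrix but no hyperbolic one, it contains up to conjugacy a power of
  \<open>a \<mapsto> ab\<close>, and then this automorphism itself: where a power of it is a conjugation, so is the automorphism.
  Hence \<open>M\<close> is a group of triangular matrices determined by its diagonals.
  Otherwise \<open>M\<close> embeds into the matrices modulo 3, so it is finite, preserves a definite form, and by reduction
  theory is conjugate to a group of matrices with entries in \<open>{-1, 0, 1}\<close>.
\<close>

section \<open>The free group on two letters\<close>

text \<open>The classification of the matrix groups uses only the properties of a family that are
  collected in \<open>admissible\<close>; two of them let one automorphism that is a conjugation on
  every member force this for others. Two obstacles shape their proofs. That a hyperbolic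
  automorphism preserves few conjugacy classes is usually seen on the once-punctured torus. Here it
  becomes linear algebra: once the automorphism is conjugated into the positive monoid, the numbers
  of letters of a run, each diminished by 1, transform by its matrix, which does not have the
  eigenvalue 1. The second obstacle is that preserved conjugacy classes do not yield one conjugator
  for a whole subgroup. Uniqueness of roots bridges this gap, together with a bound on surviving
  letters in the parabolic case and with the Heisenberg group in the hyperbolic case. Determinant -1
  and negative traces are dealt with by squaring.\<close>

abbreviation linv :: "bool letter \<Rightarrow> bool letter" where
  "linv a \<equiv> (\<not> fst a, snd a)"

lemma reduced_word_Nil [simp]: "reduced_word []"
  by (simp add: reduced_word_def)

lemma reduced_word_Cons:
  "reduced_word (a # w) \<longleftrightarrow> reduced_word w \<and> (w = [] \<or> hd w \<noteq> (\<not> fst a, snd a))"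
  by (cases w) (auto simp: reduced_word_def prod_eq_iff)

lemma reduced_word_append:
  "reduced_word (u @ v) \<longleftrightarrow>
     reduced_word u \<and> reduced_word v \<and> (u = [] \<or> v = [] \<or> hd v \<noteq> (\<not> fst (last u), snd (last u)))"
  by (induction u) (auto simp: reduced_word_Cons hd_append)

definition lcons :: "bool letter \<Rightarrow> bool letter list \<Rightarrow> bool letter list" where
  "lcons a w = (if w \<noteq> [] \<and> hd w = linv a then tl w else a # w)"

definition winv :: "bool letter list \<Rightarrow> bool letter list" where
  "winv w = rev (map linv w)"

lemma reduced_lcons: "reduced_word w \<Longrightarrow> reduced_word (lcons a w)"
  by (cases w) (auto simp: lcons_def reduced_word_Cons)

lemma lcons_linv: "reduced_word w \<Longrightarrow> lcons (linv a) (lcons a w) = w"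
  by (cases w) (auto simp: lcons_def reduced_word_Cons prod_eq_iff)

lemma reduced_foldr_lcons: "reduced_word w \<Longrightarrow> reduced_word (foldr lcons u w)"
  by (induction u) (auto simp: reduced_lcons)

lemma foldr_lcons_reduced: "reduced_word (u @ v) \<Longrightarrow> foldr lcons u v = u @ v"
proof (induction u)
  case (Cons x u)
  then have "foldr lcons u v = u @ v" "u @ v = [] \<or> hd (u @ v) \<noteq> linv x"
    by (auto simp: reduced_word_Cons)
  then have "lcons x (u @ v) = x # u @ v" unfolding lcons_def by auto
  then show ?case using \<open>foldr lcons u v = u @ v\<close> by simp
qed simp

text \<open>A letter and its inverse act on reduced words as mutually inverse maps, so a
  cancellation inside the acting word does not change the action. Associativity of the reduced
  product rests on this.\<close>

lemma foldr_lcons_lcons: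
  assumes "reduced_word w"
  shows "foldr lcons (lcons x u) w = lcons x (foldr lcons u w)"
proof (cases "u \<noteq> [] \<and> hd u = linv x")
  case True
  then obtain v where v: "u = linv x # v" by (cases u) auto
  have "lcons x (lcons (linv x) (foldr lcons v w)) = foldr lcons v w"
    using lcons_linv[OF reduced_foldr_lcons[OF assms], of "linv x" v] by simp
  then show ?thesis by (simp add: v lcons_def[of x "linv x # v"])
qed (auto simp: lcons_def)

lemma foldr_lcons_foldr:
  "reduced_word w \<Longrightarrow> foldr lcons (foldr lcons u v) w = foldr lcons u (foldr lcons v w)"
  by (induction u) (auto simp: foldr_lcons_lcons)

lemma winv_simps [simp]:
  "winv [] = []" "winv (u @ v) = winv v @ winv u" "winv (winv u) = u" "length (winv u) = length u"
  "winv u = [] \<longleftrightarrow> u = []" "winv [a] = [linv a]"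
  by (auto simp: winv_def rev_map comp_def)

lemma winv_Cons [simp]: "winv (a # u) = winv u @ [linv a]"
  by (simp add: winv_def)

lemma hd_winv: "u \<noteq> [] \<Longrightarrow> hd (winv u) = linv (last u)"
  by (simp add: winv_def hd_rev last_map)

lemma last_winv: "u \<noteq> [] \<Longrightarrow> last (winv u) = linv (hd u)"
  by (simp add: winv_def last_rev hd_map)

lemma reduced_winv [simp]: "reduced_word (winv u) \<longleftrightarrow> reduced_word u"
proof -
  have "reduced_word u \<Longrightarrow> reduced_word (winv u)" for u
    by (induction u) (auto simp: reduced_word_Cons reduced_word_append last_winv prod_eq_iff)
  from this[of u] this[of "winv u"] show ?thesis by auto
qed

lemma foldr_lcons_winv: "reduced_word w \<Longrightarrow> foldr lcons (winv u) (foldr lcons u w) = w"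
  by (induction u arbitrary: w) (auto simp: lcons_linv reduced_foldr_lcons)

text \<open>A type of class \<open>group_add\<close> (which is not commutative) makes the group laws
  available to the simplifier; \<open>rep\<close> returns the reduced word on which all length
  arguments operate.\<close>

typedef f2 = "{w :: bool letter list. reduced_word w}" morphisms rep Abs_f2
  by (rule exI[of _ "[]"]) simp

setup_lifting type_definition_f2

lift_definition wd :: "bool letter list \<Rightarrow> f2" is "\<lambda>w. foldr lcons w []"
  by (simp add: reduced_foldr_lcons)

instantiation f2 :: group_add
begin
lift_definition zero_f2 :: f2 is "[]" by simp
lift_definition plus_f2 :: "f2 \<Rightarrow> f2 \<Rightarrow> f2" is "\<lambda>u v. foldr lcons u v"
  by (simp add: reduced_foldr_lcons)
lift_definition uminus_f2 :: "f2 \<Rightarrow> f2" is winv by simp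
definition minus_f2 :: "f2 \<Rightarrow> f2 \<Rightarrow> f2" where "minus_f2 x y = x + - y"
instance
proof
  fix x y z :: f2
  show "x + y + z = x + (y + z)" by transfer (simp add: foldr_lcons_foldr)
  show "0 + x = x" by transfer simp
  show "x + 0 = x" by transfer (use foldr_lcons_reduced[of _ "[]"] in simp)
  show "- x + x = 0"
  proof transfer
    fix u :: "bool letter list" assume "reduced_word u"
    then show "foldr lcons (winv u) u = []"
      using foldr_lcons_winv[of "[]" u] foldr_lcons_reduced[of u "[]"] by simp
  qed
  show "x + - y = x - y" by (simp add: minus_f2_def)
qed
end

lemma reduced_rep [simp]: "reduced_word (rep x)"
  using rep by simp

lemma rep_0 [simp]: "rep 0 = []" by (rule zero_f2.rep_eq)

lemma rep_eq_Nil [simp]: "rep x = [] \<longleftrightarrow> x = 0"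
  by transfer simp

lemma rep_uminus [simp]: "rep (- x) = winv (rep x)" by (rule uminus_f2.rep_eq)

lemma wd_rep [simp]: "wd (rep x) = x"
  by transfer (use foldr_lcons_reduced[of _ "[]"] in simp)

lemma rep_wd: "reduced_word w \<Longrightarrow> rep (wd w) = w"
  using foldr_lcons_reduced[of w "[]"] by (simp add: wd.rep_eq)

lemma wd_Nil [simp]: "wd [] = 0" by transfer simp

lemma wd_append: "wd (u @ v) = wd u + wd v"
proof (transfer)
  fix u v :: "bool letter list"
  show "foldr lcons (u @ v) [] = foldr lcons (foldr lcons u []) (foldr lcons v [])"
    using foldr_lcons_foldr[of "foldr lcons v []" u "[]"] by (simp add: reduced_foldr_lcons)
qed

lemma wd_Cons: "wd (l # v) = wd [l] + wd v"
  using wd_append[of "[l]" v] by simp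

lemma wd_winv: "wd (winv u) = - wd u"
proof -
  have "wd (winv u) + wd u = 0"
    unfolding wd_append[symmetric] by transfer (simp add: foldr_lcons_winv)
  then show ?thesis by (metis minus_unique minus_minus)
qed

lemma rep_plus_reduced: "reduced_word (rep x @ rep y) \<Longrightarrow> rep (x + y) = rep x @ rep y"
  by (simp add: plus_f2.rep_eq foldr_lcons_reduced)

text \<open>In a product of reduced words only a suffix \<open>c\<close> of the first cancels
  against a prefix of the second. All estimates of lengths and letter counts of a sum start from
  this splitting.\<close>

lemma rep_plus_split:
  obtains p c q where "rep x = p @ c" "rep y = winv c @ q" "reduced_word (p @ q)" "rep (x + y) = p @ q"
proof -
  have "\<exists>p c q. u = p @ c \<and> v = winv c @ q \<and> reduced_word (p @ q)"
    if "reduced_word u" "reduced_word v" for u v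
    using that
  proof (induction u arbitrary: v rule: rev_induct)
    case Nil
    show ?case
      by (rule exI[of _ "[]"], rule exI[of _ "[]"], rule exI[of _ v]) (use Nil in simp)
  next
    case (snoc l u)
    show ?case
    proof (cases "v \<noteq> [] \<and> hd v = linv l")
      case True
      then obtain v' where v': "v = linv l # v'" by (cases v) auto
      have "reduced_word u" "reduced_word v'"
        using snoc.prems v' by (simp_all add: reduced_word_append reduced_word_Cons)
      from snoc.IH[OF this] obtain p c q
        where pcq: "u = p @ c" "v' = winv c @ q" "reduced_word (p @ q)" by (elim exE conjE)
      show ?thesis
        by (rule exI[of _ p], rule exI[of _ "c @ [l]"], rule exI[of _ q]) (use pcq v' in simp)
    next
      case False
      then have red: "reduced_word ((u @ [l]) @ v)"
        using snoc.prems by (auto simp: reduced_word_append reduced_word_Cons)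
      show ?thesis
        by (rule exI[of _ "u @ [l]"], rule exI[of _ "[]"], rule exI[of _ v]) (use red in simp)
    qed
  qed
  from this[OF reduced_rep reduced_rep, of x y] obtain p c q where
    *: "rep x = p @ c" "rep y = winv c @ q" "reduced_word (p @ q)"
    by (elim exE conjE)
  have "x + y = wd (p @ c) + wd (winv c @ q)" by (simp only: *(1,2)[symmetric] wd_rep)
  also have "\<dots> = wd (p @ q)" by (simp add: wd_append wd_winv add.assoc)
  finally have "rep (x + y) = p @ q" using *(3) by (simp add: rep_wd)
  with * show ?thesis by (rule that)
qed

section \<open>Generators, homomorphisms and the universal property\<close>

definition gen :: "bool \<Rightarrow> f2" where "gen g = wd [(True, g)]"

lemma rep_gen: "rep (gen g) = [(True, g)]"
  by (simp add: gen_def rep_wd reduced_word_Cons)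

lemma wd_single: "wd [l] = (if fst l then gen (snd l) else - gen (snd l))"
  using wd_winv[of "[(True, snd l)]"] by (cases l; cases "fst l") (simp_all add: gen_def)

text \<open>The target is an arbitrary \<open>group_add\<close>, so that endomorphisms, exponent
  sums and the map to the Heisenberg group are all instances.\<close>

definition lift :: "(bool \<Rightarrow> 'g::group_add) \<Rightarrow> f2 \<Rightarrow> 'g" where
  "lift f x = sum_list (map (\<lambda>l. if fst l then f (snd l) else - f (snd l)) (rep x))"

definition ghom :: "('g::group_add \<Rightarrow> 'h::group_add) \<Rightarrow> bool" where
  "ghom f \<longleftrightarrow> (\<forall>x y. f (x + y) = f x + f y)"

lemma ghomI: "(\<And>x y. f (x + y) = f x + f y) \<Longrightarrow> ghom f" by (simp add: ghom_def)

lemma ghom_plus: "ghom f \<Longrightarrow> f (x + y) = f x + f y" by (simp add: ghom_def)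

lemma ghom_zero: "ghom f \<Longrightarrow> f 0 = 0"
proof -
  assume "ghom f"
  then have "f (0 + 0) = f 0 + f 0" by (rule ghom_plus)
  then have "f 0 + f 0 = f 0 + 0" by (simp only: add_0_left add_0_right)
  then show "f 0 = 0" by (rule add_left_imp_eq)
qed

lemma ghom_uminus: "ghom f \<Longrightarrow> f (- x) = - f x"
proof -
  assume h: "ghom f"
  have "f x + f (- x) = f (x + - x)" by (rule ghom_plus[OF h, symmetric])
  also have "\<dots> = 0" by (simp add: ghom_zero[OF h])
  finally show "f (- x) = - f x" by (rule minus_unique[symmetric])
qed

lemma ghom_minus: "ghom f \<Longrightarrow> f (x - y) = f x - f y"
  using ghom_plus[of f x "- y"] ghom_uminus[of f y] by (simp only: diff_conv_add_uminus)

lemmas ghom_simps = ghom_plus ghom_zero ghom_uminus ghom_minus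

lemma ghom_comp: "ghom f \<Longrightarrow> ghom g \<Longrightarrow> ghom (f \<circ> g)"
  by (simp add: ghom_def)

lemma ghom_lift: "ghom (lift f)"
proof (rule ghomI)
  fix x y
  define S where "S w = sum_list (map (\<lambda>l. if fst l then f (snd l) else - f (snd l)) w)" for w
  have app: "S (u @ v) = S u + S v" for u v by (simp add: S_def)
  have inv: "S (winv c) = - S c" for c
  proof (induction c)
    case (Cons l c)
    have "S (l # c) = S [l] + S c" "S [linv l] = - S [l]" by (simp_all add: S_def)
    then show ?case by (simp only: winv_Cons app Cons minus_add)
  qed (simp add: S_def)
  obtain p c q where eq: "rep x = p @ c" "rep y = winv c @ q" "rep (x + y) = p @ q"
    by (rule rep_plus_split)
  have "lift f z = S (rep z)" for z by (simp add: S_def lift_def)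
  then show "lift f (x + y) = lift f x + lift f y"
    by (simp only: eq app inv add.assoc add_minus_cancel minus_add_cancel)
qed

lemma lift_gen [simp]: "lift f (gen g) = f g"
  by (simp add: lift_def rep_gen)

lemma ghom_wd_eq:
  assumes "ghom f" "ghom f'" "\<And>g. f (gen g) = f' (gen g)"
  shows "f (wd w) = f' (wd w)"
proof (induction w)
  case Nil
  then show ?case by (simp add: ghom_zero[OF assms(1)] ghom_zero[OF assms(2)])
next
  case (Cons l w)
  then have "f (wd [l] + wd w) = f' (wd [l] + wd w)"
    by (simp add: ghom_simps[OF assms(1)] ghom_simps[OF assms(2)] assms(3) wd_single)
  then show ?case by (simp only: wd_Cons[of l w])
qed

lemma ghom_eqI:
  assumes "ghom f" "ghom f'" "f (gen True) = f' (gen True)" "f (gen False) = f' (gen False)"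
  shows "f = f'"
proof
  fix x
  have "f (gen g) = f' (gen g)" for g using assms by (cases g) auto
  from ghom_wd_eq[OF assms(1,2) this, of "rep x"] show "f x = f' x" by simp
qed

section \<open>Powers, conjugates and centralizers\<close>

lemmas grp = add.assoc minus_add diff_conv_add_uminus

primrec nm :: "nat \<Rightarrow> 'g::monoid_add \<Rightarrow> 'g" where
  "nm 0 x = 0" | "nm (Suc n) x = x + nm n x"

definition zm :: "int \<Rightarrow> 'g::group_add \<Rightarrow> 'g" where
  "zm k x = (if 0 \<le> k then nm (nat k) x else - nm (nat (- k)) x)"

definition cj :: "'g::group_add \<Rightarrow> 'g \<Rightarrow> 'g" where "cj g x = g + x - g"

lemma nm_comm: "nm n x + x = x + nm n x"
  by (induction n) (simp_all add: add.assoc)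

lemma nm_add: "nm (m + n) x = nm m x + nm n x"
  by (induction m) (simp_all add: add.assoc)

lemma nm_zero [simp]: "nm n 0 = 0"
  by (induction n) simp_all

lemma zm_succ: "zm (i + 1) x = x + zm i x"
proof -
  consider "i \<ge> 0" | "i = - 1" | "i < - 1" by linarith
  then show ?thesis
  proof cases
    case 1
    then have "nat (i + 1) = Suc (nat i)" by simp
    with 1 show ?thesis by (simp add: zm_def)
  next
    case 2
    then show ?thesis by (simp add: zm_def)
  next
    case 3
    define n where "n = nat (- (i + 1))"
    have n: "nat (- i) = Suc n" using 3 by (simp add: n_def)
    have "zm i x = - (nm n x + x)" using 3 by (simp add: zm_def n nm_comm)
    moreover have "zm (i + 1) x = - nm n x" using 3 by (simp add: zm_def n_def)
    ultimately show ?thesis by (simp only: minus_add add_minus_cancel)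
  qed
qed

lemma zm_0 [simp]: "zm 0 x = 0" and zm_1 [simp]: "zm 1 x = x"
  by (simp_all add: zm_def)

lemma zm_add: "zm (i + j) x = zm i x + zm j x"
proof (induction i rule: int_induct[where k = 0])
  case base
  then show ?case by simp
next
  case (step1 i)
  have "zm (i + 1 + j) x = x + zm (i + j) x" using zm_succ[of "i + j" x] by (simp add: ac_simps)
  then show ?case by (simp only: step1 zm_succ add.assoc)
next
  case (step2 i)
  have "x + zm (i - 1 + j) x = zm (i + j) x" using zm_succ[of "i - 1 + j" x] by simp
  also have "\<dots> = zm i x + zm j x" by (rule step2)
  also have "zm i x = x + zm (i - 1) x" using zm_succ[of "i - 1" x] by simp
  finally show ?case by (simp only: add.assoc add_left_cancel)
qed

lemma zm_uminus: "zm (- i) x = - zm i x"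
proof -
  have "zm i x + zm (- i) x = 0" by (simp flip: zm_add)
  then show ?thesis by (rule minus_unique[symmetric])
qed

lemma zm_diff: "zm (i - j) x = zm i x - zm j x"
  using zm_add[of i "- j" x] by (simp add: zm_uminus)

lemma zm_of_nat: "zm (int n) x = nm n x"
  by (simp add: zm_def)

lemma zm_comm: "zm i x + zm j x = zm j x + zm i x"
  by (simp add: add.commute flip: zm_add)

lemma zm_mult: "zm (i * j) x = zm i (zm j x)"
proof (induction i rule: int_induct[where k = 0])
  case base
  then show ?case by simp
next
  case (step1 i)
  have "zm ((i + 1) * j) x = zm j x + zm (i * j) x" by (simp add: algebra_simps flip: zm_add)
  then show ?case by (simp only: step1 zm_succ)
next
  case (step2 i)
  have "zm j x + zm ((i - 1) * j) x = zm (i * j) x" by (simp add: algebra_simps flip: zm_add)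
  also have "\<dots> = zm j x + zm (i - 1) (zm j x)"
    using step2 zm_succ[of "i - 1" "zm j x"] by simp
  finally show ?case by (simp only: add_left_cancel)
qed

lemma nm_commutes: "y + x = x + y \<Longrightarrow> y + nm n x = nm n x + y"
proof (induction n)
  case (Suc n)
  have "y + nm (Suc n) x = (y + x) + nm n x" by (simp add: add.assoc)
  also have "\<dots> = x + (y + nm n x)" using Suc.prems by (simp add: add.assoc)
  also have "\<dots> = nm (Suc n) x + y" using Suc by (simp add: add.assoc)
  finally show ?case .
qed simp

lemma uminus_commutes:
  fixes x :: "'g::group_add"
  assumes "y + x = x + y" shows "y + - x = - x + y"
proof -
  have "- x + (x + y) + - x = - x + (y + x) + - x" by (simp only: assms)
  then show ?thesis
    by (simp only: minus_add_cancel add.assoc add.right_inverse add_0_right)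
qed

lemma ghom_nm: "ghom f \<Longrightarrow> f (nm n x) = nm n (f x)"
  by (induction n) (simp_all add: ghom_zero ghom_plus)

lemma ghom_zm: "ghom f \<Longrightarrow> f (zm n x) = zm n (f x)"
  by (simp add: zm_def ghom_nm ghom_uminus)

lemma ghom_cj: "ghom (cj g)"
  by (rule ghomI) (simp add: cj_def grp del: add_uminus_conv_diff)

lemma cj_cj: "cj g (cj h x) = cj (g + h) x"
  by (simp add: cj_def grp del: add_uminus_conv_diff)

lemma cj_0 [simp]: "cj 0 x = x" and cj_zero [simp]: "cj g 0 = 0"
  by (simp_all add: cj_def)

lemma cj_uminus_cj [simp]: "cj (- g) (cj g x) = x" "cj g (cj (- g) x) = x"
  by (simp_all add: cj_cj)

lemma cj_eq_iff: "cj g x = x \<longleftrightarrow> g + x = x + g"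
  by (auto simp: cj_def diff_eq_eq)

lemma cj_inject [simp]: "cj g x = cj g y \<longleftrightarrow> x = y"
  by (metis cj_uminus_cj(1))

lemma ghom_apply_cj: "ghom f \<Longrightarrow> f (cj g x) = cj (f g) (f x)"
  by (simp add: cj_def ghom_plus ghom_minus)

section \<open>Lengths, letter counts and cyclically reduced words\<close>

definition len :: "f2 \<Rightarrow> nat" where "len x = length (rep x)"

definition lcnt :: "bool \<Rightarrow> bool letter list \<Rightarrow> nat" where
  "lcnt g w = length (filter (\<lambda>l. snd l = g) w)"

definition cnt :: "bool \<Rightarrow> f2 \<Rightarrow> nat" where "cnt g x = lcnt g (rep x)"

lemma lcnt_simps [simp]:
  "lcnt g [] = 0" "lcnt g (u @ v) = lcnt g u + lcnt g v"
  "lcnt g (l # v) = (if snd l = g then 1 else 0) + lcnt g v"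
  by (simp_all add: lcnt_def)

lemma lcnt_winv [simp]: "lcnt g (winv u) = lcnt g u"
  by (induction u) simp_all

lemma lcnt_concat_replicate: "lcnt g (concat (replicate n u)) = n * lcnt g u"
  by (induction n) simp_all

lemma cnt_plus_le: "cnt g (x + y) \<le> cnt g x + cnt g y"
proof -
  obtain p c q where "rep x = p @ c" "rep y = winv c @ q" "rep (x + y) = p @ q"
    by (rule rep_plus_split)
  then show ?thesis by (simp add: cnt_def)
qed

lemma len_plus_le: "len (x + y) \<le> len x + len y"
proof -
  obtain p c q where "rep x = p @ c" "rep y = winv c @ q" "rep (x + y) = p @ q"
    by (rule rep_plus_split)
  then show ?thesis by (simp add: len_def)
qed

lemma cnt_uminus [simp]: "cnt g (- x) = cnt g x" and len_uminus [simp]: "len (- x) = len x"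
  by (simp_all add: cnt_def len_def)

lemma len_0 [simp]: "len 0 = 0" and cnt_0 [simp]: "cnt g 0 = 0"
  by (simp_all add: len_def cnt_def)

lemma len_eq_0 [simp]: "len x = 0 \<longleftrightarrow> x = 0"
  by (simp add: len_def)

lemma finite_len_le: "finite {x. len x \<le> B}"
proof -
  have "rep ` {x. len x \<le> B} \<subseteq> {w. set w \<subseteq> UNIV \<and> length w \<le> B}" by (auto simp: len_def)
  moreover have "finite {w :: bool letter list. set w \<subseteq> UNIV \<and> length w \<le> B}"
    by (rule finite_lists_length_le) simp
  ultimately have "finite (rep ` {x. len x \<le> B})" by (rule finite_subset)
  then show ?thesis by (rule finite_imageD) (simp add: inj_on_def rep_inject)
qed

lemma nat_pigeonhole:
  fixes f :: "nat \<Rightarrow> 'x"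
  assumes "finite S" "\<And>n. f n \<in> S"
  obtains i j where "i < j" "f i = f j"
proof -
  have "finite (range f)" using assms by (meson finite_subset image_subsetI)
  then have "\<not> inj f" using finite_imageD infinite_UNIV_nat by blast
  then obtain i j where "f i = f j" "i \<noteq> j" by (auto simp: inj_def)
  then show ?thesis using that by (metis nat_neq_iff)
qed

text \<open>The nonempty cyclically reduced words: exactly those whose powers are formed without
  cancellation.\<close>

definition cyc :: "bool letter list \<Rightarrow> bool" where
  "cyc w \<longleftrightarrow> w \<noteq> [] \<and> reduced_word w \<and> hd w \<noteq> linv (last w)"

lemma concat_replicate_ends:
  "n > 0 \<Longrightarrow> w \<noteq> [] \<Longrightarrow>
    concat (replicate n w) \<noteq> [] \<and> hd (concat (replicate n w)) = hd w \<and> last (concat (replicate n w)) = last w"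
proof (induction n)
  case (Suc n)
  then show ?case by (cases "n = 0") (auto simp: hd_append last_append)
qed simp

lemma reduced_concat_replicate: "cyc w \<Longrightarrow> reduced_word (concat (replicate n w))"
proof (induction n)
  case (Suc n)
  then show ?case
    using concat_replicate_ends[of n w] by (cases "n = 0") (auto simp: cyc_def reduced_word_append)
qed simp

lemma cyc_concat_replicate:
  assumes "cyc w" "n > 0"
  shows "cyc (concat (replicate n w))"
proof -
  have "w \<noteq> []" "hd w \<noteq> linv (last w)" using assms(1) by (simp_all add: cyc_def)
  then show ?thesis
    using concat_replicate_ends[OF assms(2), of w] reduced_concat_replicate[OF assms(1), of n]
    unfolding cyc_def by presburger
qed

lemma reduced_conj_power:
  assumes "reduced_word (s @ u @ winv s)" "cyc u" "n > 0"
  shows "reduced_word (s @ concat (replicate n u) @ winv s)"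
  using assms reduced_concat_replicate[OF assms(2), of n] concat_replicate_ends[of n u]
  by (auto simp: reduced_word_append cyc_def hd_append)

lemma wd_concat_replicate: "wd (concat (replicate n w)) = nm n (wd w)"
  by (induction n) (simp_all add: wd_append)

lemma cyclic_decomposition:
  "reduced_word w \<Longrightarrow> w \<noteq> [] \<Longrightarrow> \<exists>s u. w = s @ u @ winv s \<and> cyc u"
proof (induction "length w" arbitrary: w rule: less_induct)
  case less
  show ?case
  proof (cases "cyc w")
    case True
    then show ?thesis by (intro exI[of _ "[]"] exI[of _ w]) simp
  next
    case False
    with less.prems have e: "hd w = linv (last w)" by (simp add: cyc_def)
    obtain l w1 where w1: "w = l # w1" using less.prems by (cases w) auto
    have "w1 \<noteq> []" using e w1 by (auto simp: prod_eq_iff)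
    then obtain w2 k where w2: "w1 = w2 @ [k]" by (cases w1 rule: rev_cases) auto
    have k: "k = linv l" using e w1 w2 by (auto simp: prod_eq_iff)
    have "w2 \<noteq> []"
      using less.prems(1) by (auto simp: w1 w2 k reduced_word_Cons)
    moreover have "reduced_word w2"
      using less.prems(1) by (simp add: w1 w2 reduced_word_Cons reduced_word_append)
    ultimately obtain s u where "w2 = s @ u @ winv s" "cyc u"
      using less.hyps[of w2] w1 w2 by auto
    then show ?thesis
      by (intro exI[of _ "l # s"] exI[of _ u]) (simp add: w1 w2 k)
  qed
qed

lemma f2_cyclic_decomposition:
  assumes "x \<noteq> 0"
  obtains s u where "x = cj s u" "cyc (rep u)" "rep x = rep s @ rep u @ winv (rep s)"
proof -
  obtain s u where su: "rep x = s @ u @ winv s" "cyc u"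
    using cyclic_decomposition[of "rep x"] assms by auto
  have "reduced_word (s @ u @ winv s)" using su(1) reduced_rep[of x] by simp
  then have r: "rep (wd s) = s" "rep (wd u) = u"
    by (simp_all add: reduced_word_append rep_wd)
  have "x = wd (s @ u @ winv s)" by (simp flip: su(1))
  then have "x = cj (wd s) (wd u)"
    by (simp add: cj_def wd_append wd_winv grp del: add_uminus_conv_diff)
  then show ?thesis using that[of "wd s" "wd u"] su r by simp
qed

lemma rep_nm_conj:
  assumes "x = cj s u" "cyc (rep u)" "rep x = rep s @ rep u @ winv (rep s)" "n > 0"
  shows "rep (nm n x) = rep s @ concat (replicate n (rep u)) @ winv (rep s)"
proof -
  have "nm n x = cj s (nm n u)" using ghom_nm[OF ghom_cj, of s n u] assms(1) by simp
  also have "\<dots> = wd (rep s @ concat (replicate n (rep u)) @ winv (rep s))"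
    by (simp add: cj_def wd_append wd_winv wd_concat_replicate grp del: add_uminus_conv_diff)
  finally show ?thesis
    using reduced_conj_power[of "rep s" "rep u" n] assms(2-4) reduced_rep[of x]
    by (simp add: rep_wd)
qed

lemma rep_nm: "cyc (rep u) \<Longrightarrow> rep (nm n u) = concat (replicate n (rep u))"
  using reduced_concat_replicate[of "rep u" n] wd_concat_replicate[of n "rep u"] rep_wd by force

lemma nm_eq_0: "nm n x = 0 \<Longrightarrow> n > 0 \<Longrightarrow> (x :: f2) = 0"
proof (rule ccontr)
  assume *: "nm n x = 0" "n > 0" "x \<noteq> 0"
  obtain s u where su: "x = cj s u" "cyc (rep u)" "rep x = rep s @ rep u @ winv (rep s)"
    using f2_cyclic_decomposition[OF *(3)] by blast
  show False using rep_nm_conj[OF su *(2)] * concat_replicate_ends[of n "rep u"] su(2)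
    by (simp add: cyc_def)
qed

text \<open>If \<open>t\<close> were longer than \<open>s\<close>, the surplus would place a letter
  and its inverse at the two ends of \<open>u\<close>, against \<open>cyc u\<close>.\<close>

lemma decomposition_unique_aux:
  assumes "s @ u @ winv s = t @ v @ winv t" "cyc u" "v \<noteq> []" "length s \<le> length t"
  shows "s = t"
proof -
  obtain r where r: "t = s @ r"
    using assms(1,4) by (auto simp: append_eq_append_conv2)
  have "u = r @ v @ winv r" using assms(1) by (simp add: r)
  then have "r = []" using assms(2) by (cases r) (auto simp: cyc_def)
  then show ?thesis using r by simp
qed

text \<open>For \<open>x = cj s u\<close> with \<open>u\<close> cyclically reduced, the n-th power
  is spelled by \<open>s\<close>, n copies of \<open>u\<close> and the inverse of \<open>s\<close>.
  The conjugator can be read off this word, and then \<open>u\<close> as the first n-th part of the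
  middle.\<close>

theorem unique_roots:
  fixes x y :: f2
  assumes "nm n x = nm n y" "n > 0"
  shows "x = y"
proof (cases "x = 0 \<or> y = 0")
  case True
  then show ?thesis using assms nm_eq_0[of n x] nm_eq_0[of n y] by auto
next
  case False
  then obtain s u where su: "x = cj s u" "cyc (rep u)" "rep x = rep s @ rep u @ winv (rep s)"
    using f2_cyclic_decomposition[of x] by blast
  obtain t v where tv: "y = cj t v" "cyc (rep v)" "rep y = rep t @ rep v @ winv (rep t)"
    using False f2_cyclic_decomposition[of y] by blast
  let ?u = "concat (replicate n (rep u))" and ?v = "concat (replicate n (rep v))"
  have eq: "rep s @ ?u @ winv (rep s) = rep t @ ?v @ winv (rep t)"
    using rep_nm_conj[OF su assms(2)] rep_nm_conj[OF tv assms(2)] assms(1) by simp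
  have cu: "cyc ?u" and cv: "cyc ?v"
    using cyc_concat_replicate[OF _ assms(2)] su(2) tv(2) by blast+
  have st: "rep s = rep t"
  proof (cases "length (rep s) \<le> length (rep t)")
    case True
    then show ?thesis using decomposition_unique_aux[OF eq cu] cv by (simp add: cyc_def)
  next
    case False
    then show ?thesis using decomposition_unique_aux[OF eq[symmetric] cv] cu by (simp add: cyc_def)
  qed
  then have uv: "?u = ?v" using eq by simp
  then have "length ?u = length ?v" by (rule arg_cong)
  then have "length (rep u) = length (rep v)" using assms(2) by (simp add: length_concat sum_list_replicate)
  moreover obtain m where "n = Suc m" using assms(2) by (cases n) auto
  ultimately have "rep u = rep v" using uv by simp
  then show ?thesis using st su tv by (metis rep_inject)
qed

lemma zm_unique_roots:
  fixes x y :: f2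
  assumes "zm k x = zm k y" "k \<noteq> 0"
  shows "x = y"
proof (cases "k > 0")
  case True
  then show ?thesis using assms unique_roots[of "nat k" x y] by (simp add: zm_def)
next
  case False
  then show ?thesis using assms unique_roots[of "nat (- k)" x y] by (simp add: zm_def split: if_splits)
qed

text \<open>Conjugation by \<open>y\<close> carries \<open>x\<close> to another n-th root of the
  same element.\<close>

lemma commutes_nmD:
  fixes x y :: f2
  assumes "y + nm n x = nm n x + y" "n > 0"
  shows "y + x = x + y"
proof -
  have "cj y (nm n x) = nm n x" using assms(1) by (simp only: cj_eq_iff)
  then have "nm n (cj y x) = nm n x" by (simp only: ghom_nm[OF ghom_cj, of y n x])
  then have "cj y x = x" using assms(2) by (rule unique_roots)
  then show ?thesis by (simp add: cj_eq_iff)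
qed

section \<open>Commuting elements and centralizers\<close>

lemma append_eq_append_prefix: "p @ c = x @ y \<Longrightarrow> length x \<le> length p \<Longrightarrow> \<exists>r. p = x @ r"
  by (auto simp: append_eq_append_conv2)

text \<open>
  Boundedly many letters of one kind survive in \<open>u^j y u^-j\<close> only if almost everything cancels, so
  these elements have bounded length and two of them coincide.
\<close>

lemma bounded_conj_commutes:
  assumes u: "cyc (rep u)" "lcnt g (rep u) > 0"
    and C: "\<And>j. cnt g (cj (nm j u) y) \<le> C"
  shows "y + u = u + y"
proof -
  \<comment> \<open>The length of \<open>C + 1\<close> copies of \<open>u\<close>, which contain
    more than \<open>C\<close> letters \<open>g\<close>; a prefix of a power of \<open>u\<close>
    with at most \<open>C\<close> such letters is therefore shorter.\<close>
  define N where "N = (C + 1) * len u"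
  have len: "len (cj (nm j u) y) \<le> 2 * N + len y" for j
  proof -
    have z: "cj (nm j u) y = nm j u + (y - nm j u)" by (simp add: cj_def add_diff_eq)
    obtain p c q where pcq: "rep (nm j u) = p @ c" "rep (y - nm j u) = winv c @ q"
        "rep (nm j u + (y - nm j u)) = p @ q"
      by (rule rep_plus_split)
    have "lcnt g p \<le> C" using C[of j] pcq(3) by (simp add: z cnt_def)
    have "length p < N"
    proof (rule ccontr)
      assume "\<not> length p < N"
      have pc: "p @ c = concat (replicate j (rep u))" using pcq(1) rep_nm[OF u(1)] by simp
      have "length (p @ c) = j * len u"
        unfolding pc by (simp add: length_concat sum_list_replicate len_def)
      then have "N \<le> j * len u" using \<open>\<not> length p < N\<close> by simp
      moreover have "len u > 0" using u(1) by (simp add: cyc_def len_def)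
      ultimately have "C + 1 \<le> j" unfolding N_def by (simp only: mult_le_cancel2)
      then have "replicate j (rep u) = replicate (C + 1) (rep u) @ replicate (j - (C + 1)) (rep u)"
        by (simp only: replicate_add[symmetric] le_add_diff_inverse)
      then have "p @ c = concat (replicate (C + 1) (rep u)) @ concat (replicate (j - (C + 1)) (rep u))"
        using pc by (simp only: concat_append)
      moreover have "length (concat (replicate (C + 1) (rep u))) = N"
        by (simp only: length_concat map_replicate sum_list_replicate N_def len_def of_nat_id)
      ultimately obtain r where "p = concat (replicate (C + 1) (rep u)) @ r"
        using \<open>\<not> length p < N\<close> append_eq_append_prefix not_less by metis
      then have "lcnt g p \<ge> lcnt g (concat (replicate (C + 1) (rep u)))" by (simp only: lcnt_simps le_add1)
      then have "lcnt g p \<ge> (C + 1) * lcnt g (rep u)" by (simp only: lcnt_concat_replicate)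
      moreover have "(C + 1) * 1 \<le> (C + 1) * lcnt g (rep u)" by (rule mult_le_mono2) (use u(2) in simp)
      ultimately have "(C + 1) * 1 \<le> lcnt g p" using order_trans by blast
      then show False using \<open>lcnt g p \<le> C\<close> by simp
    qed
    have "len (y - nm j u) \<le> len y + len (nm j u)"
      using len_plus_le[of y "- nm j u"] by simp
    then have "length q \<le> len y + length p" using pcq by (simp add: len_def)
    then show ?thesis using \<open>length p < N\<close> pcq(3) by (simp add: z len_def)
  qed
  obtain i j where ij: "i < j" "cj (nm i u) y = cj (nm j u) y"
    by (rule nat_pigeonhole[OF finite_len_le[of "2 * N + len y"], of "\<lambda>j. cj (nm j u) y"])
       (use len in auto)
  have "nm j u = nm i u + nm (j - i) u" using ij(1) nm_add[of i "j - i" u] by simp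
  then have "cj (nm i u) y = cj (nm i u) (cj (nm (j - i) u) y)" using ij(2) by (simp only: cj_cj)
  then have "y = cj (nm (j - i) u) y" by (simp only: cj_inject)
  then have "nm (j - i) u + y = y + nm (j - i) u" by (metis cj_eq_iff)
  then show ?thesis using commutes_nmD[of y "j - i" u] ij(1) by simp
qed

text \<open>If nothing cancels in \<open>g + u\<close>, then for reasons of length nothing cancels
  in \<open>u + g\<close> either, and comparing the two words shows that \<open>u\<close> is a
  prefix of \<open>g\<close>.\<close>

lemma commuting_shrink:
  assumes "reduced_word (rep g @ rep u)" "u \<noteq> 0" "g + u = u + g" "len u \<le> len g"
  shows "len (g - u) < len g"
proof -
  have 1: "rep (g + u) = rep g @ rep u" by (rule rep_plus_reduced[OF assms(1)])
  obtain p c q where pcq: "rep u = p @ c" "rep g = winv c @ q" "rep (u + g) = p @ q"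
    by (rule rep_plus_split)
  have "length (rep (u + g)) = length (rep g) + length (rep u)" using 1 assms(3) by simp
  then have "c = []" using pcq by simp
  then have eq: "rep g @ rep u = rep u @ rep g" using 1 assms(3) pcq by simp
  then obtain g' where g': "rep g = rep u @ g'"
    using assms(4) by (auto simp: append_eq_append_conv2 len_def)
  then have "reduced_word g'" using reduced_rep[of g] by (simp add: reduced_word_append)
  have "g = u + wd g'" using arg_cong[OF g', of wd] by (simp add: wd_append)
  moreover have "g - u = - u + g"
    using uminus_commutes[OF assms(3)] by simp
  ultimately have "g - u = wd g'" by simp
  then show ?thesis using g' assms(2) \<open>reduced_word g'\<close> by (simp add: len_def rep_wd)
qed

text \<open>Division with remainder of \<open>g\<close> by \<open>u\<close>.\<close>

lemma commuting_reduce: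
  assumes "cyc (rep u)" "g + u = u + g"
  shows "\<exists>k. len (g + zm k u) < len u"
  using assms(2)
proof (induction "len g" arbitrary: g rule: less_induct)
  case less
  have u: "u \<noteq> 0" using assms(1) by (auto simp: cyc_def)
  show ?case
  proof (cases "len g < len u")
    case True
    then show ?thesis by (intro exI[of _ 0]) simp
  next
    case False
    then have g: "g \<noteq> 0" using u by auto
    \<comment> \<open>Since \<open>u\<close> is cyclically reduced, \<open>u\<close> and
      \<open>- u\<close> begin with different letters, so the end of \<open>g\<close> cancels
      against at most one of them.\<close>
    have "len (g - u) < len g \<or> len (g + u) < len g"
    proof (cases "reduced_word (rep g @ rep u)")
      case True
      then show ?thesis using commuting_shrink[OF True u less.prems] False by simp
    next
      case nr: False
      then have e: "hd (rep u) = linv (last (rep g))"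
        using g u by (auto simp: reduced_word_append)
      have "reduced_word (rep g @ rep (- u))"
        using e g u assms(1) by (auto simp: reduced_word_append hd_winv cyc_def prod_eq_iff)
      then show ?thesis
        using commuting_shrink[of g "- u"] u False uminus_commutes[OF less.prems] by simp
    qed
    then show ?thesis
    proof
      assume *: "len (g - u) < len g"
      have "(g - u) + u = u + (g - u)"
        using less.prems by (simp add: add_diff_eq flip: less.prems)
      then obtain k where k: "len (g - u + zm k u) < len u" using less.hyps[OF *] by blast
      have "g - u + zm k u = g + zm (k - 1) u"
        using zm_add[of "- 1" k u] zm_uminus[of 1 u] by (simp add: grp del: add_uminus_conv_diff)
      then show ?thesis using k by metis
    next
      assume *: "len (g + u) < len g"
      have "(g + u) + u = u + (g + u)" by (simp only: less.prems add.assoc)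
      then obtain k where k: "len (g + u + zm k u) < len u" using less.hyps[OF *] by blast
      have "g + u + zm k u = g + zm (k + 1) u" by (simp add: zm_succ add.assoc)
      then show ?thesis using k by metis
    qed
  qed
qed

text \<open>The remainders of the powers of \<open>g\<close> modulo powers of \<open>u\<close> are
  short, so two of them coincide. A common power is all that is needed of the fact that centralizers
  are cyclic.\<close>

theorem commuting_powers:
  fixes g h :: f2
  assumes "h \<noteq> 0" "g + h = h + g"
  obtains n k where "n > 0" "nm n g = zm k h"
proof -
  obtain s u where su: "h = cj s u" "cyc (rep u)" using f2_cyclic_decomposition[OF assms(1)] by metis
  define g' where "g' = cj (- s) g"
  have "cj (- s) (g + h) = cj (- s) (h + g)" using assms(2) by simp
  then have gu: "g' + u = u + g'" by (simp add: g'_def su(1) ghom_plus[OF ghom_cj])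
  have "\<exists>k. len (nm i g' + zm k u) < len u" for i
    by (rule commuting_reduce[OF su(2)]) (simp add: nm_commutes[OF gu[symmetric]])
  then obtain K where "\<And>i. len (nm i g' + zm (K i) u) < len u" by metis
  then have K: "len (nm i g' + zm (K i) u) \<le> len u" for i by (simp add: less_imp_le)
  obtain i j where ij: "i < j" "nm i g' + zm (K i) u = nm j g' + zm (K j) u"
    by (rule nat_pigeonhole[OF finite_len_le[of "len u"], of "\<lambda>i. nm i g' + zm (K i) u"])
       (use K in auto)
  have "nm j g' = nm i g' + nm (j - i) g'" using ij(1) nm_add[of i "j - i" g'] by simp
  then have "zm (K i) u = nm (j - i) g' + zm (K j) u" using ij(2) by (simp add: add.assoc)
  then have "nm (j - i) g' = zm (K i - K j) u" by (simp add: zm_diff)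
  then have "cj s (nm (j - i) g') = cj s (zm (K i - K j) u)" by simp
  then have "nm (j - i) g = zm (K i - K j) h"
    by (simp add: ghom_nm[OF ghom_cj] ghom_zm[OF ghom_cj] g'_def su(1))
  then show ?thesis using that[of "j - i"] ij(1) by simp
qed

text \<open>Some power of \<open>g\<close> is a power of \<open>h\<close> and hence fixed;
  \<open>g\<close> and \<open>f g\<close> are roots of this same element.\<close>

lemma ghom_fixes_centralizer:
  fixes g h :: f2
  assumes "ghom f" "f h = h" "h \<noteq> 0" "g + h = h + g"
  shows "f g = g"
proof -
  obtain n k where nk: "n > 0" "nm n g = zm k h" by (rule commuting_powers[OF assms(3,4)])
  have "nm n (f g) = f (zm k h)" by (simp add: ghom_nm[OF assms(1)] flip: nk(2))
  also have "\<dots> = nm n g" by (simp add: ghom_zm[OF assms(1)] assms(2) nk(2))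
  finally show ?thesis using nk(1) by (rule unique_roots)
qed

section \<open>Elementary automorphisms and positive words\<close>

definition cnj :: "f2 \<Rightarrow> f2 \<Rightarrow> bool" where "cnj x y \<longleftrightarrow> (\<exists>g. y = cj g x)"

lemma cnjI: "cnj x (cj g x)" by (auto simp: cnj_def)

lemma cnj_refl [simp]: "cnj x x" using cnjI[of x 0] by simp

lemma cnj_sym: "cnj x y \<Longrightarrow> cnj y x"
  unfolding cnj_def by (metis cj_uminus_cj(1))

lemma cnj_trans: "cnj x y \<Longrightarrow> cnj y z \<Longrightarrow> cnj x z"
  unfolding cnj_def by (metis cj_cj)

lemma cnj_ghom: "ghom f \<Longrightarrow> cnj x y \<Longrightarrow> cnj (f x) (f y)"
  unfolding cnj_def by (metis ghom_apply_cj)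

text \<open>With a = \<open>gen True\<close> and b = \<open>gen False\<close> these are the
  elementary automorphisms of the overview: \<open>st True\<close> is a -> ab and
  \<open>st False\<close> is b -> ba. Both generators have images ending in
  \<open>gen (\<not> t)\<close>.\<close>

definition st :: "bool \<Rightarrow> f2 \<Rightarrow> f2" where
  "st t = lift (\<lambda>g. if g = t then gen g + gen (\<not> g) else gen g)"

lemma ghom_st: "ghom (st t)" by (simp add: st_def ghom_lift)

lemma st_gen: "st t (gen g) = (if g = t then gen g + gen (\<not> g) else gen g)"
  by (simp add: st_def)

definition pos :: "bool list \<Rightarrow> f2" where "pos p = wd (map (Pair True) p)"

lemma pos_simps [simp]: "pos [] = 0" "pos (p @ q) = pos p + pos q" "pos [g] = gen g"
  by (simp_all add: pos_def wd_append gen_def)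

lemma pos_Cons: "pos (g # p) = gen g + pos p"
  using pos_simps(2)[of "[g]" p] by simp

definition subst :: "bool \<Rightarrow> bool list \<Rightarrow> bool list" where
  "subst t p = concat (map (\<lambda>g. if g = t then [g, \<not> g] else [g]) p)"

lemma subst_simps [simp]:
  "subst t [] = []" "subst t (p @ q) = subst t p @ subst t q"
  "subst t (g # p) = (if g = t then [g, \<not> g] else [g]) @ subst t p"
  by (simp_all add: subst_def)

lemma st_pos: "st t (pos p) = pos (subst t p)"
  by (induction p) (simp_all add: ghom_zero[OF ghom_st] ghom_plus[OF ghom_st] pos_Cons st_gen add.assoc)

text \<open>
  The image under \<open>st t\<close> of a nonempty positive word ends in the letter \<open>\<not> t\<close>. So this letter cancels in the
  image of \<open>pos p - pos n\<close>, and \<open>hat t\<close> leaves it out from the start.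
\<close>

definition hat :: "bool \<Rightarrow> bool list \<Rightarrow> bool list" where "hat t p = butlast (subst t p)"

lemma subst_eq_hat: "p \<noteq> [] \<Longrightarrow> subst t p = hat t p @ [\<not> t]"
  by (cases p rule: rev_cases) (auto simp: hat_def butlast_append)

lemma st_pos_hat: "p \<noteq> [] \<Longrightarrow> st t (pos p) = pos (hat t p) + gen (\<not> t)"
  by (simp add: st_pos subst_eq_hat)

lemma hat_Nil [simp]: "hat t [] = []" by (simp add: hat_def)

text \<open>A final letter \<open>t\<close> contributes \<open>t, \<not> t\<close>, of which
  \<open>t\<close> is left; a final letter \<open>\<not> t\<close> is dropped, but the image of the
  preceding letters ends in \<open>\<not> t\<close> again. As \<open>hat\<close> keeps both ends of
  a run, the conditions in \<open>good\<close> survive as long as no run becomes empty.\<close>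

lemma last_hat: "hat t p \<noteq> [] \<Longrightarrow> last (hat t p) = last p"
proof (cases p rule: rev_cases)
  case (snoc q g)
  assume ne: "hat t p \<noteq> []"
  show ?thesis
  proof (cases "g = t")
    case True
    then show ?thesis by (simp add: snoc hat_def butlast_append)
  next
    case False
    then have "hat t p = subst t q" by (simp add: snoc hat_def butlast_append)
    moreover from this have "q \<noteq> []" using ne by auto
    ultimately show ?thesis using False subst_eq_hat[of q t] by (auto simp: snoc)
  qed
qed simp

lemma hd_hat: "hat t p \<noteq> [] \<Longrightarrow> hd (hat t p) = hd p"
proof -
  assume ne: "hat t p \<noteq> []"
  then obtain g q where p: "p = g # q" by (cases p) auto
  have "hd (subst t p) = hd (hat t p)" using ne subst_eq_hat[of p t] p by simp
  then show ?thesis by (simp add: p split: if_splits)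
qed

lemma count_subst:
  "count_list (subst t p) t = count_list p t"
  "count_list (subst t p) (\<not> t) = count_list p t + count_list p (\<not> t)"
  by (induction p) auto

lemma count_hat:
  assumes "p \<noteq> []"
  shows "count_list (hat t p) t = count_list p t"
    and "int (count_list (hat t p) (\<not> t)) = int (count_list p t) + int (count_list p (\<not> t)) - 1"
  using count_subst[of t p] by (simp_all add: subst_eq_hat[OF assms])

lemma length_eq_counts: "length p = count_list p t + count_list p (\<not> t)"
  by (induction p) auto

lemma hat_eq_Nil:
  assumes "p \<noteq> []" "hat t p = []"
  shows "p = [\<not> t]"
proof -
  have "subst t p = [\<not> t]" using subst_eq_hat[OF assms(1), of t] assms(2) by simp
  then show ?thesis using assms(1)
    by (cases p; cases "tl p") (auto split: if_splits)
qed

section \<open>Cyclic words with alternating signs\<close>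

text \<open>
  A list of pairs \<open>(p, n)\<close> stands for the product of the elements \<open>pos p - pos n\<close>, i.e. for a word cut at its
  sign changes; \<open>good\<close> lists are those without cancellation in the cyclic word.
\<close>

definition tw :: "(bool list \<times> bool list) list \<Rightarrow> bool letter list" where
  "tw ps = concat (map (\<lambda>(p, n). map (Pair True) p @ winv (map (Pair True) n)) ps)"

definition val :: "(bool list \<times> bool list) list \<Rightarrow> f2" where
  "val ps = sum_list (map (\<lambda>(p, n). pos p - pos n) ps)"

lemma val_simps [simp]:
  "val [] = 0" "val (ps @ qs) = val ps + val qs" "val ((p, n) # ps) = pos p - pos n + val ps"
  by (simp_all add: val_def)

lemma wd_tw: "wd (tw ps) = val ps"
proof (induction ps)
  case (Cons a ps)
  obtain p n where a: "a = (p, n)" by (cases a)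
  have "tw (a # ps) = (map (Pair True) p @ winv (map (Pair True) n)) @ tw ps" by (simp add: tw_def a)
  then have "wd (tw (a # ps)) = pos p + - pos n + wd (tw ps)"
    by (simp only: wd_append wd_winv pos_def)
  then show ?case by (simp add: a Cons)
qed (simp add: tw_def)

text \<open>The word of \<open>- pos n\<close> ends in the inverse of the first letter of
  \<open>n\<close>, so it is the two first letters that meet at the junction of consecutive
  pairs.\<close>

definition turn :: "bool list \<times> bool list \<Rightarrow> bool list \<times> bool list \<Rightarrow> bool" where
  "turn x y \<longleftrightarrow> hd (snd x) \<noteq> hd (fst y)"

definition lgood :: "(bool list \<times> bool list) list \<Rightarrow> bool" where
  "lgood ps \<longleftrightarrow> ps \<noteq> [] \<and> (\<forall>x\<in>set ps. fst x \<noteq> [] \<and> snd x \<noteq> [] \<and> last (fst x) \<noteq> last (snd x)) \<and>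
     successively turn ps"

definition good :: "(bool list \<times> bool list) list \<Rightarrow> bool" where
  "good ps \<longleftrightarrow> lgood ps \<and> turn (last ps) (hd ps)"

lemma reduced_map_Pair: "reduced_word (map (Pair b) p)"
  by (induction p) (auto simp: reduced_word_Cons hd_map)

lemma reduced_tw:
  "lgood ps \<Longrightarrow> reduced_word (tw ps) \<and> tw ps \<noteq> [] \<and> hd (tw ps) = (True, hd (fst (hd ps))) \<and>
     last (tw ps) = (False, hd (snd (last ps)))"
proof (induction ps)
  case Nil
  then show ?case by (simp add: lgood_def)
next
  case (Cons a ps)
  obtain p n where a: "a = (p, n)" by (cases a)
  define B where "B = map (Pair True) p @ winv (map (Pair True) n)"
  have ne: "p \<noteq> []" "n \<noteq> []" "last p \<noteq> last n" using Cons.prems by (auto simp: lgood_def a)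
  have eq: "tw (a # ps) = B @ tw ps" by (simp add: tw_def a B_def)
  have B: "B \<noteq> []" "hd B = (True, hd p)" "last B = (False, hd n)"
    using ne by (auto simp: B_def hd_append hd_map last_append last_winv)
  have rB: "reduced_word B"
    using ne by (auto simp: B_def reduced_word_append reduced_map_Pair hd_winv last_map)
  show ?case
  proof (cases "ps = []")
    case True
    then show ?thesis using B rB eq by (simp add: a tw_def)
  next
    case False
    then have "lgood ps" "turn a (hd ps)"
      using Cons.prems by (auto simp: lgood_def successively_Cons)
    from Cons.IH[OF this(1)] this(2) show ?thesis
      using B rB eq False by (auto simp: reduced_word_append hd_append a turn_def)
  qed
qed

lemma cyc_tw: "good ps \<Longrightarrow> cyc (tw ps)"
  using reduced_tw[of ps] by (auto simp: cyc_def good_def turn_def)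

lemma rep_val: "good ps \<Longrightarrow> rep (val ps) = tw ps"
  using cyc_tw[of ps] rep_wd[of "tw ps"] by (simp add: cyc_def wd_tw)

lemma length_tw: "length (tw ps) = sum_list (map (\<lambda>(p, n). length p + length n) ps)"
  by (induction ps) (auto simp: tw_def)

text \<open>Conjugation by \<open>g\<close> changes a length by at most \<open>2 * len g\<close>,
  whereas passing to \<open>N\<close>-th powers multiplies any difference of the lengths by
  \<open>N\<close>, which is chosen larger.\<close>

lemma cyc_conj_len_le:
  assumes "cyc (rep u)" "cyc (rep v)" "v = cj g u"
  shows "len u \<le> len v"
proof -
  define N where "N = 2 * len g + 1"
  have l: "len (nm N x) = N * len x" if "cyc (rep x)" for x
    using rep_nm[OF that, of N] by (simp add: len_def length_concat sum_list_replicate)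
  have "nm N u = cj (- g) (nm N v)"
    by (simp add: assms(3) ghom_nm[OF ghom_cj])
  then have "len (nm N u) \<le> len (- g + nm N v) + len g"
    using len_plus_le[of "- g + nm N v" g] by (simp add: cj_def)
  then have "len (nm N u) \<le> 2 * len g + len (nm N v)"
    using len_plus_le[of "- g" "nm N v"] by simp
  then have "N * len u < N * (len v + 1)" using l assms(1,2) by (simp add: N_def)
  then have "len u < len v + 1" by (simp only: mult_less_cancel1)
  then show ?thesis by simp
qed

lemma cnj_good_length:
  assumes "good ps" "good qs" "cnj (val ps) (val qs)"
  shows "length (tw ps) = length (tw qs)"
proof -
  have "cyc (rep (val ps))" "cyc (rep (val qs))" using assms(1,2) by (simp_all add: rep_val cyc_tw)
  then have "len (val ps) = len (val qs)"
    using cyc_conj_len_le assms(3) cnj_sym[OF assms(3)] unfolding cnj_def by (metis le_antisym)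
  then show ?thesis using assms(1,2) by (simp add: len_def rep_val)
qed

section \<open>The number of sign changes\<close>

text \<open>
  Positive automorphisms cannot increase \<open>kap\<close>, so it is constant along the orbit of a conjugacy class that
  returns to itself. Then no run disappears, and \<open>hat\<close> can be iterated.
\<close>

definition kap :: "f2 \<Rightarrow> nat" where
  "kap w = (LEAST k. \<exists>ps. length ps = k \<and> cnj w (val ps))"

lemma kap_le: "cnj w (val ps) \<Longrightarrow> kap w \<le> length ps"
  unfolding kap_def by (rule Least_le) blast

lemma kap_ex: "\<exists>ps. length ps = kap w \<and> cnj w (val ps)"
proof -
  have "val (map (\<lambda>(b, g). if b then ([g], []) else ([], [g])) u) = wd u" for u
  proof (induction u)
    case (Cons l u)
    obtain b g where l: "l = (b, g)" by (cases l)
    have "wd (l # u) = (if b then gen g else - gen g) + wd u"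
      using wd_Cons[of l u] wd_single[of l] by (simp add: l)
    then show ?case using Cons by (cases b) (simp_all add: l)
  qed simp
  from this[of "rep w"] have "\<exists>ps. val ps = w" by auto
  then have "\<exists>k ps. length ps = k \<and> cnj w (val ps)" using cnj_refl by blast
  then show ?thesis unfolding kap_def by (rule LeastI_ex)
qed

lemma kap_cnj: "cnj w w' \<Longrightarrow> kap w = kap w'"
  using kap_le kap_ex by (metis cnj_sym cnj_trans le_antisym)

lemma val_subst: "val (map (map_prod (subst t) (subst t)) ps) = st t (val ps)"
  by (induction ps)
     (auto simp: ghom_zero[OF ghom_st] ghom_plus[OF ghom_st] ghom_minus[OF ghom_st] st_pos)

lemma kap_st: "kap (st t w) \<le> kap w"
proof -
  obtain ps where ps: "length ps = kap w" "cnj w (val ps)" using kap_ex by blast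
  have "cnj (st t w) (val (map (map_prod (subst t) (subst t)) ps))"
    using cnj_ghom[OF ghom_st ps(2)] by (simp add: val_subst)
  then show ?thesis using kap_le ps(1) by fastforce
qed

lemma cnj_val_rotate: "cnj (val (xs @ ys)) (val (ys @ xs))"
proof -
  have "val (ys @ xs) = cj (- val xs) (val (xs @ ys))" by (simp add: cj_def add.assoc)
  then show ?thesis by (auto simp: cnj_def)
qed

text \<open>An empty run would let its pair merge with a cyclic neighbour, contrary to the
  minimality of \<open>kap\<close>. A neighbour exists because there are at least two pairs.\<close>

lemma kap_nonempty:
  assumes w: "cnj w (val ps)" and k: "length ps = kap w" "length ps \<ge> 2" and x: "(p, n) \<in> set ps"
  shows "p \<noteq> []" "n \<noteq> []"
proof -
  obtain xs ys where ps: "ps = xs @ (p, n) # ys" using x by (auto simp: in_set_conv_decomp)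
  have r1: "cnj w (val ((p, n) # ys @ xs))"
    using cnj_trans[OF w] cnj_val_rotate[of xs "(p, n) # ys"] by (simp add: ps)
  have r2: "cnj w (val ((ys @ xs) @ [(p, n)]))"
    using cnj_trans[OF w] cnj_val_rotate[of "xs @ [(p, n)]" ys] by (simp add: ps add.assoc)
  have ne: "ys @ xs \<noteq> []" "Suc (length (ys @ xs)) = kap w" using k by (auto simp: ps)
  show "n \<noteq> []"
  proof
    assume n: "n = []"
    obtain p2 n2 r where r: "ys @ xs = (p2, n2) # r" using ne(1) by (cases "ys @ xs") auto
    have "val ((p, n) # ys @ xs) = val ((p @ p2, n2) # r)"
      by (simp only: r n val_simps pos_simps) (simp add: grp del: add_uminus_conv_diff)
    then have "kap w \<le> length ((p @ p2, n2) # r)" using r1 kap_le by metis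
    then show False using ne(2) r by simp
  qed
  show "p \<noteq> []"
  proof
    assume p: "p = []"
    obtain p2 n2 r where r: "ys @ xs = r @ [(p2, n2)]" using ne(1) by (cases "ys @ xs" rule: rev_cases) auto
    have "val ((ys @ xs) @ [(p, n)]) = val (r @ [(p2, n @ n2)])"
      by (simp only: r p val_simps pos_simps) (simp add: grp del: add_uminus_conv_diff)
    then have "kap w \<le> length (r @ [(p2, n @ n2)])" using r2 kap_le by metis
    then show False using ne(2) r by simp
  qed
qed

lemma successivelyI_split:
  "(\<And>xs x y ys. ps = xs @ x # y # ys \<Longrightarrow> R x y) \<Longrightarrow> successively R ps"
proof (induction ps)
  case (Cons a ps)
  have "successively R ps"
    by (rule Cons.IH) (use Cons.prems[of "a # _"] in simp)
  moreover have "R a (hd ps)" if "ps \<noteq> []"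
    using Cons.prems[of "[]" a "hd ps" "tl ps"] that by simp
  ultimately show ?case by (auto simp: successively_Cons)
qed simp

text \<open>Among the lists with the minimal number of pairs one of minimal total length is taken.
  Every violation of \<open>good\<close> is a cancellation that shortens two runs and keeps the
  number of pairs. Empty runs can remain only if there is at most one pair, which gives the first
  two cases.\<close>

lemma good_exists:
  obtains (Pos) p where "cnj w (pos p)" | (Neg) p where "cnj w (- pos p)"
  | (Good) ps where "good ps" "cnj w (val ps)" "length ps = kap w"
proof -
  define P where "P ps \<longleftrightarrow> length ps = kap w \<and> cnj w (val ps)" for ps
  define size where "size ps = sum_list (map (\<lambda>(p, n). length p + length n) ps)"
    for ps :: "(bool list \<times> bool list) list"
  obtain ps where ps: "P ps" "\<And>qs. P qs \<Longrightarrow> size ps \<le> size qs"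
    using ex_has_least_nat[of P] kap_ex[of w] unfolding P_def by metis
  have w: "cnj w (val ps)" "length ps = kap w" using ps(1) by (auto simp: P_def)
  consider "ps = []" | p n where "ps = [(p, n)]" "p = [] \<or> n = []"
    | "ps \<noteq> []" "\<And>p n. (p, n) \<in> set ps \<Longrightarrow> p \<noteq> [] \<and> n \<noteq> []"
  proof -
    consider "length ps \<ge> 2" | "length ps = 0" | "length ps = 1" by linarith
    then show ?thesis
    proof cases
      case 1
      then show ?thesis using kap_nonempty[OF w(1,2)] that(3) by force
    next
      case 2
      then show ?thesis using that(1) by simp
    next
      case 3
      then obtain x where "ps = [x]" by (auto simp: length_Suc_conv)
      then show ?thesis using that(2)[of "fst x" "snd x"] that(3) by force
    qed
  qed
  then show ?thesis
  proof cases
    case 1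
    then show ?thesis using w(1) Pos[of "[]"] by simp
  next
    case 2
    then show ?thesis using w(1) Pos[of p] Neg[of n] by auto
  next
    case 3
    have last: "last p \<noteq> last n" if x: "(p, n) \<in> set ps" for p n
    proof
      assume e: "last p = last n"
      obtain p' n' where pn: "p = p' @ [last n]" "n = n' @ [last n]"
        using that[of "butlast p" "butlast n"] 3(2)[OF x] append_butlast_last_id[of p]
          append_butlast_last_id[of n] unfolding e by simp
      obtain xs ys where eq: "ps = xs @ (p, n) # ys" using x by (auto simp: in_set_conv_decomp)
      have "pos p - pos n = pos p' - pos n'"
        by (subst pn(1), subst pn(2), simp only: pos_simps) (simp add: grp del: add_uminus_conv_diff)
      then have "val (xs @ (p', n') # ys) = val ps" by (simp add: eq)
      then have "P (xs @ (p', n') # ys)" using w by (simp add: P_def eq)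
      then have "size ps \<le> size (xs @ (p', n') # ys)" by (rule ps(2))
      moreover have "length p = Suc (length p')" "length n = Suc (length n')"
        using arg_cong[OF pn(1), of length] arg_cong[OF pn(2), of length] by simp_all
      ultimately show False by (simp add: size_def eq)
    qed
    \<comment> \<open>Stated for the first two pairs of a list of the same size: rotations bring
      every junction there, including the one from the last pair to the first.\<close>
    have turn2: "turn x y" if eq: "cnj w (val (x # y # r))" "length (x # y # r) = kap w"
        "size (x # y # r) = size ps" "fst y \<noteq> []" "snd x \<noteq> []" for x y r
    proof (rule ccontr)
      assume "\<not> turn x y"
      then have e: "hd (snd x) = hd (fst y)" by (simp add: turn_def)
      obtain p n p2 n2 where xy: "x = (p, n)" "y = (p2, n2)" by (cases x, cases y)
      obtain g n' p2' where g: "n = g # n'" "p2 = g # p2'"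
        using e eq(4,5) by (cases n; cases p2) (auto simp: xy)
      have "val ((p, n') # (p2', n2) # r) = val (x # y # r)"
        by (simp only: xy g val_simps pos_Cons) (simp add: grp del: add_uminus_conv_diff)
      then have "P ((p, n') # (p2', n2) # r)" using eq by (simp add: P_def)
      then have "size ps \<le> size ((p, n') # (p2', n2) # r)" by (rule ps(2))
      then show False using eq(3) by (simp add: size_def xy g)
    qed
    have "successively turn ps"
    proof (rule successivelyI_split)
      fix xs x y ys assume eq: "ps = xs @ x # y # ys"
      show "turn x y"
      proof (rule turn2)
        show "cnj w (val (x # y # ys @ xs))"
          using cnj_trans[OF w(1)] cnj_val_rotate[of xs "x # y # ys"] by (simp add: eq)
        show "length (x # y # ys @ xs) = kap w" using w(2) by (simp add: eq)
        show "size (x # y # ys @ xs) = size ps" by (simp add: eq size_def)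
        show "fst y \<noteq> []" "snd x \<noteq> []" using 3(2)[of "fst x" "snd x"] 3(2)[of "fst y" "snd y"]
          by (simp_all add: eq)
      qed
    qed
    moreover have "turn (last ps) (hd ps)"
    proof (cases "length ps = 1")
      case True
      then obtain p n where eq: "ps = [(p, n)]" by (auto simp: length_Suc_conv)
      show ?thesis
      proof (rule ccontr)
        assume "\<not> turn (last ps) (hd ps)"
        then have e: "hd n = hd p" by (simp add: turn_def eq)
        obtain g n' p' where g: "n = g # n'" "p = g # p'"
          using e 3(2)[of p n] by (cases n; cases p) (auto simp: eq)
        \<comment> \<open>With a single pair the cancelling letters stand at the two ends of the
          word, and removing them is a conjugation.\<close>
        have "val [(p', n')] = cj (- gen g) (val ps)"
          by (simp only: eq g val_simps pos_Cons cj_def) (simp add: grp del: add_uminus_conv_diff)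
        then have "P [(p', n')]"
          using w cnj_trans[OF w(1) cnjI[of "val ps" "- gen g"]] by (simp add: P_def eq)
        then have "size ps \<le> size [(p', n')]" by (rule ps(2))
        then show False by (simp add: size_def eq g)
      qed
    next
      case False
      define y where "y = hd ps"
      obtain ys where y: "ps = y # ys" using 3(1) y_def by (cases ps) auto
      have "ys \<noteq> []" using False y by auto
      then obtain x r where x: "ys = r @ [x]" by (cases ys rule: rev_cases) auto
      have "turn x y"
      proof (rule turn2)
        show "cnj w (val (x # y # r))"
          using cnj_trans[OF w(1)] cnj_val_rotate[of "y # r" "[x]"] by (simp add: x y)
        show "length (x # y # r) = kap w" using w(2) by (simp add: x y)
        show "size (x # y # r) = size ps" by (simp add: x y size_def)
        show "fst y \<noteq> []" "snd x \<noteq> []" using 3(2)[of "fst x" "snd x"] 3(2)[of "fst y" "snd y"]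
          by (simp_all add: x y)
      qed
      then show ?thesis by (simp add: x y)
    qed
    ultimately have "good ps" using 3 last by (auto simp: good_def lgood_def)
    then show ?thesis using Good w by blast
  qed
qed

section \<open>Exponent sums and the iteration of \<open>hat\<close> on cyclic words\<close>

definition ex :: "bool \<Rightarrow> f2 \<Rightarrow> int" where "ex g = lift (\<lambda>h. if h = g then 1 else 0)"

lemma ghom_ex: "ghom (ex g)" by (simp add: ex_def ghom_lift)

lemma ex_gen: "ex g (gen h) = (if h = g then 1 else 0)" by (simp add: ex_def)

lemma ex_pos: "ex g (pos p) = int (count_list p g)"
  by (induction p) (simp_all add: ghom_zero[OF ghom_ex] ghom_plus[OF ghom_ex] pos_Cons ex_gen)

lemma ex_cj [simp]: "ex g (cj h x) = ex g x"
  by (simp add: cj_def ghom_plus[OF ghom_ex] ghom_minus[OF ghom_ex])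

lemma ex_cnj: "cnj x y \<Longrightarrow> ex g y = ex g x"
  by (auto simp: cnj_def)

lemma ex_st: "ex g (st t x) = ex g x + (if g = t then 0 else ex t x)"
proof -
  define f where "f x = ex g x + (if g = t then 0 else ex t x)" for x
  have "ghom f" by (rule ghomI) (simp add: f_def ghom_plus[OF ghom_ex])
  moreover have "ghom (ex g \<circ> st t)" by (rule ghom_comp[OF ghom_ex ghom_st])
  moreover have "(ex g \<circ> st t) (gen h) = f (gen h)" for h
    by (cases g; cases t; cases h) (simp_all add: f_def st_gen ghom_plus[OF ghom_ex] ex_gen)
  ultimately have "ex g \<circ> st t = f" by (intro ghom_eqI)
  then show ?thesis by (metis comp_apply f_def)
qed

definition hats :: "bool \<Rightarrow> (bool list \<times> bool list) list \<Rightarrow> (bool list \<times> bool list) list" where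
  "hats t ps = map (map_prod (hat t) (hat t)) ps"

lemma val_hats:
  "(\<And>p n. (p, n) \<in> set ps \<Longrightarrow> p \<noteq> [] \<and> n \<noteq> []) \<Longrightarrow> val (hats t ps) = st t (val ps)"
proof (induction ps)
  case Nil
  then show ?case by (simp add: hats_def ghom_zero[OF ghom_st])
next
  case (Cons x ps)
  obtain p n where x: "x = (p, n)" by (cases x)
  have "p \<noteq> []" "n \<noteq> []" using Cons.prems x by auto
  then have "st t (pos p - pos n) = pos (hat t p) - pos (hat t n)"
    by (simp add: ghom_minus[OF ghom_st] st_pos_hat)
       (simp add: grp del: add_uminus_conv_diff)
  moreover have "val (hats t ps) = st t (val ps)"
    by (rule Cons.IH) (use Cons.prems in auto)
  ultimately show ?case
    by (simp add: hats_def x ghom_plus[OF ghom_st])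
qed

lemma last_neqI: "x \<notin> set v \<Longrightarrow> v \<noteq> [] \<Longrightarrow> last v \<noteq> x"
  by auto

text \<open>Constancy of \<open>kap\<close> makes the new list minimal as well, so that none of its
  runs is empty; the ends of nonempty runs are unchanged by \<open>hat\<close>.\<close>

lemma good_hats:
  assumes ps: "good ps" "cnj w (val ps)" "length ps = kap w"
    and k: "kap (st t w) = kap w" and e: "ex t w = 0"
  shows "good (hats t ps)" "cnj (st t w) (val (hats t ps))" "length (hats t ps) = kap (st t w)"
proof -
  have ne: "p \<noteq> [] \<and> n \<noteq> [] \<and> last p \<noteq> last n" if "(p, n) \<in> set ps" for p n
    using ps(1) that by (auto simp: good_def lgood_def)
  show c: "cnj (st t w) (val (hats t ps))"
    using cnj_ghom[OF ghom_st ps(2)] val_hats[of ps t] ne by metis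
  show l: "length (hats t ps) = kap (st t w)" using ps(3) k by (simp add: hats_def)
  have ne': "hat t p \<noteq> [] \<and> hat t n \<noteq> []" if x: "(p, n) \<in> set ps" for p n
  proof (cases "length ps \<ge> 2")
    case True
    have "(hat t p, hat t n) \<in> set (hats t ps)" using x by (force simp: hats_def)
    then show ?thesis using kap_nonempty[OF c l] True by (auto simp: hats_def)
  next
    \<comment> \<open>A single pair has no neighbour to merge with, and the exponent sum takes over:
      both runs contain equally many letters \<open>t\<close>. A run that vanishes is
      \<open>[\<not> t]\<close>, so the other one contains no \<open>t\<close> and ends in
      \<open>\<not> t\<close> too, although the last letters differ.\<close>
    case False
    then have "ps = [(p, n)]" using x by (cases ps; cases "tl ps") auto
    then have "ex t w = ex t (pos p - pos n)" using ex_cnj[OF ps(2), of t] by simp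
    then have cnt: "count_list p t = count_list n t"
      using e by (simp add: ghom_minus[OF ghom_ex] ex_pos)
    have aux: False if "u \<noteq> []" "v \<noteq> []" "last u \<noteq> last v" "count_list u t = count_list v t" "hat t u = []"
      for u v
    proof -
      have u: "u = [\<not> t]" by (rule hat_eq_Nil[OF that(1,5)])
      then have "count_list v t = 0" using that(4) by simp
      then have "t \<notin> set v" by (simp add: count_list_0_iff)
      then have "last v \<noteq> t" using that(2) by (rule last_neqI)
      then have "last v = (\<not> t)" by blast
      then show False using that(3) u by simp
    qed
    show ?thesis using aux[of p n] aux[of n p] ne[OF x] cnt by metis
  qed
  have "turn (map_prod (hat t) (hat t) x) (map_prod (hat t) (hat t) y) = turn x y"
    if "x \<in> set ps" "y \<in> set ps" for x y
    using ne'[of "fst x" "snd x"] ne'[of "fst y" "snd y"] that by (simp add: turn_def hd_hat)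
  note turn = this
  have "successively turn (hats t ps)"
  proof -
    have "successively turn ps" using ps(1) by (simp add: good_def lgood_def)
    then show ?thesis unfolding hats_def successively_map
      by (rule successively_mono) (use turn in auto)
  qed
  moreover have "turn (last (hats t ps)) (hd (hats t ps))"
  proof -
    have "ps \<noteq> []" "turn (last ps) (hd ps)" using ps(1) by (auto simp: good_def lgood_def)
    then show ?thesis using turn[of "last ps" "hd ps"] by (simp add: hats_def last_map hd_map)
  qed
  moreover have "ps \<noteq> []" using ps(1) by (auto simp: good_def lgood_def)
  moreover have "last (hat t p) \<noteq> last (hat t n)" if "(p, n) \<in> set ps" for p n
    using ne[OF that] ne'[OF that] by (simp add: last_hat)
  ultimately show "good (hats t ps)"
    using ne' by (auto simp: good_def lgood_def hats_def)
qed

definition stw :: "bool list \<Rightarrow> f2 \<Rightarrow> f2" where "stw ws = foldr st ws"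

definition hatw :: "bool list \<Rightarrow> bool list \<Rightarrow> bool list" where "hatw ws = foldr hat ws"

lemma stw_simps [simp]:
  "stw [] x = x" "stw (t # ws) x = st t (stw ws x)" "stw (us @ ws) x = stw us (stw ws x)"
  by (simp_all add: stw_def)

lemma hatw_simps [simp]:
  "hatw [] x = x" "hatw (t # ws) x = hat t (hatw ws x)" "hatw (us @ ws) x = hatw us (hatw ws x)"
  by (simp_all add: hatw_def)

lemma ghom_stw: "ghom (stw ws)"
  by (rule ghomI, induction ws) (simp_all add: ghom_plus[OF ghom_st])

lemma kap_stw: "kap (stw ws w) \<le> kap w"
  by (induction ws) (auto intro: order_trans[OF kap_st])

lemma ex_stw: "(\<And>t. t \<in> set ws \<Longrightarrow> ex t w = 0) \<Longrightarrow> ex g (stw ws w) = ex g w"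
proof (induction ws arbitrary: g)
  case (Cons t ws)
  have "ex h (stw ws w) = ex h w" for h by (rule Cons.IH) (use Cons.prems in simp)
  moreover have "ex t w = 0" using Cons.prems by simp
  ultimately show ?case by (simp add: ex_st)
qed simp

lemma good_hatw:
  assumes "good ps" "cnj w (val ps)" "length ps = kap w" "\<And>t. t \<in> set ws \<Longrightarrow> ex t w = 0"
    and "kap (stw ws w) = kap w"
  shows "good (map (map_prod (hatw ws) (hatw ws)) ps) \<and>
    cnj (stw ws w) (val (map (map_prod (hatw ws) (hatw ws)) ps))"
  using assms(4,5)
proof (induction ws)
  case Nil
  have "map_prod (hatw []) (hatw []) = id" by (auto simp: fun_eq_iff hatw_def)
  then show ?case using assms(1,2) by simp
next
  case (Cons t ws)
  \<comment> \<open>\<open>kap\<close> never increases along the way and has the same value at both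
    ends, so it is constant in between.\<close>
  have k: "kap (stw ws w) = kap w"
    using Cons.prems(2) kap_st[of t "stw ws w"] kap_stw[of ws w] by simp
  let ?qs = "map (map_prod (hatw ws) (hatw ws)) ps"
  have IH: "good ?qs" "cnj (stw ws w) (val ?qs)" using Cons k by auto
  have "length ?qs = kap (stw ws w)" using assms(3) k by simp
  moreover have "kap (st t (stw ws w)) = kap (stw ws w)" using Cons.prems(2) k by simp
  moreover have "ex t (stw ws w) = 0" using ex_stw[of ws w t] Cons.prems(1) by simp
  ultimately have g: "good (hats t ?qs)" "cnj (st t (stw ws w)) (val (hats t ?qs))"
    using good_hats[OF IH, of t] by blast+
  have "hats t ?qs = map (map_prod (hatw (t # ws)) (hatw (t # ws))) ps"
    by (simp add: hats_def comp_def map_prod_def case_prod_beta)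
  with g show ?case by (simp only: stw_simps simp_thms)
qed

text \<open>All iterates are good lists for the same conjugacy class, so their words have equal
  length and there are finitely many of them. From a repetition on, a power of
  \<open>hatw ws\<close> fixes every run.\<close>

lemma good_periodic:
  assumes "good ps" "cnj w (val ps)" "length ps = kap w" "\<And>t. t \<in> set ws \<Longrightarrow> ex t w = 0"
    and w: "cnj w (stw ws w)"
  obtains qs d where "good qs" "cnj w (val qs)" "d > 0"
    "\<And>p n. (p, n) \<in> set qs \<Longrightarrow> hatw (concat (replicate d ws)) p = p \<and> hatw (concat (replicate d ws)) n = n"
proof -
  define f where "f d = map (map_prod (hatw (concat (replicate d ws))) (hatw (concat (replicate d ws)))) ps" for d
  have wd: "cnj w (stw (concat (replicate d ws)) w)" for d
  proof (induction d)
    case (Suc d)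
    have "cnj (stw ws w) (stw ws (stw (concat (replicate d ws)) w))"
      by (rule cnj_ghom[OF ghom_stw Suc])
    then show ?case using cnj_trans[OF w] by simp
  qed simp
  have f: "good (f d)" "cnj w (val (f d))" for d
  proof -
    have "t \<in> set (concat (replicate d ws)) \<Longrightarrow> ex t w = 0" for t
      using assms(4) by (auto split: if_splits)
    then have "good (f d) \<and> cnj (stw (concat (replicate d ws)) w) (val (f d))"
      unfolding f_def using good_hatw[OF assms(1-3)] kap_cnj[OF wd[of d]] by metis
    then show "good (f d)" "cnj w (val (f d))" using cnj_trans[OF wd] by auto
  qed
  define B where "B = length (tw ps)"
  define L where "L = {p :: bool list. set p \<subseteq> UNIV \<and> length p \<le> B}"
  have finL: "finite L" unfolding L_def by (rule finite_lists_length_le) simp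
  have fS: "f d \<in> {qs. set qs \<subseteq> L \<times> L \<and> length qs = length ps}" for d
  proof -
    have len: "sum_list (map (\<lambda>(p, n). length p + length n) (f d)) = B"
      using cnj_good_length[OF assms(1) f(1)[of d]] cnj_trans[OF cnj_sym[OF assms(2)] f(2)[of d]]
      by (simp add: length_tw B_def)
    have "length p + length n \<le> B" if "(p, n) \<in> set (f d)" for p n
      using member_le_sum_list[of "length p + length n" "map (\<lambda>(p, n). length p + length n) (f d)"]
        that len by force
    then have "set (f d) \<subseteq> L \<times> L" by (fastforce simp: L_def)
    then show ?thesis by (simp add: f_def)
  qed
  have "finite {qs. set qs \<subseteq> L \<times> L \<and> length qs = length ps}"
    by (rule finite_lists_length_eq) (simp add: finL)
  then obtain i j where ij: "i < j" "f i = f j"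
    by (rule nat_pigeonhole) (rule fS)
  define d where "d = j - i"
  have d: "concat (replicate j ws) = concat (replicate d ws) @ concat (replicate i ws)"
    using ij(1) replicate_add[of d i ws] by (simp add: d_def flip: concat_append)
  have "map_prod (hatw (concat (replicate d ws))) (hatw (concat (replicate d ws))) x = x"
    if "x \<in> set (f i)" for x
  proof -
    have "map (map_prod (hatw (concat (replicate d ws))) (hatw (concat (replicate d ws)))) (f i) = f j"
      by (simp add: f_def d comp_def map_prod_def case_prod_beta)
    then have "map (map_prod (hatw (concat (replicate d ws))) (hatw (concat (replicate d ws)))) (f i)
      = map id (f i)" using ij(2) by simp
    then show ?thesis using that unfolding map_eq_conv by simp
  qed
  then show ?thesis using that[of "f i" d] f[of i] ij(1) d_def by fastforce
qed

section \<open>Cyclic words preserved by positive automorphisms\<close>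

text \<open>The matrix of \<open>st t\<close>, written as an action on pairs of integers; exponent
  sums and letter counts minus 1 both transform by it.\<close>

definition stv :: "bool \<Rightarrow> (bool \<Rightarrow> int) \<Rightarrow> bool \<Rightarrow> int" where
  "stv t u = (\<lambda>g. if g = t then u g else u g + u (\<not> g))"

text \<open>
  The letter lost in \<open>hat\<close> makes the number of letters minus 1 transform linearly.
\<close>

lemma count_hatw:
  assumes "hatw ws p \<noteq> []"
  shows "(\<lambda>g. int (count_list (hatw ws p) g) - 1) = foldr stv ws (\<lambda>g. int (count_list p g) - 1)"
  using assms
proof (induction ws)
  case (Cons t ws)
  then have ne: "hatw ws p \<noteq> []" by auto
  have "int (count_list (hatw (t # ws) p) g) - 1 =
    stv t (\<lambda>g. int (count_list (hatw ws p) g) - 1) g" for g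
    using count_hat[OF ne, of t] by (cases "g = t") (auto simp: stv_def)
  then show ?case using Cons.IH[OF ne] by (simp add: fun_eq_iff)
qed simp

lemma ex_stw_stv: "(\<lambda>g. ex g (stw ws w)) = foldr stv ws (\<lambda>g. ex g w)"
proof (induction ws)
  case (Cons t ws)
  have "(\<lambda>g. ex g (stw (t # ws) w)) = stv t (\<lambda>g. ex g (stw ws w))"
    by (auto simp: fun_eq_iff stv_def ex_st)
  then show ?case by (simp only: Cons foldr_Cons comp_apply)
qed simp

lemma stv_simps:
  "stv True v True = v True" "stv True v False = v False + v True"
  "stv False v False = v False" "stv False v True = v True + v False"
  by (simp_all add: stv_def)

text \<open>A product of elementary matrices has nonnegative entries and determinant 1, and an
  off-diagonal entry is positive as soon as its letter occurs in \<open>ws\<close>.\<close>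

lemma foldr_stv_matrix:
  "\<exists>p q r s :: int. p \<ge> 1 \<and> q \<ge> 0 \<and> r \<ge> 0 \<and> s \<ge> 1 \<and> p * s - q * r = 1 \<and>
     (True \<in> set ws \<longrightarrow> r \<ge> 1) \<and> (False \<in> set ws \<longrightarrow> q \<ge> 1) \<and>
     (\<forall>u. foldr stv ws u True = p * u True + q * u False \<and> foldr stv ws u False = r * u True + s * u False)"
proof (induction ws)
  case Nil
  then show ?case
    by (rule exI[of _ 1], rule exI[of _ 0], rule exI[of _ 0], rule exI[of _ 1]) simp
next
  case (Cons t ws)
  then obtain p q r s :: int where pqrs: "p \<ge> 1" "q \<ge> 0" "r \<ge> 0" "s \<ge> 1" "p * s - q * r = 1"
    "True \<in> set ws \<longrightarrow> r \<ge> 1" "False \<in> set ws \<longrightarrow> q \<ge> 1"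
    "\<forall>u. foldr stv ws u True = p * u True + q * u False \<and> foldr stv ws u False = r * u True + s * u False"
    by (elim exE conjE)
  show ?case
  proof (cases t)
    case True
    show ?thesis
      by (rule exI[of _ p], rule exI[of _ q], rule exI[of _ "r + p"], rule exI[of _ "s + q"])
         (use pqrs True in \<open>auto simp: stv_simps algebra_simps\<close>)
  next
    case False
    show ?thesis
      by (rule exI[of _ "p + r"], rule exI[of _ "q + s"], rule exI[of _ r], rule exI[of _ s])
         (use pqrs False in \<open>auto simp: stv_simps algebra_simps\<close>)
  qed
qed

lemma foldr_stv_fixed:
  assumes "True \<in> set ws" "False \<in> set ws" "foldr stv ws u = u"
  shows "u g = 0"
proof -
  obtain p q r s :: int where pqrs: "p \<ge> 1" "q \<ge> 1" "r \<ge> 1" "s \<ge> 1" "p * s - q * r = 1"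
    and u: "foldr stv ws u True = p * u True + q * u False"
      "foldr stv ws u False = r * u True + s * u False"
    using foldr_stv_matrix[of ws] assms(1,2) by blast
  have e: "(p - 1) * u True + q * u False = 0" "r * u True + (s - 1) * u False = 0"
    using u assms(3) by (simp_all add: algebra_simps)
  have "q * r \<ge> 1" using pqrs(2,3) mult_mono[of 1 q 1 r] by simp
  then have "p * s \<ge> 2" using pqrs(5) by simp
  have "p + s \<noteq> 2"
  proof
    assume "p + s = 2"
    then have "p = 1" "s = 1" using pqrs(1,4) by auto
    then show False using \<open>p * s \<ge> 2\<close> by simp
  qed
  \<comment> \<open>For determinant 1 this number is the determinant of the matrix minus the
    identity. It does not vanish because the trace exceeds 2; the two identities below are Cramer's
    rule.\<close>
  then have D: "2 - p - s \<noteq> 0" by simp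
  have "(2 - p - s) * u True = (s - 1) * ((p - 1) * u True + q * u False) - q * (r * u True + (s - 1) * u False)
      - (p * s - q * r - 1) * u True" by (simp add: algebra_simps)
  then have T: "u True = 0" using e pqrs(5) D by simp
  have "(2 - p - s) * u False = (p - 1) * (r * u True + (s - 1) * u False) - r * ((p - 1) * u True + q * u False)
      - (p * s - q * r - 1) * u False" by (simp add: algebra_simps)
  then have "u False = 0" using e pqrs(5) D by simp
  with T show ?thesis by (cases g) auto
qed

lemma stv_power: "foldr stv (replicate m t) u (\<not> t) = u (\<not> t) + int m * u t"
proof -
  have "foldr stv (replicate m t) u (\<not> t) = u (\<not> t) + int m * u t \<and> foldr stv (replicate m t) u t = u t"
    by (induction m) (auto simp: stv_def algebra_simps)
  then show ?thesis by blast
qed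

lemma concat_replicate_replicate: "concat (replicate d (replicate m x)) = replicate (d * m) x"
  by (induction d) (simp_all add: replicate_add)

lemma pos_replicate: "pos (replicate k g) = nm k (gen g)"
  by (induction k) (simp_all add: pos_Cons)

lemma count_0_replicate: "count_list p g = 0 \<Longrightarrow> p = replicate (length p) (\<not> g)"
  by (induction p) (auto split: if_splits)

lemma pos_count_0:
  assumes "count_list p t = 0"
  shows "st t (pos p) = pos p" "pos p + gen (\<not> t) = gen (\<not> t) + pos p"
proof -
  have p: "pos p = nm (length p) (gen (\<not> t))"
    using count_0_replicate[OF assms] pos_replicate by metis
  show "st t (pos p) = pos p" by (simp add: p ghom_nm[OF ghom_st] st_gen)
  show "pos p + gen (\<not> t) = gen (\<not> t) + pos p" by (simp add: p nm_comm)
qed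

text \<open>The new letter \<open>\<not> t\<close> arises behind the only \<open>t\<close> and moves
  to the end through a power of itself.\<close>

lemma st_pos_count_1: "count_list p t = 1 \<Longrightarrow> st t (pos p) = pos p + gen (\<not> t)"
proof (induction p)
  case (Cons g p)
  show ?case
  proof (cases "g = t")
    case True
    then have "count_list p t = 0" using Cons.prems by simp
    from pos_count_0[OF this] show ?thesis
      by (simp add: pos_Cons ghom_plus[OF ghom_st] st_gen True add.assoc)
  next
    case False
    then show ?thesis using Cons
      by (simp add: pos_Cons ghom_plus[OF ghom_st] st_gen add.assoc)
  qed
qed simp

lemma good_nonempty: "good ps \<Longrightarrow> (p, n) \<in> set ps \<Longrightarrow> p \<noteq> [] \<and> n \<noteq> [] \<and> last p \<noteq> last n"
  by (auto simp: good_def lgood_def)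

text \<open>In a periodic good list every run contains the letter \<open>t\<close> exactly once, so
  \<open>st t\<close> appends \<open>gen (\<not> t)\<close> to both runs of a pair, where it
  cancels.\<close>

lemma cnj_power_step_fixed:
  assumes m: "m > 0" and w: "cnj w (stw (replicate m t) w)"
  obtains y where "cnj w y" "st t y = y"
proof -
  have "ex (\<not> t) w = foldr stv (replicate m t) (\<lambda>g. ex g w) (\<not> t)"
    using ex_cnj[OF w, of "\<not> t"] fun_cong[OF ex_stw_stv[of "replicate m t" w], of "\<not> t"] by simp
  \<comment> \<open>Each application of \<open>st t\<close> adds \<open>ex t w\<close> to the other
    exponent sum, which must return to its value.\<close>
  then have "ex (\<not> t) w = ex (\<not> t) w + int m * ex t w" by (simp only: stv_power)
  then have e: "ex t w = 0" using m by simp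
  show ?thesis
  proof (cases rule: good_exists[of w])
    case (Pos p)
    then have "count_list p t = 0" using ex_cnj[OF Pos, of t] e by (simp add: ex_pos)
    then show ?thesis using that Pos pos_count_0(1) by blast
  next
    case (Neg p)
    then have "count_list p t = 0"
      using ex_cnj[OF Neg, of t] e by (simp add: ex_pos ghom_uminus[OF ghom_ex])
    then have "st t (- pos p) = - pos p" using pos_count_0(1) by (simp add: ghom_uminus[OF ghom_st])
    then show ?thesis using that Neg by blast
  next
    case (Good ps)
    have "\<And>s. s \<in> set (replicate m t) \<Longrightarrow> ex s w = 0" using e by simp
    then obtain qs d where qs: "good qs" "cnj w (val qs)" "d > 0"
      "\<And>p n. (p, n) \<in> set qs \<Longrightarrow> hatw (replicate (d * m) t) p = p \<and> hatw (replicate (d * m) t) n = n"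
      using good_periodic[OF Good(1,2,3) _ w] concat_replicate_replicate by metis
    have one: "count_list u t = 1" if "hatw (replicate (d * m) t) u = u" "u \<noteq> []" for u
    proof -
      define v where "v g = int (count_list u g) - 1" for g
      have "v = foldr stv (replicate (d * m) t) v"
        using count_hatw[of "replicate (d * m) t" u] that unfolding v_def by simp
      \<comment> \<open>The shifted count of \<open>\<not> t\<close> grows by \<open>v t\<close> at
        each step, so periodicity of the run forces \<open>v t = 0\<close>, i.e. a single letter
        \<open>t\<close>.\<close>
      then have "v (\<not> t) = v (\<not> t) + int (d * m) * v t" by (metis stv_power)
      then have "v t = 0" using m qs(3) by simp
      then show ?thesis by (simp add: v_def)
    qed
    have "st t (val rs) = val rs" if "set rs \<subseteq> set qs" for rs
      using that
    proof (induction rs)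
      case (Cons x rs)
      obtain p n where x: "x = (p, n)" by (cases x)
      have pn: "(p, n) \<in> set qs" using Cons.prems x by simp
      have "count_list p t = 1" "count_list n t = 1"
        using one qs(4)[OF pn] good_nonempty[OF qs(1) pn] by auto
      then have "st t (pos p - pos n) = pos p - pos n"
        by (simp add: ghom_minus[OF ghom_st] st_pos_count_1) (simp add: grp del: add_uminus_conv_diff)
      then show ?case using Cons by (simp add: x ghom_plus[OF ghom_st])
    qed (simp add: ghom_zero[OF ghom_st])
    then show ?thesis using that[OF qs(2)] by simp
  qed
qed

section \<open>The conjugacy classes preserved by a hyperbolic automorphism\<close>

definition cc :: f2 where "cc = gen True + gen False - gen True - gen False"

lemma counts_1:
  assumes "count_list p True = 1" "count_list p False = 1"
  shows "p = [True, False] \<or> p = [False, True]"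
proof -
  have "length p = 2" using length_eq_counts[of p True] assms by simp
  then obtain x y where "p = [x, y]" by (auto simp: length_Suc_conv numeral_2_eq_2)
  then show ?thesis using assms by (cases x; cases y) auto
qed

text \<open>A pair of distinct arrangements of the two letters is the commutator or its inverse, and
  \<open>turn\<close> forces the same choice in all pairs.\<close>

lemma val_commutators:
  assumes "lgood ps"
    and "\<And>p n. (p, n) \<in> set ps \<Longrightarrow> p \<in> {[True, False], [False, True]} \<and> n \<in> {[True, False], [False, True]}"
  shows "val ps = nm (length ps) (if hd (fst (hd ps)) then cc else - cc)"
  using assms
proof (induction ps)
  case Nil
  then show ?case by (simp add: lgood_def)
next
  case (Cons x ps)
  obtain p n where x: "x = (p, n)" by (cases x)
  have "last p \<noteq> last n" using Cons.prems(1) by (simp add: lgood_def x)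
  moreover have "p \<in> {[True, False], [False, True]}" "n \<in> {[True, False], [False, True]}"
    using Cons.prems(2)[of p n] by (simp_all add: x)
  ultimately have pn: "p = [True, False] \<and> n = [False, True] \<or> p = [False, True] \<and> n = [True, False]"
    by auto
  then have pnv: "pos p - pos n = (if hd p then cc else - cc)" "hd n = (\<not> hd p)"
    by (auto simp: pos_Cons cc_def grp simp del: add_uminus_conv_diff)
  show ?case
  proof (cases "ps = []")
    case True
    then show ?thesis using pnv by (simp add: x)
  next
    case False
    then have "lgood ps" "turn x (hd ps)"
      using Cons.prems(1) by (auto simp: lgood_def successively_Cons)
    moreover from this have "hd (fst (hd ps)) = hd p" using pnv(2) by (auto simp: turn_def x)
    moreover have "val ps = nm (length ps) (if hd (fst (hd ps)) then cc else - cc)"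
      by (rule Cons.IH[OF \<open>lgood ps\<close>]) (use Cons.prems(2) in auto)
    ultimately show ?thesis using pnv(1) by (simp add: x)
  qed
qed

lemma nm_uminus:
  fixes x :: "'g::group_add"
  shows "nm k (- x) = - nm k x"
proof (induction k)
  case (Suc k)
  have "- nm (Suc k) x = - (nm k x + x)" by (simp only: nm.simps nm_comm)
  then show ?case by (simp only: nm.simps Suc minus_add)
qed simp

text \<open>The matrix has no nonzero fixed vector. Applied to exponent sums this yields 0, and
  applied to shifted letter counts of periodic runs it yields one letter of each kind in every
  run.\<close>

lemma cnj_hyperbolic_commutator:
  assumes ws: "True \<in> set ws" "False \<in> set ws" and w: "cnj w (stw ws w)"
  obtains k where "cnj w (zm k cc)"
proof -
  have "(\<lambda>g. ex g w) = foldr stv ws (\<lambda>g. ex g w)"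
    using ex_cnj[OF w] ex_stw_stv[of ws w] by simp
  then have e: "ex g w = 0" for g using foldr_stv_fixed[OF ws, of "\<lambda>g. ex g w" g] by simp
  show ?thesis
  proof (cases rule: good_exists[of w])
    case (Pos p)
    then have "count_list p g = 0" for g using ex_cnj[OF Pos, of g] e by (simp add: ex_pos)
    then have "p = []" using length_eq_counts[of p True] by simp
    then show ?thesis using that[of 0] Pos by simp
  next
    case (Neg p)
    then have "count_list p g = 0" for g
      using ex_cnj[OF Neg, of g] e by (simp add: ex_pos ghom_uminus[OF ghom_ex])
    then have "p = []" using length_eq_counts[of p True] by simp
    then show ?thesis using that[of 0] Neg by simp
  next
    case (Good ps)
    obtain qs d where qs: "good qs" "cnj w (val qs)" "d > 0"
      "\<And>p n. (p, n) \<in> set qs \<Longrightarrow>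
        hatw (concat (replicate d ws)) p = p \<and> hatw (concat (replicate d ws)) n = n"
      by (rule good_periodic[OF Good(1,2,3) e w]) blast
    let ?W = "concat (replicate d ws)"
    have W: "True \<in> set ?W" "False \<in> set ?W" using ws qs(3) by auto
    have one: "u \<in> {[True, False], [False, True]}" if "hatw ?W u = u" "u \<noteq> []" for u
    proof -
      have "foldr stv ?W (\<lambda>g. int (count_list u g) - 1) = (\<lambda>g. int (count_list u g) - 1)"
        using count_hatw[of ?W u] that by simp
      from foldr_stv_fixed[OF W this] have "count_list u g = 1" for g by (simp add: algebra_simps)
      then show ?thesis using counts_1[of u] by simp
    qed
    have "lgood qs" using qs(1) by (simp add: good_def)
    then have "val qs = nm (length qs) (if hd (fst (hd qs)) then cc else - cc)"
      by (rule val_commutators) (use one qs(4) good_nonempty[OF qs(1)] in blast)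
    then have "val qs = zm (int (length qs)) cc \<or> val qs = zm (- int (length qs)) cc"
      by (auto simp: zm_of_nat zm_uminus nm_uminus)
    then show ?thesis using that qs(2) by metis
  qed
qed

section \<open>Syllable normal forms\<close>

text \<open>The form b^n a^(+-1) b^k a^(+-1) ... of an element, in which every letter a is a
  syllable of its own together with the power of b behind it. Multiples of \<open>st True\<close>
  and conjugations by powers of b then only shift exponents.\<close>

definition sval :: "int \<Rightarrow> (bool \<times> int) list \<Rightarrow> f2" where
  "sval n ss = zm n (gen False) +
     sum_list (map (\<lambda>(e, k). (if e then gen True else - gen True) + zm k (gen False)) ss)"

fun srd :: "(bool \<times> int) list \<Rightarrow> bool" where
  "srd [] \<longleftrightarrow> True"
| "srd ((e, k) # ss) \<longleftrightarrow> srd ss \<and> (ss = [] \<or> fst (hd ss) = e \<or> k \<noteq> 0)"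

lemma sval_Nil: "sval n [] = zm n (gen False)"
  by (simp add: sval_def)

lemma sval_Cons: "sval n ((e, k) # ss) = zm n (gen False) + (if e then gen True else - gen True) + sval k ss"
  by (simp add: sval_def add.assoc)

lemma sval_add: "zm m (gen False) + sval n ss = sval (m + n) ss"
  by (simp add: sval_def zm_add add.assoc)

lemma sval_exists: "\<exists>n ss. wd w = sval n ss \<and> srd ss"
proof (induction w)
  case Nil
  have "wd [] = sval 0 []" by (simp add: sval_Nil)
  then show ?case by (metis srd.simps(1))
next
  case (Cons l w)
  then obtain n ss where IH: "wd w = sval n ss" "srd ss" by blast
  obtain e g where l: "l = (e, g)" by (cases l)
  have w: "wd (l # w) = (if e then gen g else - gen g) + sval n ss"
    using wd_Cons[of l w] wd_single[of l] by (simp add: l IH)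
  show ?case
  proof (cases g)
    case False
    have "wd (l # w) = sval ((if e then 1 else - 1) + n) ss"
      using sval_add[of "if e then 1 else - 1" n ss] by (simp add: w False zm_uminus split: if_splits)
    then show ?thesis using IH(2) by blast
  next
    case True
    show ?thesis
    proof (cases "srd ((e, n) # ss)")
      case True
      have "wd (l # w) = sval 0 ((e, n) # ss)" by (simp add: sval_Cons w \<open>g\<close>)
      then show ?thesis using True by blast
    next
      case False
      then obtain k ts where ss: "ss = (\<not> e, k) # ts" "n = 0"
        using IH(2) by (cases ss) auto
      have "wd (l # w) = sval k ts" by (simp add: w \<open>g\<close> ss sval_Cons)
      moreover have "srd ts" using IH(2) ss by simp
      ultimately show ?thesis by blast
    qed
  qed
qed

definition bw :: "int \<Rightarrow> bool letter list" where "bw n = replicate (nat \<bar>n\<bar>) (n > 0, False)"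

lemma bw_0 [simp]: "bw 0 = []"
  by (simp add: bw_def)

lemma bw_inject: "bw n = bw m \<Longrightarrow> n = m"
  by (auto simp: bw_def replicate_eq_replicate)

lemma wd_bw: "wd (bw n) = zm n (gen False)"
proof -
  have r: "wd (replicate k l) = nm k (wd [l])" for k l
  proof (induction k)
    case (Suc k)
    then show ?case using wd_Cons[of l "replicate k l"] by simp
  qed simp
  show ?thesis by (auto simp: bw_def r wd_single zm_def nm_uminus)
qed

definition sword :: "int \<Rightarrow> (bool \<times> int) list \<Rightarrow> bool letter list" where
  "sword n ss = bw n @ concat (map (\<lambda>(e, k). (e, True) # bw k) ss)"

lemma sword_simps:
  "sword n [] = bw n" "sword n ((e, k) # ss) = bw n @ (e, True) # sword k ss"
  by (simp_all add: sword_def)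

lemma wd_sword: "wd (sword n ss) = sval n ss"
proof (induction ss arbitrary: n)
  case (Cons x ss)
  obtain e k where x: "x = (e, k)" by (cases x)
  have "wd (sword n (x # ss)) = wd (bw n) + (wd [(e, True)] + wd (sword k ss))"
    by (simp only: x sword_simps wd_append wd_Cons[of "(e, True)" "sword k ss"])
  then show ?case by (simp add: x Cons wd_bw wd_single sval_Cons add.assoc)
qed (simp add: sword_simps wd_bw sval_Nil)

lemma reduced_bw: "reduced_word (bw n)"
proof -
  have "reduced_word (replicate k l)" for k and l :: "bool letter"
    by (induction k) (auto simp: reduced_word_Cons hd_replicate prod_eq_iff)
  then show ?thesis by (simp add: bw_def)
qed

lemma snd_bw: "l \<in> set (bw n) \<Longrightarrow> \<not> snd l"
  by (auto simp: bw_def)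

lemma bw_eq_Nil: "bw n = [] \<longleftrightarrow> n = 0"
  by (auto simp: bw_def)

lemma reduced_sword: "srd ss \<Longrightarrow> reduced_word (sword n ss)"
proof (induction ss arbitrary: n)
  case Nil
  then show ?case by (simp add: sword_simps reduced_bw)
next
  case (Cons x ss)
  obtain e k where x: "x = (e, k)" by (cases x)
  have IH: "reduced_word (sword k ss)" using Cons by (simp add: x)
  have "sword k ss = [] \<or> hd (sword k ss) \<noteq> (\<not> e, True)"
  proof (cases "k = 0")
    case True
    then have "sword k ss = [] \<or> hd (sword k ss) = (fst (hd ss), True)"
      by (cases ss) (auto simp: sword_def bw_eq_Nil)
    then show ?thesis using Cons.prems True by (auto simp: x sword_def bw_eq_Nil)
  next
    case False
    then have "hd (sword k ss) \<in> set (bw k)" by (simp add: sword_def hd_append bw_eq_Nil)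
    then show ?thesis using snd_bw by fastforce
  qed
  then have "reduced_word ((e, True) # sword k ss)" using IH by (simp add: reduced_word_Cons)
  moreover have "bw n = [] \<or> (e, True) \<noteq> linv (last (bw n))"
    using snd_bw[OF last_in_set, of n] by (auto simp: prod_eq_iff)
  ultimately show ?case by (auto simp: x sword_simps reduced_word_append reduced_bw)
qed

lemma sword_inject: "sword n ss = sword m ts \<Longrightarrow> n = m \<and> ss = ts"
proof (induction ss arbitrary: n m ts)
  have tk: "takeWhile (\<lambda>l. \<not> snd l) (sword n ss) = bw n" for n ss
  proof -
    have "takeWhile (\<lambda>l. \<not> snd l) (bw n @ r) = bw n @ takeWhile (\<lambda>l. \<not> snd l) r" for r
      by (rule takeWhile_append2) (use snd_bw in auto)
    moreover have "sword n ss = bw n @ (if ss = [] then [] else (fst (hd ss), True) # sword (snd (hd ss)) (tl ss))"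
      by (cases ss) (auto simp: sword_simps)
    ultimately show ?thesis by simp
  qed
  {
    case Nil
    have nm: "n = m" using tk[of n "[]"] tk[of m ts] Nil bw_inject by metis
    then show ?case using Nil by (cases ts) (auto simp: sword_def)
  next
    case (Cons x ss)
    have nm: "n = m" using tk[of n "x # ss"] tk[of m ts] Cons.prems bw_inject by metis
    obtain e k where x: "x = (e, k)" by (cases x)
    obtain e' k' ts' where ts: "ts = (e', k') # ts'"
      using Cons.prems nm by (cases ts) (auto simp: sword_def x)
    have "e = e'" "sword k ss = sword k' ts'" using Cons.prems nm by (simp_all add: x ts sword_simps)
    then show ?case using Cons.IH[of k k' ts'] nm by (simp add: x ts)
  }
qed

text \<open>Normal forms spell reduced words, and the positions of the letter a in such a word
  determine the syllables.\<close>

lemma sval_inject: "sval n ss = sval m ts \<Longrightarrow> srd ss \<Longrightarrow> srd ts \<Longrightarrow> n = m \<and> ss = ts"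
  by (metis reduced_sword rep_wd sword_inject wd_sword)

text \<open>This family contains the powers of \<open>st True\<close> as \<open>p = 0\<close> and is
  closed under composition with conjugations by powers of b, which move weight from \<open>q\<close>
  to \<open>p\<close>.\<close>

definition chi :: "int \<Rightarrow> int \<Rightarrow> f2 \<Rightarrow> f2" where
  "chi p q = lift (\<lambda>g. if g then zm p (gen False) + gen True + zm q (gen False) else gen False)"

lemma ghom_chi: "ghom (chi p q)" by (simp add: chi_def ghom_lift)

text \<open>The exponent of b that the image of the first syllable puts in front of its letter. The
  inverse of b^p a b^q is b^(-q) a^(-1) b^(-p), whence the exchange of \<open>p\<close> and
  \<open>- q\<close> here and of \<open>q\<close> and \<open>- p\<close> in
  \<open>chs\<close>.\<close>

fun pre :: "int \<Rightarrow> int \<Rightarrow> (bool \<times> int) list \<Rightarrow> int" where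
  "pre p q [] = 0"
| "pre p q ((e, k) # ss) = (if e then p else - q)"

fun chs :: "int \<Rightarrow> int \<Rightarrow> (bool \<times> int) list \<Rightarrow> (bool \<times> int) list" where
  "chs p q [] = []"
| "chs p q ((e, k) # ss) = (e, (if e then q else - p) + k + pre p q ss) # chs p q ss"

lemma chi_sval: "chi p q (sval n ss) = sval (n + pre p q ss) (chs p q ss)"
proof (induction ss arbitrary: n)
  case Nil
  then show ?case by (simp add: sval_Nil ghom_zm[OF ghom_chi]) (simp add: chi_def)
next
  case (Cons x ss)
  obtain e k where x: "x = (e, k)" by (cases x)
  let ?b = "gen False"
  have b: "chi p q (zm n ?b) = zm n ?b" by (simp add: ghom_zm[OF ghom_chi]) (simp add: chi_def)
  have a: "chi p q (if e then gen True else - gen True) =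
    zm (if e then p else - q) ?b + (if e then gen True else - gen True) + zm (if e then q else - p) ?b"
    by (simp add: ghom_uminus[OF ghom_chi]) (simp add: chi_def zm_uminus grp del: add_uminus_conv_diff)
  have "chi p q (sval n (x # ss)) =
    zm n ?b + (zm (if e then p else - q) ?b + (if e then gen True else - gen True) + zm (if e then q else - p) ?b)
     + sval (k + pre p q ss) (chs p q ss)"
    by (simp only: x sval_Cons ghom_plus[OF ghom_chi] a b Cons)
  also have "\<dots> = zm (n + (if e then p else - q)) ?b + (if e then gen True else - gen True) +
     sval ((if e then q else - p) + (k + pre p q ss)) (chs p q ss)"
    by (simp only: sval_add[symmetric] zm_add add.assoc)
  finally show ?case by (simp add: x sval_Cons add.assoc)
qed

text \<open>Between a letter and its inverse the two corrections cancel, so precisely the exponents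
  that have to be nonzero stay unchanged.\<close>

lemma srd_chs: "srd ss \<Longrightarrow> srd (chs p q ss)"
proof (induction ss)
  case (Cons x ss)
  obtain e k where x: "x = (e, k)" by (cases x)
  show ?case using Cons
    by (cases ss) (auto simp: x split: if_splits)
qed simp

lemma chi_fixed_iff:
  assumes "srd ss"
  shows "chi p q (sval n ss) = sval n ss \<longleftrightarrow> pre p q ss = 0 \<and> chs p q ss = ss"
proof
  assume "chi p q (sval n ss) = sval n ss"
  then have "sval (n + pre p q ss) (chs p q ss) = sval n ss" by (simp only: chi_sval)
  from sval_inject[OF this srd_chs[OF assms] assms] show "pre p q ss = 0 \<and> chs p q ss = ss" by simp
qed (simp add: chi_sval)

lemma f2_syllables: obtains n ss where "x = sval n ss" "srd ss"
  using sval_exists[of "rep x"] by auto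

text \<open>The corrections of the exponents are homogeneous in \<open>p\<close> and
  \<open>q\<close>: those for the multiples vanish exactly if those for \<open>p\<close> and
  \<open>q\<close> do. This is how a property of a power passes to the automorphism itself.\<close>

lemma chi_fixed_scale:
  assumes "chi (k * p) (k * q) x = x" "k \<noteq> 0"
  shows "chi p q x = x"
proof -
  obtain n ss where x: "x = sval n ss" "srd ss" by (rule f2_syllables)
  have 1: "pre (k * p) (k * q) ss = k * pre p q ss" for ss by (cases ss) auto
  have "chs (k * p) (k * q) ss = ss \<Longrightarrow> chs p q ss = ss" for ss
  proof (induction ss)
    case (Cons y ss)
    obtain e j where y: "y = (e, j)" by (cases y)
    have "k * ((if e then q else - p) + pre p q ss) = 0"
      using Cons.prems by (simp add: y 1 algebra_simps split: if_splits)
    then show ?case using Cons assms(2) by (simp add: y)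
  qed simp
  then show ?thesis using assms 1[of ss] by (simp add: x chi_fixed_iff)
qed

lemma chi_fixed_trivial:
  assumes "chi p q x = x" "p \<noteq> 0" "q \<noteq> 0"
  obtains n where "x = zm n (gen False)"
proof -
  obtain n ss where x: "x = sval n ss" "srd ss" by (rule f2_syllables)
  have "pre p q ss = 0" using assms(1) by (simp add: x chi_fixed_iff)
  then have "ss = []" using assms(2,3) by (cases ss) (auto split: if_splits)
  then show ?thesis using that x sval_Nil by blast
qed

lemma cj_chi: "cj (zm n (gen False)) (chi p q x) = chi (n + p) (q - n) x"
proof -
  have "cj (zm n (gen False)) \<circ> chi p q = chi (n + p) (q - n)"
  proof (rule ghom_eqI)
    show "ghom (cj (zm n (gen False)) \<circ> chi p q)" by (rule ghom_comp[OF ghom_cj ghom_chi])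
    show "ghom (chi (n + p) (q - n))" by (rule ghom_chi)
    show "(cj (zm n (gen False)) \<circ> chi p q) (gen True) = chi (n + p) (q - n) (gen True)"
      by (simp add: chi_def cj_def zm_add zm_diff add_diff_eq add.assoc)
    have "zm n (gen False) + gen False = gen False + zm n (gen False)"
      using zm_comm[of n "gen False" 1] by simp
    then show "(cj (zm n (gen False)) \<circ> chi p q) (gen False) = chi (n + p) (q - n) (gen False)"
      by (simp add: chi_def cj_eq_iff)
  qed
  then show ?thesis by (metis comp_apply)
qed

lemma chi_0_0: "chi 0 0 x = x"
  using ghom_eqI[OF ghom_chi, of id 0 0] by (simp add: chi_def ghom_def)

lemma chi_stw: "stw (replicate m True) = chi 0 (int m)"
proof (induction m)
  case 0
  then show ?case by (simp add: fun_eq_iff chi_0_0)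
next
  case (Suc m)
  have "st True \<circ> chi 0 (int m) = chi 0 (int (Suc m))"
  proof (rule ghom_eqI)
    show "ghom (st True \<circ> chi 0 (int m))" by (rule ghom_comp[OF ghom_st ghom_chi])
    show "ghom (chi 0 (int (Suc m)))" by (rule ghom_chi)
    show "(st True \<circ> chi 0 (int m)) (gen False) = chi 0 (int (Suc m)) (gen False)"
      by (simp add: chi_def st_gen)
    have "zm (1 + int m) (gen False) = gen False + zm (int m) (gen False)" by (simp add: zm_add)
    then show "(st True \<circ> chi 0 (int m)) (gen True) = chi 0 (int (Suc m)) (gen True)"
      by (simp add: chi_def st_gen ghom_plus[OF ghom_st] ghom_zm[OF ghom_st] add.assoc)
  qed
  then show ?case using Suc by (auto simp: fun_eq_iff)
qed

lemma chi_st: "st True = chi 0 1"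
  using chi_stw[of 1] by (simp add: fun_eq_iff)

section \<open>Subgroups on which a positive automorphism is a conjugation\<close>

text \<open>The automorphism inserts letters \<open>\<not> t\<close> only, and cancellation can only
  remove letters.\<close>

lemma cnt_st_wd_le: "cnt t (st t (wd w)) \<le> lcnt t w"
proof (induction w)
  case Nil
  then show ?case by (simp add: ghom_zero[OF ghom_st])
next
  case (Cons l w)
  have "cnt t (st t (gen g)) \<le> (if g = t then 1 else 0)" for g
    using cnt_plus_le[of t "gen g" "gen (\<not> g)"] by (auto simp: st_gen cnt_def rep_gen)
  from this[of "snd l"] have "cnt t (st t (wd [l])) \<le> (if snd l = t then 1 else 0)"
    by (cases "fst l") (simp_all only: wd_single ghom_uminus[OF ghom_st] cnt_uminus if_True if_False)
  moreover have "cnt t (st t (wd (l # w))) \<le> cnt t (st t (wd [l])) + cnt t (st t (wd w))"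
    using cnt_plus_le by (subst wd_Cons) (simp only: ghom_plus[OF ghom_st])
  ultimately show ?case using Cons by simp
qed

lemma cnt_st_le: "cnt t (st t x) \<le> cnt t x"
  using cnt_st_wd_le[of t "rep x"] by (simp add: cnt_def)

lemma cnt_cj_le: "cnt t (cj g x) \<le> cnt t x + 2 * cnt t g"
  using cnt_plus_le[of t "g + x" "- g"] cnt_plus_le[of t g x] by (simp add: cj_def)

lemma stw_replicate_fixed: "st t x = x \<Longrightarrow> stw (replicate m t) x = x"
  by (induction m) simp_all

lemma wd_lcnt_0: "lcnt True w = 0 \<Longrightarrow> \<exists>n. wd w = zm n (gen False)"
proof (induction w)
  case Nil
  have "wd [] = zm 0 (gen False)" by simp
  then show ?case by blast
next
  case (Cons l w)
  then obtain n where n: "wd w = zm n (gen False)" by (auto split: if_splits)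
  have "snd l = False" using Cons.prems by (simp split: if_splits)
  then have "wd (l # w) = zm (if fst l then 1 else - 1) (gen False) + zm n (gen False)"
    using wd_Cons[of l w] wd_single[of l] by (simp add: n zm_uminus)
  then show ?case by (metis zm_add)
qed

text \<open>Conjugation by b^n is \<open>chi n (- n)\<close>, whose two parameters are nonzero, so
  only powers of b are fixed.\<close>

lemma centralizer_gen_False:
  assumes "n \<noteq> 0" "zm n (gen False) + x = x + zm n (gen False)"
  obtains k where "x = zm k (gen False)"
proof -
  have "cj (zm n (gen False)) (chi 0 0 x) = x"
    using assms(2) by (simp add: chi_0_0 cj_eq_iff)
  then have "chi n (- n) x = x" by (simp add: cj_chi)
  then obtain k where "x = zm k (gen False)" by (rule chi_fixed_trivial) (use assms(1) in simp_all)
  then show ?thesis by (rule that)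
qed

text \<open>Undoing the conjugation shows that \<open>chi (- N) (int m + N)\<close> fixes
  \<open>H\<close> pointwise. If one parameter vanishes, the other can be scaled to 1; if none does,
  \<open>H\<close> consists of powers of b, which \<open>st True\<close> fixes.\<close>

lemma parabolic_root_elliptic:
  assumes m: "m > 0"
    and H: "\<And>y. y \<in> H \<Longrightarrow> stw (replicate m True) y = cj (zm N (gen False)) y"
  shows "\<exists>d. \<forall>y\<in>H. st True y = cj (zm d (gen False)) y"
proof -
  have fx: "chi (- N) (int m + N) y = y" if "y \<in> H" for y
  proof -
    have "chi 0 (int m) y = cj (zm N (gen False)) y" using H[OF that] by (simp only: chi_stw)
    then have "cj (zm (- N) (gen False)) (chi 0 (int m) y) = y" by (simp add: zm_uminus)
    then show ?thesis by (simp add: cj_chi)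
  qed
  consider "N = 0" | "N = - int m" | "N \<noteq> 0" "int m + N \<noteq> 0" by linarith
  then show ?thesis
  proof cases
    case 1
    have "st True y = cj (zm 0 (gen False)) y" if "y \<in> H" for y
      using chi_fixed_scale[of "int m" 0 1 y] fx[OF that] m 1 by (simp add: chi_st)
    then show ?thesis by blast
  next
    case 2
    have "st True y = cj (zm (- 1) (gen False)) y" if "y \<in> H" for y
    proof -
      have "chi 1 0 y = y" using chi_fixed_scale[of "int m" 1 0 y] fx[OF that] m 2 by simp
      then have "cj (zm 1 (gen False)) (st True y) = y" using cj_chi[of 1 0 1 y] by (simp add: chi_st)
      then have "cj (zm (- 1) (gen False)) (cj (zm 1 (gen False)) (st True y)) = cj (zm (- 1) (gen False)) y"
        by simp
      then show ?thesis by (simp add: zm_uminus)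
    qed
    then show ?thesis by blast
  next
    case 3
    have "st True y = cj (zm 0 (gen False)) y" if y: "y \<in> H" for y
    proof -
      obtain k where "y = zm k (gen False)"
        using chi_fixed_trivial[OF fx[OF y]] 3 by auto
      then show ?thesis by (simp add: ghom_zm[OF ghom_st] st_gen)
    qed
    then show ?thesis by blast
  qed
qed

text \<open>The fixed element \<open>h\<close> commutes with \<open>g\<close>, so \<open>g\<close>
  is fixed by \<open>st True\<close> as well. The cases are whether \<open>g\<close> is trivial,
  contains the letter a after cyclic reduction, or is conjugate to a power of b.\<close>

lemma parabolic_root_fixed:
  assumes m: "m > 0" and H: "\<And>x. x \<in> H \<Longrightarrow> stw (replicate m True) x = cj g x"
    and h: "h \<in> H" "h \<noteq> 0" "st True h = h"
  shows "\<exists>e. \<forall>x\<in>H. st True x = cj e x"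
proof -
  let ?b = "gen False" and ?r = "stw (replicate m True)"
  have "cj g h = h" using H[OF h(1)] stw_replicate_fixed[OF h(3)] by simp
  then have "g + h = h + g" by (simp add: cj_eq_iff)
  then have sg: "st True g = g" using ghom_fixes_centralizer[OF ghom_st h(3,2)] by blast
  show ?thesis
  proof (cases "g = 0")
    case True
    have "\<exists>d. \<forall>y\<in>H. st True y = cj (zm d ?b) y"
      by (rule parabolic_root_elliptic[OF m, of H 0]) (use H True in simp)
    then show ?thesis by blast
  next
    case g: False
    obtain s u where su: "g = cj s u" "cyc (rep u)" using f2_cyclic_decomposition[OF g] by metis
    show ?thesis
    proof (cases "lcnt True (rep u) > 0")
      case True
      \<comment> \<open>Iterating turns \<open>x\<close> into its conjugates by the powers of
        \<open>g\<close>, without increasing the number of letters a. As the cyclic reduction of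
        \<open>g\<close> contains a, boundedness makes \<open>x\<close> commute with
        \<open>g\<close>, and the centralizer of a fixed element is fixed.\<close>
      have "st True x = x" if x: "x \<in> H" for x
      proof -
        have pw: "((?r ^^ j) x) = cj (nm j g) x" for j
        proof (induction j)
          case (Suc j)
          have "(?r ^^ Suc j) x = cj (?r (nm j g)) (?r x)"
            by (simp add: Suc ghom_apply_cj[OF ghom_stw])
          also have "?r (nm j g) = nm j g"
            by (simp add: ghom_nm[OF ghom_stw] stw_replicate_fixed[OF sg])
          also have "cj (nm j g) (?r x) = cj (nm j g + g) x" by (simp add: H[OF x] cj_cj)
          finally show ?case by (simp add: nm_comm)
        qed simp
        have "cnt True (stw (replicate k True) z) \<le> cnt True z" for k z
          by (induction k) (auto intro: order_trans[OF cnt_st_le])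
        then have "cnt True ((?r ^^ j) x) \<le> cnt True x" for j
          by (induction j) (auto intro: order_trans)
        then have c: "cnt True (cj (nm j g) x) \<le> cnt True x" for j by (simp only: pw)
        have "cj (nm j u) (cj (- s) x) = cj (- s) (cj (nm j g) x)" for j
        proof -
          have "nm j g = cj s (nm j u)" by (simp add: su(1) ghom_nm[OF ghom_cj])
          then have "cj (- s) (cj (nm j g) x) = cj (- s + cj s (nm j u)) x" by (simp add: cj_cj)
          also have "- s + cj s (nm j u) = nm j u + - s"
            by (simp add: cj_def grp del: add_uminus_conv_diff)
          finally show ?thesis by (simp only: cj_cj)
        qed
        then have "cnt True (cj (nm j u) (cj (- s) x)) \<le> cnt True x + 2 * cnt True (- s)" for j
          using cnt_cj_le[of True "- s" "cj (nm j g) x"] c[of j] by simp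
        from bounded_conj_commutes[OF su(2) True this]
        have "cj (- s) x + u = u + cj (- s) x" .
        then have "cj s (cj (- s) x + u) = cj s (u + cj (- s) x)" by simp
        then have "x + g = g + x" by (simp add: ghom_plus[OF ghom_cj] su(1))
        then show ?thesis using ghom_fixes_centralizer[OF ghom_st sg g] by blast
      qed
      then show ?thesis by (intro exI[of _ 0]) simp
    next
      case False
      then obtain n where n: "u = zm n ?b" using wd_lcnt_0[of "rep u"] by auto
      have "n \<noteq> 0" using g su(1) n by auto
      \<comment> \<open>Since \<open>g = cj s (zm n ?b)\<close> and \<open>zm n ?b\<close> are both
        fixed, \<open>- s + st True s\<close> centralizes a power of b and is itself a power of
        b.\<close>
      have "cj (st True s) (zm n ?b) = cj s (zm n ?b)"
        using sg by (simp add: su(1) n ghom_apply_cj[OF ghom_st] ghom_zm[OF ghom_st] st_gen)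
      then have "cj (- s) (cj (st True s) (zm n ?b)) = zm n ?b" by simp
      then have "zm n ?b + (- s + st True s) = (- s + st True s) + zm n ?b"
        by (simp add: cj_cj cj_eq_iff)
      then obtain r where "- s + st True s = zm r ?b" by (rule centralizer_gen_False[OF \<open>n \<noteq> 0\<close>])
      then have r: "st True s = s + zm r ?b" by (metis add_minus_cancel)
      have rs: "stw (replicate k True) s = s + zm (int k * r) ?b" for k
      proof (induction k)
        case (Suc k)
        have "stw (replicate (Suc k) True) s = s + (zm r ?b + zm (int k * r) ?b)"
          by (simp add: Suc ghom_plus[OF ghom_st] r ghom_zm[OF ghom_st] st_gen add.assoc)
        also have "zm r ?b + zm (int k * r) ?b = zm (int (Suc k) * r) ?b"
          by (simp add: algebra_simps flip: zm_add)
        finally show ?case .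
      qed simp
      let ?H = "cj (- s) ` H"
      \<comment> \<open>On the translated set \<open>?H\<close> the conjugator is a power of b,
        which is the case already settled.\<close>
      have "?r y = cj (zm (n - int m * r) ?b) y" if y: "y \<in> ?H" for y
      proof -
        obtain x where x: "x \<in> H" "y = cj (- s) x" using y by blast
        have "?r y = cj (- ?r s) (cj g x)"
          by (simp add: x(2) ghom_apply_cj[OF ghom_stw] ghom_uminus[OF ghom_stw] H[OF x(1)])
        also have "g = s + zm n ?b - s" by (simp add: su(1) n cj_def)
        also have "cj (- ?r s) (cj (s + zm n ?b - s) x) = cj (- zm (int m * r) ?b + zm n ?b) y"
          by (simp add: x(2) cj_cj rs grp del: add_uminus_conv_diff)
        also have "- zm (int m * r) ?b + zm n ?b = zm (n - int m * r) ?b"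
          by (simp flip: zm_uminus zm_add)
        finally show ?thesis .
      qed
      from parabolic_root_elliptic[OF m this] obtain d
        where "\<forall>y\<in>?H. st True y = cj (zm d ?b) y" by (rule exE)
      then have d: "st True y = cj (zm d ?b) y" if "y \<in> ?H" for y using that by (rule bspec)
      have "st True x = cj (s + zm r ?b + zm d ?b - s) x" if "x \<in> H" for x
      proof -
        have "st True x = st True (cj s (cj (- s) x))" by simp
        also have "\<dots> = cj (s + zm r ?b) (cj (zm d ?b) (cj (- s) x))"
          using d[of "cj (- s) x"] that by (simp only: ghom_apply_cj[OF ghom_st] r) simp
        finally show ?thesis by (simp add: cj_cj grp del: add_uminus_conv_diff)
      qed
      then show ?thesis by blast
    qed
  qed
qed

text \<open>A nonzero element of \<open>H\<close> is conjugate to one that \<open>st True\<close>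
  fixes; translating \<open>H\<close> by the conjugating element makes the previous lemma
  applicable.\<close>

theorem parabolic_root:
  assumes m: "m > 0" and H: "\<And>x. x \<in> H \<Longrightarrow> stw (replicate m True) x = cj g x"
  shows "\<exists>e. \<forall>x\<in>H. st True x = cj e x"
proof (cases "\<forall>x\<in>H. x = 0")
  case True
  then show ?thesis by (intro exI[of _ 0]) (auto simp: ghom_zero[OF ghom_st])
next
  case False
  then obtain h where h: "h \<in> H" "h \<noteq> 0" by blast
  let ?r = "stw (replicate m True)"
  have "cnj h (?r h)" using H[OF h(1)] by (simp add: cnjI)
  then obtain y where y: "cnj h y" "st True y = y" by (rule cnj_power_step_fixed[OF m])
  then obtain s where s: "y = cj s h" by (auto simp: cnj_def)
  have "?r x = cj (?r s + g - s) x" if x: "x \<in> cj s ` H" for x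
  proof -
    obtain z where z: "z \<in> H" "x = cj s z" using x by blast
    then show ?thesis using H[OF z(1)]
      by (simp add: ghom_apply_cj[OF ghom_stw] cj_cj)
  qed
  note Hs = this
  have "y \<noteq> 0"
  proof
    assume "y = 0"
    then have "cj s h = cj s 0" using s by simp
    then show False using h(2) by (simp only: cj_inject)
  qed
  have "y \<in> cj s ` H" using s h(1) by simp
  from parabolic_root_fixed[OF m Hs this \<open>y \<noteq> 0\<close> y(2)] obtain e
    where "\<forall>x\<in>cj s ` H. st True x = cj e x" by (rule exE)
  then have e: "st True x = cj e x" if "x \<in> cj s ` H" for x using that by (rule bspec)
  have "st True x = cj (- st True s + e + s) x" if "x \<in> H" for x
  proof -
    have "st True x = st True (cj (- s) (cj s x))" by simp
    also have "\<dots> = cj (- st True s) (cj e (cj s x))"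
      using e[of "cj s x"] that
      by (simp only: ghom_apply_cj[OF ghom_st] ghom_uminus[OF ghom_st]) simp
    finally show ?thesis by (simp add: cj_cj add.assoc)
  qed
  then show ?thesis by blast
qed

text \<open>
  The integral Heisenberg group; its centre reads off exponents of the commutator.
\<close>

datatype heis = Heis int int int

instantiation heis :: group_add
begin
definition "0 = Heis 0 0 0"
fun plus_heis where "Heis a b c + Heis a' b' c' = Heis (a + a') (b + b') (c + c' + a * b')"
fun uminus_heis where "- Heis a b c = Heis (- a) (- b) (a * b - c)"
definition "x - y = x + - (y :: heis)"
instance
proof
  fix x y z :: heis
  show "x + y + z = x + (y + z)" by (cases x; cases y; cases z) (simp add: algebra_simps)
  show "0 + x = x" "x + 0 = x" by (cases x; simp add: zero_heis_def)+
  show "- x + x = 0" by (cases x) (simp add: zero_heis_def)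
  show "x + - y = x - y" by (simp add: minus_heis_def)
qed
end

definition hz :: "f2 \<Rightarrow> heis" where
  "hz = lift (\<lambda>g. if g then Heis 1 0 0 else Heis 0 1 0)"

lemma ghom_hz: "ghom hz" by (simp add: hz_def ghom_lift)

lemma hz_cc: "hz (zm k cc) = Heis 0 0 k"
proof -
  have 1: "hz cc = Heis 0 0 1"
    by (simp add: cc_def ghom_plus[OF ghom_hz] ghom_minus[OF ghom_hz])
       (simp add: hz_def minus_heis_def)
  have "nm n (Heis 0 0 1) = Heis 0 0 (int n)" for n
    by (induction n) (simp_all add: zero_heis_def)
  then have "zm k (Heis 0 0 1) = Heis 0 0 k" by (simp add: zm_def)
  then show ?thesis by (simp only: ghom_zm[OF ghom_hz] 1)
qed

lemma cj_heis_central: "cj x (Heis 0 0 k) = Heis 0 0 k"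
  by (cases x) (simp add: cj_eq_iff)

lemma hz_cnj_cc: "cnj x (zm k cc) \<Longrightarrow> hz x = Heis 0 0 k"
  using cnj_sym[of x "zm k cc"] unfolding cnj_def
  by (auto simp: ghom_apply_cj[OF ghom_hz] hz_cc cj_heis_central)

lemma zm_heis_central: "zm j (Heis 0 0 k) = Heis 0 0 (j * k)"
  by (metis hz_cc ghom_hz ghom_zm zm_mult)

text \<open>Every element of \<open>H\<close> is conjugate to a power of the commutator; the point
  is one conjugator \<open>s\<close> for all of them. It is read off one nontrivial
  \<open>h\<close>, and suitable multiples of \<open>h\<close> and of any other element are shown to
  coincide.\<close>

theorem hyperbolic_peripheral:
  assumes ws: "True \<in> set ws" "False \<in> set ws"
    and H: "\<And>x. x \<in> H \<Longrightarrow> stw ws x = cj g x"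
  shows "\<exists>s. \<forall>x\<in>H. \<exists>k. cj s x = zm k cc"
proof (cases "\<forall>x\<in>H. x = 0")
  case True
  then show ?thesis by (intro exI[of _ 0]) (auto intro: exI[of _ 0])
next
  case False
  then obtain h where h: "h \<in> H" "h \<noteq> 0" by blast
  \<comment> \<open>Unlike the arbitrary set \<open>H\<close>, this equalizer of two homomorphisms
    is a subgroup.\<close>
  define K where "K = {x. stw ws x = cj g x}"
  have K: "\<exists>k. cnj x (zm k cc)" if "x \<in> K" for x
  proof -
    have "cnj x (stw ws x)" using that by (simp add: K_def cnjI)
    then show ?thesis using cnj_hyperbolic_commutator[OF ws] by blast
  qed
  have HK: "x \<in> K" if "x \<in> H" for x using H[OF that] by (simp add: K_def)
  obtain s i where si: "zm i cc = cj s h" using K[OF HK[OF h(1)]] by (auto simp: cnj_def)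
  have i: "i \<noteq> 0"
  proof
    assume "i = 0"
    then have "cj s h = cj s 0" using si by simp
    then show False using h(2) by (simp only: cj_inject)
  qed
  have "\<exists>k. cj s x = zm k cc" if x: "x \<in> H" for x
  proof -
    obtain j where j: "cnj x (zm j cc)" using K[OF HK[OF x]] by blast
    \<comment> \<open>The multiples are chosen so that the commutator exponents \<open>i\<close> of
      \<open>h\<close> and \<open>j\<close> of \<open>x\<close> cancel in the centre of the
      Heisenberg group. As \<open>y\<close> lies in \<open>K\<close>, it is conjugate to a power of
      the commutator, whose exponent must then be 0.\<close>
    define y where "y = zm j h - zm i x"
    have "y \<in> K"
      using HK[OF h(1)] HK[OF x]
      by (simp add: K_def y_def ghom_minus[OF ghom_stw] ghom_zm[OF ghom_stw]
          ghom_minus[OF ghom_cj] ghom_zm[OF ghom_cj])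
    then obtain M where M: "cnj y (zm M cc)" using K by blast
    have "hz h = Heis 0 0 i" by (rule hz_cnj_cc) (use si in \<open>auto simp: cnj_def\<close>)
    then have "hz y = Heis 0 0 (j * i) - Heis 0 0 (i * j)"
      by (simp add: y_def ghom_minus[OF ghom_hz] ghom_zm[OF ghom_hz] hz_cnj_cc[OF j] zm_heis_central)
    then have "hz y = Heis 0 0 0" by (simp add: mult.commute zero_heis_def[symmetric])
    then have "M = 0" using hz_cnj_cc[OF M] by simp
    then have "cj (- 0) y = y" "cnj y 0" using M by simp_all
    then have "y = 0" by (metis cj_inject cj_zero cnj_def)
    then have "zm j h = zm i x" by (simp add: y_def)
    then have "cj s (zm j h) = cj s (zm i x)" by simp
    then have "zm j (zm i cc) = zm i (cj s x)" by (simp only: ghom_zm[OF ghom_cj] si)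
    then have "zm i (zm j cc) = zm i (cj s x)" by (simp only: zm_mult[symmetric] mult.commute)
    then show ?thesis using zm_unique_roots[OF _ i] by metis
  qed
  then show ?thesis by blast
qed

section \<open>Generators of the automorphism group\<close>

definition aut :: "(f2 \<Rightarrow> f2) \<Rightarrow> bool" where "aut f \<longleftrightarrow> ghom f \<and> bij f"

text \<open>The signed permutations of the basis: \<open>\<sigma>\<close> tells whether the letters
  keep their places, \<open>\<epsilon> g\<close> the sign given to \<open>g\<close>.\<close>

definition sp :: "bool \<Rightarrow> (bool \<Rightarrow> bool) \<Rightarrow> f2 \<Rightarrow> f2" where
  "sp \<sigma> \<epsilon> = lift (\<lambda>g. if \<epsilon> g then gen (g = \<sigma>) else - gen (g = \<sigma>))"

lemma ghom_sp: "ghom (sp \<sigma> \<epsilon>)" by (simp add: sp_def ghom_lift)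

lemma sp_gen: "sp \<sigma> \<epsilon> (gen g) = (if \<epsilon> g then gen (g = \<sigma>) else - gen (g = \<sigma>))"
  by (simp add: sp_def)

lemma sp_comp: "sp \<sigma> \<epsilon> \<circ> sp \<sigma>' \<epsilon>' = sp (\<sigma> = \<sigma>') (\<lambda>g. \<epsilon>' g = \<epsilon> (g = \<sigma>'))"
proof (rule ghom_eqI)
  have "(sp \<sigma> \<epsilon> \<circ> sp \<sigma>' \<epsilon>') (gen g) = sp (\<sigma> = \<sigma>') (\<lambda>g. \<epsilon>' g = \<epsilon> (g = \<sigma>')) (gen g)" for g
    by (cases g; cases \<sigma>; cases \<sigma>') (auto simp: sp_gen ghom_uminus[OF ghom_sp])
  then show "(sp \<sigma> \<epsilon> \<circ> sp \<sigma>' \<epsilon>') (gen True) = sp (\<sigma> = \<sigma>') (\<lambda>g. \<epsilon>' g = \<epsilon> (g = \<sigma>')) (gen True)"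
    "(sp \<sigma> \<epsilon> \<circ> sp \<sigma>' \<epsilon>') (gen False) = sp (\<sigma> = \<sigma>') (\<lambda>g. \<epsilon>' g = \<epsilon> (g = \<sigma>')) (gen False)"
    by blast+
qed (intro ghom_comp ghom_sp, rule ghom_sp)

lemma sp_id: "sp True (\<lambda>g. True) = id"
  by (rule ghom_eqI) (simp_all add: ghom_sp sp_gen, simp add: ghom_def)

lemma sp_inv: "sp True \<epsilon> \<circ> sp True \<epsilon> = id"
  using sp_id by (simp add: sp_comp)

definition sti :: "bool \<Rightarrow> f2 \<Rightarrow> f2" where
  "sti t = lift (\<lambda>g. if g = t then gen g - gen (\<not> g) else gen g)"

lemma ghom_sti: "ghom (sti t)" by (simp add: sti_def ghom_lift)

lemma sti_gen: "sti t (gen g) = (if g = t then gen g - gen (\<not> g) else gen g)"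
  by (simp add: sti_def)

lemma ghom_id: "ghom (id :: 'g::group_add \<Rightarrow> 'g)" by (simp add: ghom_def)

lemma st_sti: "st t \<circ> sti t = id"
  by (rule ghom_eqI; (intro ghom_comp ghom_st ghom_sti ghom_id)?; cases t)
     (simp_all add: sti_gen st_gen ghom_minus[OF ghom_st] add_diff_eq)

lemma sti_st: "sti t \<circ> st t = id"
  by (rule ghom_eqI; (intro ghom_comp ghom_st ghom_sti ghom_id)?; cases t)
     (simp_all add: sti_gen st_gen ghom_plus[OF ghom_sti])

lemma sti_sp: "sti t = sp True (\<lambda>g. g = t) \<circ> st t \<circ> sp True (\<lambda>g. g = t)"
  by (rule ghom_eqI; (intro ghom_comp ghom_st ghom_sti ghom_sp)?; cases t)
     (simp_all add: sti_gen st_gen sp_gen ghom_plus[OF ghom_sp] ghom_uminus[OF ghom_st] ghom_uminus[OF ghom_sp])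

lemma cj_comp: "cj g \<circ> cj h = cj (g + h)"
  by (simp add: fun_eq_iff cj_cj)

text \<open>A signed permutation conjugates an elementary automorphism into an elementary one or the
  inverse of one, up to an inner factor: the image of an inverted letter receives its new factor on
  the left, and conjugation by \<open>h\<close> moves it to the right.\<close>

lemma sp_st:
  "\<exists>h. sp \<sigma> \<epsilon> \<circ> st t = cj h \<circ> (if \<epsilon> True = \<epsilon> False then st (t = \<sigma>) else sti (t = \<sigma>)) \<circ> sp \<sigma> \<epsilon>"
proof -
  define y where "y = gen (\<not> (t = \<sigma>))"
  define h where "h = (if \<epsilon> t then 0 else if \<epsilon> (\<not> t) then - y else y)"
  have "(sp \<sigma> \<epsilon> \<circ> st t) (gen g) =
    (cj h \<circ> (if \<epsilon> True = \<epsilon> False then st (t = \<sigma>) else sti (t = \<sigma>)) \<circ> sp \<sigma> \<epsilon>) (gen g)" for g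
    by (cases g; cases t; cases \<sigma>; cases "\<epsilon> True"; cases "\<epsilon> False")
       (simp_all add: h_def y_def st_gen sti_gen sp_gen ghom_plus[OF ghom_sp] ghom_uminus[OF ghom_st]
          ghom_uminus[OF ghom_sti] cj_def grp del: add_uminus_conv_diff)
  moreover have "ghom (sp \<sigma> \<epsilon> \<circ> st t)" by (intro ghom_comp ghom_sp ghom_st)
  moreover have "ghom (cj h \<circ> (if \<epsilon> True = \<epsilon> False then st (t = \<sigma>) else sti (t = \<sigma>)) \<circ> sp \<sigma> \<epsilon>)"
    by (simp add: ghom_comp ghom_cj ghom_sp ghom_st ghom_sti)
  ultimately show ?thesis using ghom_eqI by blast
qed

text \<open>The relation that removes inverses from a product: a mixed factor is traded for one
  positive factor and a signed permutation.\<close>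

lemma st_sti_other:
  "st (\<not> t) \<circ> sti t = cj (gen (\<not> t)) \<circ> st t \<circ> sp False (\<lambda>g. g \<noteq> t)"
  by (rule ghom_eqI; (intro ghom_comp ghom_st ghom_sti ghom_sp ghom_cj)?; cases t)
     (simp_all add: sti_gen st_gen sp_gen ghom_plus[OF ghom_st] ghom_uminus[OF ghom_st] cj_def
       grp del: add_uminus_conv_diff)

text \<open>Signed permutations are allowed on both sides because a change of sign turns an
  elementary automorphism into its inverse; with their help the middle factor can be kept
  positive.\<close>

definition NF :: "(f2 \<Rightarrow> f2) \<Rightarrow> bool" where
  "NF f \<longleftrightarrow> (\<exists>g \<sigma> \<epsilon> ws \<sigma>' \<epsilon>'. f = cj g \<circ> sp \<sigma> \<epsilon> \<circ> stw ws \<circ> sp \<sigma>' \<epsilon>')"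

lemma NFI: "f = cj g \<circ> sp \<sigma> \<epsilon> \<circ> stw ws \<circ> sp \<sigma>' \<epsilon>' \<Longrightarrow> NF f"
  unfolding NF_def by blast

lemma NF_cj: "NF (cj g)"
  by (rule NFI[of _ g True "\<lambda>_. True" "[]" True "\<lambda>_. True"]) (simp add: sp_id fun_eq_iff)

lemma NF_sp: "NF f \<Longrightarrow> NF (f \<circ> sp \<sigma> \<epsilon>)"
proof -
  assume "NF f"
  then obtain g \<sigma>1 \<epsilon>1 ws \<sigma>' \<epsilon>' where f: "f = cj g \<circ> sp \<sigma>1 \<epsilon>1 \<circ> stw ws \<circ> sp \<sigma>' \<epsilon>'"
    unfolding NF_def by blast
  have "f \<circ> sp \<sigma> \<epsilon> = cj g \<circ> sp \<sigma>1 \<epsilon>1 \<circ> stw ws \<circ> (sp \<sigma>' \<epsilon>' \<circ> sp \<sigma> \<epsilon>)"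
    by (simp only: f comp_assoc)
  then show ?thesis unfolding sp_comp by (rule NFI)
qed

lemma NF_cj_left: "NF f \<Longrightarrow> NF (cj g \<circ> f)"
proof -
  assume "NF f"
  then obtain h \<sigma>1 \<epsilon>1 ws \<sigma>' \<epsilon>' where f: "f = cj h \<circ> sp \<sigma>1 \<epsilon>1 \<circ> stw ws \<circ> sp \<sigma>' \<epsilon>'"
    unfolding NF_def by blast
  have "cj g \<circ> f = (cj g \<circ> cj h) \<circ> sp \<sigma>1 \<epsilon>1 \<circ> stw ws \<circ> sp \<sigma>' \<epsilon>'"
    by (simp only: f comp_assoc)
  then show ?thesis unfolding cj_comp by (rule NFI)
qed

lemma NF_sp_left: "NF f \<Longrightarrow> NF (sp \<sigma> \<epsilon> \<circ> f)"
proof -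
  assume "NF f"
  then obtain g \<sigma>1 \<epsilon>1 ws \<sigma>' \<epsilon>' where f: "f = cj g \<circ> sp \<sigma>1 \<epsilon>1 \<circ> stw ws \<circ> sp \<sigma>' \<epsilon>'"
    unfolding NF_def by blast
  have "sp \<sigma> \<epsilon> \<circ> f = cj (sp \<sigma> \<epsilon> g) \<circ> (sp \<sigma> \<epsilon> \<circ> sp \<sigma>1 \<epsilon>1) \<circ> stw ws \<circ> sp \<sigma>' \<epsilon>'"
    by (simp add: f fun_eq_iff ghom_apply_cj[OF ghom_sp])
  then show ?thesis unfolding sp_comp by (rule NFI)
qed

lemma NF_stw: "NF (stw ws)"
  by (rule NFI[of _ 0 True "\<lambda>_. True" ws True "\<lambda>_. True"]) (simp add: sp_id fun_eq_iff)

text \<open>The inverse either cancels the last positive factor or is absorbed by it through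
  \<open>st_sti_other\<close>.\<close>

lemma NF_stw_sti: "NF (stw ws \<circ> sti t)"
proof (cases ws rule: rev_cases)
  case Nil
  have "stw ws \<circ> sti t = sp True (\<lambda>g. g = t) \<circ> stw [t] \<circ> sp True (\<lambda>g. g = t)"
    by (simp add: Nil sti_sp fun_eq_iff)
  then show ?thesis using NF_sp[OF NF_sp_left[OF NF_stw]] by simp
next
  case (snoc us r)
  show ?thesis
  proof (cases "r = t")
    case True
    have "stw ws \<circ> sti t = stw us \<circ> (st t \<circ> sti t)" by (simp add: snoc True fun_eq_iff)
    then show ?thesis by (simp add: st_sti NF_stw)
  next
    case False
    then have r: "r = (\<not> t)" by simp
    have "stw ws \<circ> sti t = stw us \<circ> (st (\<not> t) \<circ> sti t)" by (simp add: snoc r fun_eq_iff)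
    also have "\<dots> = cj (stw us (gen (\<not> t))) \<circ> (stw (us @ [t]) \<circ> sp False (\<lambda>g. g \<noteq> t))"
      unfolding st_sti_other by (simp add: fun_eq_iff ghom_apply_cj[OF ghom_stw])
    finally show ?thesis using NF_cj_left[OF NF_sp[OF NF_stw]] by simp
  qed
qed

lemma NF_st: "NF f \<Longrightarrow> NF (f \<circ> st t)"
proof -
  assume "NF f"
  then obtain g \<sigma> \<epsilon> ws \<sigma>' \<epsilon>' where f: "f = cj g \<circ> sp \<sigma> \<epsilon> \<circ> stw ws \<circ> sp \<sigma>' \<epsilon>'"
    unfolding NF_def by blast
  define r where "r = (if \<epsilon>' True = \<epsilon>' False then st (t = \<sigma>') else sti (t = \<sigma>'))"
  obtain h where h: "sp \<sigma>' \<epsilon>' \<circ> st t = cj h \<circ> r \<circ> sp \<sigma>' \<epsilon>'" unfolding r_def using sp_st by blast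
  have "stw ws \<circ> st (t = \<sigma>') = stw (ws @ [t = \<sigma>'])" by (simp add: fun_eq_iff)
  then have nf: "NF (stw ws \<circ> r)" using NF_stw NF_stw_sti by (simp add: r_def)
  have "f \<circ> st t = cj g \<circ> (sp \<sigma> \<epsilon> \<circ> (stw ws \<circ> (sp \<sigma>' \<epsilon>' \<circ> st t)))" by (simp add: f comp_assoc)
  also have "\<dots> = cj g \<circ> (sp \<sigma> \<epsilon> \<circ> (cj (stw ws h) \<circ> (stw ws \<circ> r \<circ> sp \<sigma>' \<epsilon>')))"
    unfolding h by (simp add: fun_eq_iff ghom_apply_cj[OF ghom_stw])
  finally show ?thesis
    using NF_cj_left[OF NF_sp_left[OF NF_cj_left[OF NF_sp[OF nf]]]] by simp
qed

section \<open>Nielsen reduction\<close>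

text \<open>The Gromov product of \<open>u\<close> and \<open>v\<close>: the length of the longest
  common prefix of their words, i.e. the number of letters of \<open>v\<close> cancelled in
  \<open>- u + v\<close>.\<close>

definition cl :: "f2 \<Rightarrow> f2 \<Rightarrow> nat" where "cl u v = (len u + len v - len (- u + v)) div 2"

lemma common_prefix:
  obtains k p q where "rep u = k @ p" "rep v = k @ q" "length k = cl u v"
    "p = [] \<or> q = [] \<or> hd p \<noteq> hd q" "len u + len v = len (- u + v) + 2 * cl u v"
proof -
  obtain p c q where pcq: "rep (- u) = p @ c" "rep v = winv c @ q" "reduced_word (p @ q)"
    "rep (- u + v) = p @ q" by (rule rep_plus_split)
  have "rep u = winv (rep (- u))" by simp
  then have u: "rep u = winv c @ winv p" unfolding pcq(1) by simp
  have l: "len u + len v = len (- u + v) + 2 * length c" by (simp add: len_def u pcq)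
  have "winv p = [] \<or> q = [] \<or> hd (winv p) \<noteq> hd q"
    using pcq(3) by (auto simp: reduced_word_append hd_winv)
  moreover have "length (winv c) = cl u v" using l by (simp add: cl_def)
  ultimately show ?thesis using that[OF u pcq(2)] l by simp
qed

text \<open>Nielsen's cancellation argument: no factor is consumed from its two sides together, so
  every factor after the first leaves at least one letter. The induction needs the precise prefix
  that remains of the first factor.\<close>

lemma wd_letter_growth:
  fixes E :: "bool letter \<Rightarrow> f2"
  assumes inv: "\<And>l. E (linv l) = - E l"
    and one: "\<And>l1 l2. l2 \<noteq> linv l1 \<Longrightarrow> cl (- E l1) (E l2) < len (E l2)"
    and two: "\<And>l1 l2 l3. l2 \<noteq> linv l1 \<Longrightarrow> l3 \<noteq> linv l2 \<Longrightarrow>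
       cl (- E l1) (E l2) + cl (- E l2) (E l3) < len (E l2)"
  shows "reduced_word (l # w) \<Longrightarrow>
    \<exists>t. rep (sum_list (map E (l # w))) =
      take (len (E l) - (if w = [] then 0 else cl (- E l) (E (hd w)))) (rep (E l)) @ t \<and> length w \<le> length t"
proof (induction w arbitrary: l)
  case Nil
  then show ?case by (intro exI[of _ "[]"]) (simp add: len_def)
next
  case (Cons l2 w)
  define c where "c = cl (- E l) (E l2)"
  define m where "m = len (E l2) - (if w = [] then 0 else cl (- E l2) (E (hd w)))"
  have red: "reduced_word (l2 # w)" "l2 \<noteq> linv l" using Cons.prems by (simp_all add: reduced_word_Cons)
  obtain t where t: "rep (sum_list (map E (l2 # w))) = take m (rep (E l2)) @ t" "length w \<le> length t"
    using Cons.IH[OF red(1)] unfolding m_def by blast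
  have "w \<noteq> [] \<Longrightarrow> hd w \<noteq> linv l2" using red(1) by (simp add: reduced_word_Cons)
  \<comment> \<open>The part of \<open>E l2\<close> cancelled from the left ends before the part
    cancelled from the right begins; the nonempty piece \<open>q2\<close> between them
    survives.\<close>
  then have cm: "c < m" using one[OF red(2)] two[OF red(2), of "hd w"] by (auto simp: c_def m_def)
  obtain k p q where kpq: "rep (- E l) = k @ p" "rep (E l2) = k @ q" "length k = c"
    "p = [] \<or> q = [] \<or> hd p \<noteq> hd q"
    unfolding c_def by (rule common_prefix)
  define q2 where "q2 = take (m - c) q"
  have "m \<le> len (E l2)" by (simp add: m_def)
  then have "q \<noteq> []" using cm kpq(2,3) by (auto simp: len_def)
  then have q2: "q2 \<noteq> []" "hd q2 = hd q" using cm by (auto simp: q2_def hd_take)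
  have tk: "take m (rep (E l2)) = k @ q2" using kpq(2,3) cm by (simp add: q2_def)
  have "rep (E l) = winv (rep (- E l))" by simp
  then have rl: "rep (E l) = winv p @ winv k" unfolding kpq(1) by simp
  have "sum_list (map E (l # l2 # w)) = wd (rep (E l)) + wd (rep (sum_list (map E (l2 # w))))" by simp
  also have "\<dots> = wd (winv p @ q2 @ t)"
    unfolding rl t(1) tk by (simp add: wd_append wd_winv grp del: add_uminus_conv_diff)
  finally have s: "sum_list (map E (l # l2 # w)) = wd (winv p @ q2 @ t)" .
  have "reduced_word (k @ q2 @ t)" using reduced_rep[of "sum_list (map E (l2 # w))"] by (simp only: t(1) tk append_assoc)
  then have "reduced_word (q2 @ t)" by (simp add: reduced_word_append)
  moreover have "reduced_word (winv p)"
    using reduced_rep[of "- E l"] unfolding kpq(1) by (simp add: reduced_word_append)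
  moreover have "p = [] \<or> hd q2 \<noteq> linv (last (winv p))"
    using kpq(4) q2 \<open>q \<noteq> []\<close> by (auto simp: last_winv)
  ultimately have "reduced_word (winv p @ q2 @ t)" using q2(1) by (auto simp: reduced_word_append hd_append)
  then have "rep (sum_list (map E (l # l2 # w))) = winv p @ q2 @ t" by (simp only: s rep_wd)
  moreover have "winv p = take (len (E l) - c) (rep (E l))" using rl kpq(3) by (simp add: len_def)
  moreover have "length (l2 # w) \<le> length (q2 @ t)" using t(2) q2(1) by (cases q2) auto
  ultimately show ?case by (intro exI[of _ "q2 @ t"]) (simp add: c_def)
qed

lemma sum_list_hom_letters: "ghom f \<Longrightarrow> sum_list (map (\<lambda>l. f (wd [l])) w) = f (wd w)"
proof (induction w)
  case (Cons l w)
  then show ?case using wd_Cons[of l w] by (simp add: ghom_plus[OF Cons.prems])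
qed (simp add: ghom_zero)

section \<open>Nielsen moves and irreducible automorphisms\<close>

definition mv :: "bool \<Rightarrow> bool \<Rightarrow> bool \<Rightarrow> f2 \<Rightarrow> f2" where
  "mv t s s' = lift (\<lambda>g. if g = t then wd [(s, t)] + wd [(s', \<not> t)] else gen g)"

lemma ghom_mv: "ghom (mv t s s')" by (simp add: mv_def ghom_lift)

lemma mv_gen: "mv t s s' (gen t) = wd [(s, t)] + wd [(s', \<not> t)]" "mv t s s' (gen (\<not> t)) = gen (\<not> t)"
  by (simp_all add: mv_def)

lemma mv_sp:
  "mv t s s' = sp True (\<lambda>g. if g = t then s else s') \<circ> st t \<circ> sp True (\<lambda>g. if g = t then True else s')"
  by (rule ghom_eqI; (intro ghom_comp ghom_st ghom_mv ghom_sp)?; cases t; cases s; cases s')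
     (simp_all add: mv_def st_gen sp_gen wd_single ghom_plus[OF ghom_sp] ghom_uminus[OF ghom_sp] ghom_uminus[OF ghom_st])

definition size2 :: "(f2 \<Rightarrow> f2) \<Rightarrow> nat" where "size2 f = len (f (gen True)) + len (f (gen False))"

lemma size2_eq: "size2 f = len (f (gen t)) + len (f (gen (\<not> t)))"
  by (cases t) (simp_all add: size2_def)

lemma len_double: "u \<noteq> 0 \<Longrightarrow> len u < len (u + u)"
proof -
  assume "u \<noteq> 0"
  then obtain s v where v: "u = cj s v" "cyc (rep v)" "rep u = rep s @ rep v @ winv (rep s)"
    by (rule f2_cyclic_decomposition)
  have "nm 2 u = u + u" by (simp add: numeral_2_eq_2)
  then have "rep (u + u) = rep s @ (rep v @ rep v) @ winv (rep s)"
    using rep_nm_conj[OF v, of 2] by (simp add: numeral_2_eq_2)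
  moreover have "rep v \<noteq> []" using v(2) by (simp add: cyc_def)
  ultimately show ?thesis using v(3) by (simp add: len_def)
qed

text \<open>
  In the product of three consecutive letters the middle one must not cancel completely. The critical case is that
  exactly half of it cancels on either side: then the neighbours are both \<open>w\<close>, with \<open>w = - p + m - k\<close> and the
  middle letter \<open>k + p\<close>, and conjugating \<open>w + (k + p)\<close> by \<open>p\<close> yields the shorter basis \<open>m, p + k\<close>.
\<close>

lemma irreducible_two:
  assumes f: "aut f" and irr: "\<And>g t s s'. size2 f \<le> size2 (cj g \<circ> f \<circ> mv t s s')"
  defines "E \<equiv> \<lambda>l. f (wd [l])"
  assumes l: "l2 \<noteq> linv l1" "l3 \<noteq> linv l2"
  shows "2 * cl (- E l1) (E l2) \<le> len (E l2)" "len (E l2) > 0"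
    "cl (- E l1) (E l2) + cl (- E l2) (E l3) < len (E l2)"
proof -
  have fh: "ghom f" and fi: "inj f" using f by (auto simp: aut_def bij_is_inj)
  have lenE: "len (E l) = len (f (gen (snd l)))" for l
    by (simp add: E_def wd_single ghom_uminus[OF fh])
  have ne: "E l \<noteq> 0" for l
  proof
    assume "E l = 0"
    then have "f (wd [l]) = f 0" by (simp add: E_def ghom_zero[OF fh])
    then have "wd [l] = 0" using fi by (simp add: inj_eq)
    moreover have "rep (wd [l]) = [l]" by (rule rep_wd) (simp add: reduced_word_Cons)
    ultimately show False by simp
  qed
  then show pos: "len (E l2) > 0" by (metis len_eq_0 neq0_conv)
  have Einv: "E (linv l) = - E l" for l by (simp add: E_def wd_single ghom_uminus[OF fh])
  have same: "2 * cl (- E l) (E l) < len (E l)" for l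
    using len_double[OF ne[of l]] common_prefix[of "- E l" "E l"] by fastforce
  have mvN: "len (E l) + len (E l') \<le> len (cj g (E l + E l')) + len (cj g (E l'))"
    if "snd l \<noteq> snd l'" for g l l'
  proof -
    have s: "snd l' = (\<not> snd l)" using that by auto
    have "size2 (cj g \<circ> f \<circ> mv (snd l) (fst l) (fst l')) =
      len (cj g (E l + E l')) + len (cj g (f (gen (\<not> snd l))))"
      unfolding size2_eq[of _ "snd l"] using s
      by (cases l; cases l') (simp add: mv_gen E_def ghom_plus[OF fh])
    also have "len (cj g (f (gen (\<not> snd l)))) = len (cj g (E l'))"
      by (simp add: E_def wd_single s ghom_uminus[OF fh] ghom_uminus[OF ghom_cj])
    finally have "size2 (cj g \<circ> f \<circ> mv (snd l) (fst l) (fst l')) = len (cj g (E l + E l')) + len (cj g (E l'))" .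
    moreover have "size2 f = len (E l) + len (E l')"
      using lenE[of l] lenE[of l'] s by (simp add: size2_eq[of f "snd l"])
    ultimately show ?thesis using irr[of g "snd l" "fst l" "fst l'"] by (simp only:)
  qed
  \<comment> \<open>A Nielsen move replaces \<open>E l\<close> by this sum, so irreducibility
    forbids a shorter one; hence at most half of either factor cancels.\<close>
  have cross1: "len (E l) \<le> len (E l + E l')" if "snd l \<noteq> snd l'" for l l'
    using mvN[OF that, of 0] by simp
  have cross: "2 * cl (- E l) (E l') \<le> len (E l') \<and> 2 * cl (- E l) (E l') \<le> len (E l)"
    if d: "snd l \<noteq> snd l'" for l l'
  proof -
    have "len (E l') \<le> len (E (linv l') + E (linv l))"
      using cross1[of "linv l'" "linv l"] d lenE by simp
    also have "E (linv l') + E (linv l) = - (E l + E l')"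
      by (simp only: Einv minus_add)
    finally have 2: "len (E l') \<le> len (E l + E l')" by (simp only: len_uminus)
    obtain k p q where "len (- E l) + len (E l') = len (- (- E l) + E l') + 2 * cl (- E l) (E l')"
      by (rule common_prefix)
    then show ?thesis using 2 cross1[OF d] by simp
  qed
  have le: "2 * cl (- E l) (E l') \<le> len (E l')" if "l' \<noteq> linv l" for l l'
  proof (cases "snd l = snd l'")
    case True
    then have "l' = l" using that by (auto simp: prod_eq_iff)
    then show ?thesis using same[of l] by simp
  qed (use cross in blast)
  then show "2 * cl (- E l1) (E l2) \<le> len (E l2)" using l(1) by blast
  have le': "2 * cl (- E l2) (E l3) \<le> len (E l2)"
  proof (cases "snd l3 = snd l2")
    case True
    then have "l3 = l2" using l(2) by (auto simp: prod_eq_iff)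
    then show ?thesis using same[of l2] by simp
  qed (use cross[of l2 l3] in auto)
  show "cl (- E l1) (E l2) + cl (- E l2) (E l3) < len (E l2)"
  proof (rule ccontr)
    assume "\<not> ?thesis"
    then have eq: "2 * cl (- E l1) (E l2) = len (E l2)" "2 * cl (- E l2) (E l3) = len (E l2)"
      using le[OF l(1)] le' by auto
    have s1: "snd l1 \<noteq> snd l2"
    proof
      assume "snd l1 = snd l2"
      then have "l1 = l2" using l(1) by (auto simp: prod_eq_iff)
      then show False using eq(1) same[of l2] by simp
    qed
    have s3: "snd l3 \<noteq> snd l2"
    proof
      assume "snd l3 = snd l2"
      then have "l3 = l2" using l(2) by (auto simp: prod_eq_iff)
      then show False using eq(2) same[of l2] by simp
    qed
    obtain k q p where k: "rep (- E l1) = k @ q" "rep (E l2) = k @ p" "length k = cl (- E l1) (E l2)"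
      by (rule common_prefix)
    obtain k' q' p' where k': "rep (- E l2) = k' @ p'" "rep (E l3) = k' @ q'" "length k' = cl (- E l2) (E l3)"
      by (rule common_prefix)
    have kp: "length p = length k" "length k' = length k"
      using eq k(2,3) k'(3) by (auto simp: len_def)
    have "rep (- E l2) = winv p @ winv k" by (simp add: k(2))
    then have kk: "k' = winv p" using k'(1) kp by simp
    show False
    proof (cases "l3 = l1")
      case False
      then have "l3 = linv l1" using s1 s3 by (auto simp: prod_eq_iff)
      then have "E l3 = - E l1" by (simp only: Einv)
      then have "k @ q = k' @ q'" using k(1) k'(2) by simp
      then have "k = winv p" using kk kp by simp
      then have "reduced_word (winv p @ p)" using k(2) reduced_rep[of "E l2"] by simp
      moreover have "p \<noteq> []" using k(2) \<open>k = winv p\<close> ne[of l2] rep_eq_Nil by fastforce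
      ultimately show False by (auto simp: reduced_word_append last_winv)
    next
      case True
      have "rep (E l1) = winv (rep (- E l1))" by simp
      then have w: "rep (E l1) = winv q @ winv k" unfolding k(1) by simp
      have "2 * length k \<le> len (E l1)" using cross[OF s1] k(3) by simp
      then have "length (winv p) \<le> length (winv q)" using w kp by (simp add: len_def)
      moreover have "winv q @ winv k = winv p @ q'" using w k'(2) kk True by simp
      ultimately obtain m where m: "winv q = winv p @ m" using append_eq_append_prefix by metis
      have E1: "E l1 = - wd p + (wd m + - wd k)"
        using wd_rep[of "E l1"] unfolding w m by (simp add: wd_append wd_winv add.assoc)
      have E2: "E l2 = wd k + wd p" using wd_rep[of "E l2"] unfolding k(2) by (simp add: wd_append)
      have c12: "cj (wd p) (E l1 + E l2) = wd m"
        by (simp add: E1 E2 cj_def grp del: add_uminus_conv_diff)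
      have c2: "cj (wd p) (E l2) = wd p + wd k"
        by (simp add: E2 cj_def grp del: add_uminus_conv_diff)
      have wl: "len (wd v) \<le> length v" for v
      proof (induction v)
        case (Cons x v)
        have "len (wd (x # v)) \<le> len (wd [x]) + len (wd v)" using len_plus_le wd_Cons by metis
        moreover have "rep (wd [x]) = [x]" by (rule rep_wd) (simp add: reduced_word_Cons)
        ultimately show ?case using Cons by (simp add: len_def)
      qed simp
      have "len (wd p + wd k) \<le> length p + length k" using len_plus_le[of "wd p" "wd k"] wl[of p] wl[of k] by simp
      moreover have "len (wd m) + 2 * length k \<le> len (E l1)"
        using wl[of m] arg_cong[OF m, of length] w kp by (simp add: len_def)
      moreover have "len (E l2) = length k + length p" using k(2) by (simp add: len_def)
      ultimately show False using mvN[OF s1, of "wd p"] pos kp unfolding c12 c2 by simp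
    qed
  qed
qed

text \<open>A generator is the image of some \<open>z\<close>, and by the growth of images its
  length 1 bounds the length of \<open>z\<close>. So both generators are images of letters, and
  \<open>f\<close> permutes the letters up to signs.\<close>

lemma irreducible_sp:
  assumes f: "aut f" and irr: "\<And>g t s s'. size2 f \<le> size2 (cj g \<circ> f \<circ> mv t s s')"
  shows "\<exists>\<sigma> \<epsilon>. f = sp \<sigma> \<epsilon>"
proof -
  have fh: "ghom f" and fi: "inj f" and fs: "surj f" using f by (auto simp: aut_def bij_is_inj bij_is_surj)
  let ?E = "\<lambda>l. f (wd [l])"
  note two = irreducible_two[OF f irr]
  have inv: "?E (linv l) = - ?E l" for l by (simp add: wd_single ghom_uminus[OF fh])
  have one: "cl (- ?E l1) (?E l2) < len (?E l2)" if "l2 \<noteq> linv l1" for l1 l2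
    using two(1,2)[OF that, of l2] by (simp add: prod_eq_iff)
  have one': "cl (- ?E l1) (?E l2) < len (?E l1)" if "l2 \<noteq> linv l1" for l1 l2
    using two(3)[OF _ that, of l1] by (simp add: prod_eq_iff)
  have letter: "\<exists>l. f (wd [l]) = gen g" for g
  proof -
    obtain z where z: "f z = gen g" using fs by (metis surjD)
    have "rep z \<noteq> []"
    proof
      assume "rep z = []"
      then have "gen g = 0" using z by (simp add: ghom_zero[OF fh])
      then show False using rep_gen[of g] by simp
    qed
    then obtain l w where lw: "rep z = l # w" by (cases "rep z") auto
    have red: "reduced_word (l # w)" using reduced_rep[of z] lw by simp
    have fz: "sum_list (map ?E (l # w)) = gen g"
      using sum_list_hom_letters[OF fh, of "rep z"] z by (simp only: wd_rep lw[symmetric])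
    obtain t where t: "[(True, g)] =
      take (len (?E l) - (if w = [] then 0 else cl (- ?E l) (?E (hd w)))) (rep (?E l)) @ t" "length w \<le> length t"
      using wd_letter_growth[of ?E l w, OF inv one two(3) red] unfolding fz rep_gen by blast
    have "(if w = [] then 0 else cl (- ?E l) (?E (hd w))) < len (?E l)"
      using one'[of "hd w" l] two(2)[of l l l] red by (auto simp: reduced_word_Cons prod_eq_iff)
    then have "length [(True, g)] \<ge> 1 + length w"
      using arg_cong[OF t(1), of length] t(2) by (simp add: len_def)
    then have "w = []" by simp
    then show ?thesis using z lw wd_rep[of z] by metis
  qed
  obtain l where l: "f (wd [l]) = gen True" using letter by blast
  obtain l' where l': "f (wd [l']) = gen False" using letter by blast
  have neq: "snd l \<noteq> snd l'"
  proof
    assume eq: "snd l = snd l'"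
    define v where "v = f (gen (snd l))"
    have v: "gen True = v \<or> gen True = - v" "gen False = v \<or> gen False = - v"
      unfolding v_def l[symmetric] l'[symmetric] eq by (simp_all add: wd_single ghom_uminus[OF fh] eq)
    have "gen True = gen False \<or> gen True = - gen False"
      using v by (elim disjE) simp_all
    then have "rep (gen True) = rep (gen False) \<or> rep (gen True) = rep (- gen False)" by metis
    then show False by (simp add: rep_gen)
  qed
  have val: "f (gen (snd l)) = (if fst l then gen True else - gen True)"
    "f (gen (snd l')) = (if fst l' then gen False else - gen False)"
    using l l' by (auto simp: wd_single ghom_uminus[OF fh] minus_equation_iff split: if_splits)
  have "f = sp (snd l) (\<lambda>g. if g = snd l then fst l else fst l')"
    by (rule ghom_eqI[OF fh ghom_sp]; cases "snd l"; cases "snd l'")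
       (use neq val in \<open>simp_all add: sp_gen\<close>)
  then show ?thesis by blast
qed

lemma aut_comp: "aut f \<Longrightarrow> aut g \<Longrightarrow> aut (f \<circ> g)"
  by (simp add: aut_def ghom_comp bij_comp)

lemma autI_inverse: "ghom f \<Longrightarrow> f \<circ> g = id \<Longrightarrow> g \<circ> f = id \<Longrightarrow> aut f"
  unfolding aut_def by (metis o_bij)

lemma aut_cj: "aut (cj g)"
  by (rule autI_inverse[of _ "cj (- g)"]) (simp_all add: ghom_cj fun_eq_iff)

lemma aut_st: "aut (st t)"
  using autI_inverse[OF ghom_st st_sti sti_st] .

lemma aut_sp: "aut (sp \<sigma> \<epsilon>)"
proof -
  have "sp \<sigma> \<epsilon> \<circ> sp \<sigma> (\<lambda>g. \<epsilon> (g = \<sigma>)) = id" "sp \<sigma> (\<lambda>g. \<epsilon> (g = \<sigma>)) \<circ> sp \<sigma> \<epsilon> = id"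
    unfolding sp_comp sp_id[symmetric]
    by (rule arg_cong2[where f = sp]; (rule ext)?; cases \<sigma>; simp)+
  then show ?thesis by (rule autI_inverse[OF ghom_sp])
qed

lemma aut_stw: "aut (stw ws)"
proof (induction ws)
  case Nil
  have "stw [] = id" by (simp add: fun_eq_iff)
  then show ?case by (simp only: aut_def ghom_id bij_id simp_thms)
next
  case (Cons t ws)
  have "stw (t # ws) = st t \<circ> stw ws" by (simp add: fun_eq_iff)
  then show ?case using aut_comp[OF aut_st Cons] by (simp only:)
qed

lemma aut_mv: "aut (mv t s s')"
  unfolding mv_sp by (intro aut_comp aut_sp aut_st)

text \<open>The inverse of a move is again a product of signed permutations and one elementary
  automorphism, and normal forms absorb such factors on the right.\<close>

lemma NF_mvD:
  assumes "NF (f \<circ> mv t s s')"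
  shows "NF f"
proof -
  let ?D = "sp True (\<lambda>g. if g = t then s else s')" and ?D' = "sp True (\<lambda>g. if g = t then True else s')"
  have "f = f \<circ> mv t s s' \<circ> ?D' \<circ> (sti t) \<circ> ?D"
  proof -
    have "mv t s s' \<circ> ?D' \<circ> sti t \<circ> ?D = ?D \<circ> (st t \<circ> ((?D' \<circ> ?D') \<circ> sti t)) \<circ> ?D"
      unfolding mv_sp by (simp add: comp_assoc)
    also have "\<dots> = id" by (simp add: sp_inv st_sti)
    finally have "f \<circ> (mv t s s' \<circ> ?D' \<circ> sti t \<circ> ?D) = f" by simp
    then show ?thesis by (simp add: comp_assoc)
  qed
  moreover have "NF (f \<circ> mv t s s' \<circ> ?D' \<circ> (sti t) \<circ> ?D)"
    using NF_sp[OF NF_sp[OF NF_st[OF NF_sp[OF NF_sp[OF assms]]]]]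
    unfolding sti_sp by (simp add: comp_assoc)
  ultimately show ?thesis by simp
qed

text \<open>Descent on the total length of the images of the basis. Inner automorphisms take part in
  the descent; they resolve the ties for which Nielsen reduction usually employs an ordering of the
  words.\<close>

theorem aut_NF: "aut f \<Longrightarrow> NF f"
proof (induction "size2 f" arbitrary: f rule: less_induct)
  case less
  show ?case
  proof (cases "\<forall>g t s s'. size2 f \<le> size2 (cj g \<circ> f \<circ> mv t s s')")
    case True
    then obtain \<sigma> \<epsilon> where "f = sp \<sigma> \<epsilon>" using irreducible_sp[OF less.prems] by blast
    then show ?thesis using NF_sp[OF NF_cj[of 0], of \<sigma> \<epsilon>] by (simp add: comp_def)
  next
    case False
    then obtain g t s s' where *: "size2 (cj g \<circ> f \<circ> mv t s s') < size2 f" by (auto simp: not_le)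
    have "NF (cj g \<circ> f \<circ> mv t s s')"
      by (rule less.hyps[OF *]) (intro aut_comp aut_cj less.prems aut_mv)
    then have "NF (cj (- g) \<circ> (cj g \<circ> f))" using NF_cj_left NF_mvD by blast
    moreover have "cj (- g) \<circ> (cj g \<circ> f) = f" by (simp add: fun_eq_iff)
    ultimately show ?thesis by simp
  qed
qed

section \<open>The action on the abelianization\<close>

datatype m2 = M2 int int int int

instantiation m2 :: monoid_mult
begin
definition "1 = M2 1 0 0 1"
fun times_m2 where
  "M2 p q r s * M2 p' q' r' s' = M2 (p * p' + q * r') (p * q' + q * s') (r * p' + s * r') (r * q' + s * s')"
instance
proof
  fix A B C :: m2
  show "A * B * C = A * (B * C)" by (cases A; cases B; cases C) (simp add: algebra_simps)
  show "1 * A = A" "A * 1 = A" by (cases A; simp add: one_m2_def)+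
qed
end

fun det :: "m2 \<Rightarrow> int" where "det (M2 p q r s) = p * s - q * r"

fun tr :: "m2 \<Rightarrow> int" where "tr (M2 p q r s) = p + s"

text \<open>The determinant times the adjugate, which is the inverse when the determinant is 1 or
  -1.\<close>

fun minv :: "m2 \<Rightarrow> m2" where
  "minv (M2 p q r s) = (let d = p * s - q * r in M2 (d * s) (- d * q) (- d * r) (d * p))"

lemma det_mult [simp]: "det (A * B) = det A * det B"
  by (cases A; cases B) (simp add: algebra_simps)

lemma det_1 [simp]: "det 1 = 1" by (simp add: one_m2_def)

lemma minv_mult: "det A = 1 \<or> det A = - 1 \<Longrightarrow> minv A * A = 1 \<and> A * minv A = 1"
proof -
  assume A: "det A = 1 \<or> det A = - 1"
  obtain p q r s where pqrs: "A = M2 p q r s" by (cases A)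
  define d where "d = p * s - q * r"
  have "minv A * A = M2 (d * d) 0 0 (d * d)" "A * minv A = M2 (d * d) 0 0 (d * d)"
    by (simp_all add: pqrs d_def Let_def algebra_simps)
  moreover have "d * d = 1" using A by (auto simp: pqrs d_def[symmetric])
  ultimately show ?thesis by (simp add: one_m2_def)
qed

text \<open>The columns are the exponent vectors of the images of the generators, so that
  composition becomes multiplication of matrices.\<close>

definition mat :: "(f2 \<Rightarrow> f2) \<Rightarrow> m2" where
  "mat f = M2 (ex True (f (gen True))) (ex True (f (gen False))) (ex False (f (gen True))) (ex False (f (gen False)))"

lemma ex_ghom: "ghom f \<Longrightarrow> ex g (f x) = ex g (f (gen True)) * ex True x + ex g (f (gen False)) * ex False x"
proof -
  assume f: "ghom f"
  define h where "h x = ex g (f (gen True)) * ex True x + ex g (f (gen False)) * ex False x" for x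
  have "ghom h" by (rule ghomI) (simp add: h_def ghom_plus[OF ghom_ex] algebra_simps)
  moreover have "ghom (ex g \<circ> f)" by (intro ghom_comp ghom_ex f)
  ultimately have "ex g \<circ> f = h" by (intro ghom_eqI) (simp_all add: h_def ex_gen)
  then show ?thesis by (metis comp_apply h_def)
qed

lemma mat_comp: "ghom f \<Longrightarrow> ghom g \<Longrightarrow> mat (f \<circ> g) = mat f * mat g"
  by (simp add: mat_def ex_ghom[of f _ "g (gen _)"])

lemma mat_id: "mat id = 1" by (simp add: mat_def ex_gen one_m2_def)

lemma mat_cj: "mat (cj g) = 1" by (simp add: mat_def ex_gen one_m2_def)

lemma mat_cj_comp: "mat (cj g \<circ> f) = mat f" by (simp add: mat_def)

lemma aut_ghom: "aut f \<Longrightarrow> ghom f" by (simp add: aut_def)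

text \<open>
  The notation \<open>inv\<close> is taken by groups with explicit carrier.
\<close>

abbreviation finv :: "(f2 \<Rightarrow> f2) \<Rightarrow> f2 \<Rightarrow> f2" where
  "finv \<equiv> inv_into UNIV"

lemma aut_inv:
  assumes "aut f"
  shows "aut (finv f)" "f \<circ> finv f = id" "finv f \<circ> f = id"
proof -
  have b: "bij f" and h: "ghom f" using assms by (auto simp: aut_def)
  show 1: "f \<circ> finv f = id" "finv f \<circ> f = id"
    using b by (simp_all add: bij_is_inj bij_is_surj surj_iff[symmetric] inj_iff[symmetric])
  have "finv f (x + y) = finv f x + finv f y" for x y
  proof -
    have "f (finv f x + finv f y) = f (finv f x) + f (finv f y)" by (rule ghom_plus[OF h])
    also have "\<dots> = x + y" using 1(1) by (metis comp_apply id_apply)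
    finally show ?thesis using 1(2) by (metis comp_apply id_apply)
  qed
  then show "aut (finv f)" using b by (simp add: aut_def ghom_def bij_imp_bij_inv)
qed

lemma mat_inv: "aut f \<Longrightarrow> mat f * mat (finv f) = 1 \<and> mat (finv f) * mat f = 1"
  using mat_comp[of f "finv f"] mat_comp[of "finv f" f] aut_inv[of f] aut_ghom mat_id by metis

lemma det_mat: "aut f \<Longrightarrow> det (mat f) = 1 \<or> det (mat f) = - 1"
proof -
  assume "aut f"
  then have "det (mat f) * det (mat (finv f)) = 1" using mat_inv det_mult det_1 by metis
  then show ?thesis using zmult_eq_1_iff by blast
qed

lemma minv_eqI: "det A = 1 \<or> det A = - 1 \<Longrightarrow> A * B = 1 \<Longrightarrow> minv A = B"
  using minv_mult by (metis mult.assoc mult.left_neutral mult.right_neutral)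

lemma mat_inv_minv: "aut f \<Longrightarrow> mat (finv f) = minv (mat f)"
  using minv_eqI[OF det_mat] mat_inv by metis

text \<open>Taken as an image rather than by a condition on determinants, so that every matrix used
  for conjugation comes with an automorphism.\<close>

definition Gam :: "m2 set" where "Gam = {mat f | f. aut f}"

lemma mat_sp: "mat (sp \<sigma> \<epsilon>) = (if \<sigma> then M2 (if \<epsilon> True then 1 else - 1) 0 0 (if \<epsilon> False then 1 else - 1)
   else M2 0 (if \<epsilon> False then 1 else - 1) (if \<epsilon> True then 1 else - 1) 0)"
  by (cases \<sigma>) (simp_all add: mat_def sp_gen ghom_uminus[OF ghom_ex] ex_gen)

lemma mat_stw_props:
  obtains p q r s where "mat (stw ws) = M2 p q r s" "p \<ge> 1" "q \<ge> 0" "r \<ge> 0" "s \<ge> 1"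
    "True \<in> set ws \<longrightarrow> r \<ge> 1" "False \<in> set ws \<longrightarrow> q \<ge> 1"
proof -
  obtain p q r s :: int where m: "p \<ge> 1" "q \<ge> 0" "r \<ge> 0" "s \<ge> 1" "p * s - q * r = 1"
     "True \<in> set ws \<longrightarrow> r \<ge> 1" "False \<in> set ws \<longrightarrow> q \<ge> 1"
     "\<forall>u. foldr stv ws u True = p * u True + q * u False \<and> foldr stv ws u False = r * u True + s * u False"
    using foldr_stv_matrix[of ws] by (elim exE conjE)
  have "ex g (stw ws x) = foldr stv ws (\<lambda>g. ex g x) g" for g x
    using fun_cong[OF ex_stw_stv[of ws x], of g] by simp
  then have "mat (stw ws) = M2 p q r s" using m(8) by (simp add: mat_def ex_gen)
  then show ?thesis by (rule that) (use m in simp_all)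
qed

lemma mat_kernel:
  assumes f: "aut f" "mat f = 1"
  shows "\<exists>g. f = cj g"
proof -
  obtain g \<sigma> \<epsilon> ws \<sigma>' \<epsilon>' where nf: "f = cj g \<circ> sp \<sigma> \<epsilon> \<circ> stw ws \<circ> sp \<sigma>' \<epsilon>'"
    using aut_NF[OF f(1)] unfolding NF_def by (elim exE)
  have "mat f = mat (sp \<sigma> \<epsilon>) * mat (stw ws) * mat (sp \<sigma>' \<epsilon>')"
    unfolding nf by (simp add: mat_comp ghom_comp ghom_cj ghom_sp ghom_stw mat_cj)
  then have m: "mat (sp \<sigma> \<epsilon>) * mat (stw ws) * mat (sp \<sigma>' \<epsilon>') = M2 1 0 0 1"
    using f(2) by (simp add: one_m2_def)
  obtain p q r s where w: "mat (stw ws) = M2 p q r s" "p \<ge> 1" "q \<ge> 0" "r \<ge> 0" "s \<ge> 1"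
    "True \<in> set ws \<longrightarrow> r \<ge> 1" "False \<in> set ws \<longrightarrow> q \<ge> 1" by (rule mat_stw_props[of ws])
  \<comment> \<open>The positive factor has the matrix of a signed permutation, and its diagonal
    entries are at least 1; so it is diagonal and \<open>ws\<close> is empty.\<close>
  have "q = 0 \<and> r = 0"
    using m w(2-5) unfolding w(1) mat_sp
    by (cases \<sigma>; cases \<sigma>'; cases "\<epsilon> True"; cases "\<epsilon> False"; cases "\<epsilon>' True"; cases "\<epsilon>' False") simp_all
  then have "True \<notin> set ws" "False \<notin> set ws" using w(6,7) by auto
  then have "ws = []" by (cases ws; cases "hd ws") auto
  then have "f = cj g \<circ> (sp \<sigma> \<epsilon> \<circ> sp \<sigma>' \<epsilon>')" by (simp add: nf fun_eq_iff)
  then have fs: "f = cj g \<circ> sp (\<sigma> = \<sigma>') (\<lambda>g. \<epsilon>' g = \<epsilon> (g = \<sigma>'))" by (simp only: sp_comp)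
  define \<delta> where "\<delta> = (\<lambda>g. \<epsilon>' g = \<epsilon> (g = \<sigma>'))"
  have "mat (sp (\<sigma> = \<sigma>') \<delta>) = M2 1 0 0 1" using f(2) unfolding fs \<delta>_def[symmetric] mat_cj_comp one_m2_def .
  then have "(\<sigma> = \<sigma>') = True \<and> \<delta> True \<and> \<delta> False"
    unfolding mat_sp by (cases "\<sigma> = \<sigma>'"; cases "\<delta> True"; cases "\<delta> False") simp_all
  then have "sp (\<sigma> = \<sigma>') \<delta> = sp True (\<lambda>_. True)"
    by (intro arg_cong2[where f = sp] ext) (simp, metis (full_types))
  then show ?thesis using fs sp_id unfolding \<delta>_def by (metis comp_id)
qed

lemma mat_eq_cj:
  assumes "aut f" "aut h" "mat f = mat h"
  shows "\<exists>g. f = cj g \<circ> h"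
proof -
  have "mat (f \<circ> finv h) = 1"
    using mat_comp[of f "finv h"] assms aut_inv(1)[OF assms(2)] mat_inv[OF assms(2)] aut_ghom by metis
  then obtain g where g: "f \<circ> finv h = cj g"
    using mat_kernel[OF aut_comp[OF assms(1) aut_inv(1)[OF assms(2)]]] by blast
  have "f = f \<circ> finv h \<circ> h" using aut_inv(3)[OF assms(2)] by (simp add: comp_assoc)
  then show ?thesis using g by metis
qed

text \<open>Nielsen's theorem on the commutator. The property passes to compositions, which leaves
  the factors of a normal form to be checked.\<close>

lemma aut_commutator:
  assumes "aut f"
  shows "\<exists>h. f cc = cj h (zm (det (mat f)) cc)"
proof -
  define P where "P f \<longleftrightarrow> (\<exists>h. f cc = cj h (zm (det (mat f)) cc))" for f
  have comp: "P (f \<circ> g)" if fg: "ghom f" "ghom g" "P f" "P g" for f g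
  proof -
    obtain h where h: "f cc = cj h (zm (det (mat f)) cc)" using fg(3) by (auto simp: P_def)
    obtain k where k: "g cc = cj k (zm (det (mat g)) cc)" using fg(4) by (auto simp: P_def)
    have "(f \<circ> g) cc = cj (f k) (zm (det (mat g)) (cj h (zm (det (mat f)) cc)))"
      by (simp add: k ghom_apply_cj[OF fg(1)] ghom_zm[OF fg(1)] h)
    also have "\<dots> = cj (f k + h) (zm (det (mat g) * det (mat f)) cc)"
      by (simp add: zm_mult cj_cj flip: ghom_zm[OF ghom_cj])
    finally show ?thesis by (auto simp: P_def mat_comp[OF fg(1,2)] mult.commute)
  qed
  have cj: "P (cj g)" for g by (auto simp: P_def mat_cj)
  have st: "P (st t)" for t
  proof -
    have "st t cc = cc"
      by (cases t) (simp_all add: cc_def ghom_plus[OF ghom_st] ghom_uminus[OF ghom_st] st_gen grp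
          del: add_uminus_conv_diff)
    moreover have "det (mat (st t)) = 1"
      by (cases t) (simp_all add: mat_def st_gen ghom_plus[OF ghom_ex] ex_gen)
    ultimately show ?thesis unfolding P_def by (metis cj_0 zm_1)
  qed
  have stw: "P (stw ws)" for ws
  proof (induction ws)
    case Nil
    have "stw [] = cj 0" by (simp add: fun_eq_iff)
    then show ?case using cj by (simp only:)
  next
    case (Cons t ws)
    have "stw (t # ws) = st t \<circ> stw ws" by (simp add: fun_eq_iff)
    then show ?case using comp[OF ghom_st ghom_stw st Cons] by (simp only:)
  qed
  have sp: "P (sp \<sigma> \<epsilon>)" for \<sigma> \<epsilon>
  proof -
    define h where "h = (if \<epsilon> True then 0 else - gen \<sigma>) + (if \<epsilon> False then 0 else - gen (\<not> \<sigma>))"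
    define h' where "h' = (if \<epsilon> False then 0 else - gen (\<not> \<sigma>)) + (if \<epsilon> True then 0 else - gen \<sigma>)"
    have "sp \<sigma> \<epsilon> cc = cj h' (zm (det (mat (sp \<sigma> \<epsilon>))) cc)"
      by (cases \<sigma>; cases "\<epsilon> True"; cases "\<epsilon> False")
         (simp_all add: mat_sp h'_def zm_uminus cj_def cc_def sp_gen ghom_plus[OF ghom_sp]
           ghom_uminus[OF ghom_sp] grp del: add_uminus_conv_diff)
    then show ?thesis by (auto simp: P_def)
  qed
  obtain g \<sigma> \<epsilon> ws \<sigma>' \<epsilon>' where nf: "f = cj g \<circ> sp \<sigma> \<epsilon> \<circ> stw ws \<circ> sp \<sigma>' \<epsilon>'"
    using aut_NF[OF assms] unfolding NF_def by (elim exE)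
  have "P f" unfolding nf by (intro comp ghom_comp ghom_cj ghom_sp ghom_stw cj sp stw)
  then show ?thesis by (simp add: P_def)
qed

section \<open>Automorphisms acting trivially on a family, and their matrices\<close>

definition MT :: "f2 set set \<Rightarrow> (f2 \<Rightarrow> f2) set" where
  "MT \<H> = {f. aut f \<and> (\<forall>H\<in>\<H>. \<exists>g. \<forall>h\<in>H. f h = cj g h)}"

definition MM :: "f2 set set \<Rightarrow> m2 set" where "MM \<H> = mat ` MT \<H>"

lemma MT_comp: "f \<in> MT \<H> \<Longrightarrow> f' \<in> MT \<H> \<Longrightarrow> f \<circ> f' \<in> MT \<H>"
proof -
  assume f: "f \<in> MT \<H>" and f': "f' \<in> MT \<H>"
  have "\<exists>g. \<forall>h\<in>H. (f \<circ> f') h = cj g h" if H: "H \<in> \<H>" for H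
  proof -
    obtain a where a: "\<forall>h\<in>H. f h = cj a h" using f H by (auto simp: MT_def)
    obtain b where b: "\<forall>h\<in>H. f' h = cj b h" using f' H by (auto simp: MT_def)
    have "ghom f" using f by (simp add: MT_def aut_def)
    then have "\<forall>h\<in>H. (f \<circ> f') h = cj (f b + a) h" using a b by (simp add: ghom_apply_cj cj_cj)
    then show ?thesis by blast
  qed
  then show ?thesis using f f' by (simp add: MT_def aut_comp)
qed

lemma MT_inv: "f \<in> MT \<H> \<Longrightarrow> finv f \<in> MT \<H>"
proof -
  assume f: "f \<in> MT \<H>"
  then have af: "aut f" by (simp add: MT_def)
  note i = aut_inv[OF af]
  have "\<exists>g. \<forall>h\<in>H. finv f h = cj g h" if H: "H \<in> \<H>" for H
  proof -
    obtain a where a: "\<forall>h\<in>H. f h = cj a h" using f H by (auto simp: MT_def)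
    have "finv f h = cj (- finv f a) h" if h: "h \<in> H" for h
    proof -
      have "h = finv f (cj a h)" using fun_cong[OF i(3), of h] a h by simp
      then have "h = cj (finv f a) (finv f h)" by (simp only: ghom_apply_cj[OF aut_ghom[OF i(1)]])
      then show ?thesis by (metis cj_uminus_cj(1))
    qed
    then show ?thesis by blast
  qed
  then show ?thesis using i(1) by (simp add: MT_def)
qed

lemma MT_cj: "cj g \<in> MT \<H>"
  by (auto simp: MT_def aut_cj)

text \<open>Automorphisms with equal matrices differ by an inner one, and inner automorphisms act
  trivially on every family.\<close>

lemma MM_iff: "aut f \<Longrightarrow> mat f \<in> MM \<H> \<longleftrightarrow> f \<in> MT \<H>"
proof
  assume f: "aut f" "mat f \<in> MM \<H>"
  then obtain h where h: "h \<in> MT \<H>" "mat f = mat h" by (auto simp: MM_def)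
  then obtain g where "f = cj g \<circ> h" using mat_eq_cj[OF f(1)] by (auto simp: MT_def)
  then show "f \<in> MT \<H>" using MT_comp[OF MT_cj h(1)] by simp
qed (simp add: MM_def)

lemma MM_Gam: "MM \<H> \<subseteq> Gam"
  by (auto simp: MM_def Gam_def MT_def)

lemma MM_one: "1 \<in> MM \<H>"
proof -
  have "mat (cj 0) \<in> MM \<H>" unfolding MM_def using MT_cj by (rule imageI)
  then show ?thesis by (simp only: mat_cj)
qed

lemma MM_mult: "A \<in> MM \<H> \<Longrightarrow> B \<in> MM \<H> \<Longrightarrow> A * B \<in> MM \<H>"
  unfolding MM_def
proof (elim imageE)
  fix f g assume *: "A = mat f" "f \<in> MT \<H>" "B = mat g" "g \<in> MT \<H>"
  then have "A * B = mat (f \<circ> g)" by (simp add: mat_comp MT_def aut_def)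
  then show "A * B \<in> mat ` MT \<H>" using MT_comp[OF *(2,4)] by blast
qed

lemma MM_minv: "A \<in> MM \<H> \<Longrightarrow> minv A \<in> MM \<H>"
  unfolding MM_def
proof (elim imageE)
  fix f assume *: "A = mat f" "f \<in> MT \<H>"
  then have "minv A = mat (finv f)" using mat_inv_minv[of f] by (simp add: MT_def)
  then show "minv A \<in> mat ` MT \<H>" using MT_inv[OF *(2)] by blast
qed

text \<open>Conjugating the matrix group amounts to moving the family, so a conjugate of such a
  group is again one of them.\<close>

lemma MM_image:
  assumes \<phi>: "aut \<phi>"
  shows "MM ((`) \<phi> ` \<H>) = (\<lambda>A. mat \<phi> * A * minv (mat \<phi>)) ` MM \<H>"
proof -
  have sub: "\<phi> \<circ> f \<circ> finv \<phi> \<in> MT ((`) \<phi> ` \<H>)" if \<phi>: "aut \<phi>" and f: "f \<in> MT \<H>" for \<phi> f \<H>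
  proof -
    have "\<exists>g. \<forall>h\<in>\<phi> ` H. (\<phi> \<circ> f \<circ> finv \<phi>) h = cj g h" if H: "H \<in> \<H>" for H
    proof -
      obtain a where a: "\<forall>h\<in>H. f h = cj a h" using f H by (auto simp: MT_def)
      have "(\<phi> \<circ> f \<circ> finv \<phi>) (\<phi> h) = cj (\<phi> a) (\<phi> h)" if "h \<in> H" for h
        using fun_cong[OF aut_inv(3)[OF \<phi>], of h] a that
        by (simp add: ghom_apply_cj[OF aut_ghom[OF \<phi>]])
      then show ?thesis by blast
    qed
    then show ?thesis using f \<phi> aut_inv(1)[OF \<phi>] by (auto simp: MT_def intro!: aut_comp)
  qed
  have m: "mat (\<phi> \<circ> f \<circ> finv \<phi>) = mat \<phi> * mat f * minv (mat \<phi>)" if "aut \<phi>" "aut f" for \<phi> f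
    using that aut_inv(1)[OF that(1)] by (simp add: mat_comp aut_ghom ghom_comp mat_inv_minv)
  have id: "(`) (finv \<phi>) ` (`) \<phi> ` \<H> = \<H>"
  proof -
    have "finv \<phi> ` \<phi> ` H = H" for H by (simp only: image_comp aut_inv(3)[OF \<phi>] image_id id_apply)
    then show ?thesis by (simp only: image_image image_ident)
  qed
  show ?thesis
  proof (intro equalityI subsetI)
    fix A assume "A \<in> MM ((`) \<phi> ` \<H>)"
    then obtain f where f: "A = mat f" "f \<in> MT ((`) \<phi> ` \<H>)" by (auto simp: MM_def)
    have af: "aut f" using f(2) by (simp add: MT_def)
    define h where "h = finv \<phi> \<circ> f \<circ> finv (finv \<phi>)"
    have ii: "finv (finv \<phi>) = \<phi>" using \<phi> by (simp add: aut_def inv_inv_eq)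
    have "h \<in> MT \<H>" using sub[OF aut_inv(1)[OF \<phi>] f(2)] by (simp add: h_def id)
    moreover have "f = \<phi> \<circ> h \<circ> finv \<phi>"
    proof -
      have "\<phi> \<circ> h \<circ> finv \<phi> = (\<phi> \<circ> finv \<phi>) \<circ> f \<circ> (\<phi> \<circ> finv \<phi>)" by (simp only: h_def ii comp_assoc)
      then show ?thesis by (simp add: aut_inv(2)[OF \<phi>])
    qed
    moreover have "aut h" using \<open>h \<in> MT \<H>\<close> by (simp add: MT_def)
    ultimately show "A \<in> (\<lambda>A. mat \<phi> * A * minv (mat \<phi>)) ` MM \<H>"
      using m[OF \<phi> \<open>aut h\<close>] f(1) by (auto simp: MM_def)
  next
    fix A assume "A \<in> (\<lambda>A. mat \<phi> * A * minv (mat \<phi>)) ` MM \<H>"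
    then obtain f where f: "f \<in> MT \<H>" "A = mat \<phi> * mat f * minv (mat \<phi>)" by (auto simp: MM_def)
    then have "A = mat (\<phi> \<circ> f \<circ> finv \<phi>)" using m[OF \<phi>] by (simp add: MT_def)
    then show "A \<in> MM ((`) \<phi> ` \<H>)" using sub[OF \<phi> f(1)] by (auto simp: MM_def)
  qed
qed

lemma MM_parabolic:
  assumes "m > 0" "mat (stw (replicate m True)) \<in> MM \<H>"
  shows "mat (st True) \<in> MM \<H>"
proof -
  have "stw (replicate m True) \<in> MT \<H>" using assms(2) MM_iff[OF aut_stw] by blast
  then have ex: "\<forall>H\<in>\<H>. \<exists>g. \<forall>x\<in>H. stw (replicate m True) x = cj g x"
    unfolding MT_def by simp
  have "\<exists>e. \<forall>x\<in>H. st True x = cj e x" if H: "H \<in> \<H>" for H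
  proof -
    from bspec[OF ex H] obtain g where g: "\<forall>x\<in>H. stw (replicate m True) x = cj g x" by (rule exE)
    show ?thesis by (rule parabolic_root[OF assms(1)]) (rule bspec[OF g])
  qed
  then have "st True \<in> MT \<H>" by (simp add: MT_def aut_st)
  then show ?thesis by (simp add: MM_def)
qed

text \<open>Every member of the family is conjugate into the powers of the commutator, and an
  automorphism of determinant 1 maps the commutator to a conjugate of itself.\<close>

lemma MM_hyperbolic:
  assumes "True \<in> set ws" "False \<in> set ws" "mat (stw ws) \<in> MM \<H>"
  shows "{A \<in> Gam. det A = 1} \<subseteq> MM \<H>"
proof
  fix A assume "A \<in> {A \<in> Gam. det A = 1}"
  then obtain f where f: "aut f" "A = mat f" "det (mat f) = 1" by (auto simp: Gam_def)
  have fh: "ghom f" using f(1) by (rule aut_ghom)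
  obtain c where c: "f cc = cj c cc" using aut_commutator[OF f(1)] f(3) by auto
  have w: "stw ws \<in> MT \<H>" using assms(3) MM_iff[OF aut_stw] by blast
  have "\<exists>g. \<forall>x\<in>H. f x = cj g x" if H: "H \<in> \<H>" for H
  proof -
    obtain g where g: "\<forall>x\<in>H. stw ws x = cj g x" using w H unfolding MT_def by blast
    have "\<exists>s. \<forall>x\<in>H. \<exists>k. cj s x = zm k cc"
      by (rule hyperbolic_peripheral[OF assms(1,2)]) (rule bspec[OF g])
    then obtain s where s: "\<forall>x\<in>H. \<exists>k. cj s x = zm k cc" by (rule exE)
    have "f x = cj (f (- s) + c + s) x" if x: "x \<in> H" for x
    proof -
      obtain k where k: "cj s x = zm k cc" using s x by blast
      have "f x = f (cj (- s) (cj s x))" by simp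
      also have "\<dots> = cj (f (- s)) (zm k (cj c cc))"
        unfolding k by (simp only: ghom_apply_cj[OF fh] ghom_zm[OF fh] c)
      also have "zm k (cj c cc) = cj c (cj s x)" by (simp add: k ghom_zm[OF ghom_cj])
      finally show ?thesis by (simp only: cj_cj add.assoc)
    qed
    then show ?thesis by blast
  qed
  then have "f \<in> MT \<H>" using f(1) by (simp add: MT_def)
  then show "A \<in> MM \<H>" using f(2) by (simp add: MM_def)
qed

section \<open>Conjugacy of integer matrices\<close>

lemma minv_det [simp]: "det A = 1 \<or> det A = - 1 \<Longrightarrow> det (minv A) = det A"
  using minv_mult[of A] det_mult[of "minv A" A] by auto

lemma Gam_det: "A \<in> Gam \<Longrightarrow> det A = 1 \<or> det A = - 1"
  using det_mat by (auto simp: Gam_def)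

lemma GamI: "aut f \<Longrightarrow> mat f \<in> Gam"
  by (auto simp: Gam_def)

lemma Gam_one: "1 \<in> Gam"
  using aut_cj[of 0] mat_cj[of 0] by (force simp: Gam_def)

lemma Gam_mult: "A \<in> Gam \<Longrightarrow> B \<in> Gam \<Longrightarrow> A * B \<in> Gam"
proof -
  assume "A \<in> Gam" "B \<in> Gam"
  then obtain f g where "aut f" "A = mat f" "aut g" "B = mat g" by (auto simp: Gam_def)
  then have "A * B = mat (f \<circ> g)" "aut (f \<circ> g)" by (simp_all add: mat_comp aut_ghom aut_comp)
  then show ?thesis by (auto simp: Gam_def)
qed

lemma Gam_minv: "A \<in> Gam \<Longrightarrow> minv A \<in> Gam"
proof -
  assume "A \<in> Gam"
  then obtain f where "aut f" "A = mat f" by (auto simp: Gam_def)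
  then have "minv A = mat (finv f)" "aut (finv f)" using mat_inv_minv aut_inv(1) by auto
  then show ?thesis by (auto simp: Gam_def)
qed

lemma Gam_minv_mult: "A \<in> Gam \<Longrightarrow> minv A * A = 1" "A \<in> Gam \<Longrightarrow> A * minv A = 1"
  using minv_mult Gam_det by blast+

lemma minv_mult_distrib: "A \<in> Gam \<Longrightarrow> B \<in> Gam \<Longrightarrow> minv (A * B) = minv B * minv A"
proof (rule minv_eqI)
  assume AB: "A \<in> Gam" "B \<in> Gam"
  then show "det (A * B) = 1 \<or> det (A * B) = - 1" using Gam_det[of "A * B"] Gam_mult by blast
  have "A * B * (minv B * minv A) = A * (B * minv B) * minv A" by (simp only: mult.assoc)
  then show "A * B * (minv B * minv A) = 1" using AB Gam_minv_mult by simp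
qed

definition cm :: "m2 \<Rightarrow> m2 \<Rightarrow> m2" where "cm B A = B * A * minv B"

lemma cm_cm: "B \<in> Gam \<Longrightarrow> C \<in> Gam \<Longrightarrow> cm B (cm C A) = cm (B * C) A"
  by (simp add: cm_def minv_mult_distrib mult.assoc)

lemma cm_1 [simp]: "cm 1 A = A" by (simp add: cm_def one_m2_def) (cases A; simp)

lemma det_cm: "B \<in> Gam \<Longrightarrow> det (cm B A) = det A"
  using Gam_det[of B] by (auto simp: cm_def)

lemma tr_comm: "tr (A * B) = tr (B * A)"
  by (cases A; cases B) simp

lemma tr_cm: "B \<in> Gam \<Longrightarrow> tr (cm B A) = tr A"
  using tr_comm[of "B * A" "minv B"] Gam_minv_mult by (simp add: cm_def mult.assoc[symmetric])

lemma Gam_lower: "M2 1 0 1 1 \<in> Gam" and Gam_upper: "M2 1 1 0 1 \<in> Gam"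
  and Gam_swap: "M2 0 1 1 0 \<in> Gam" and Gam_diag: "M2 1 0 0 (- 1) \<in> Gam"
proof -
  have "mat (st True) = M2 1 0 1 1" "mat (st False) = M2 1 1 0 1"
    by (simp_all add: mat_def st_gen ghom_plus[OF ghom_ex] ex_gen)
  then show "M2 1 0 1 1 \<in> Gam" "M2 1 1 0 1 \<in> Gam"
    using GamI[OF aut_st[of True]] GamI[OF aut_st[of False]] by simp_all
  have "mat (sp False (\<lambda>_. True)) = M2 0 1 1 0" "mat (sp True (\<lambda>g. g)) = M2 1 0 0 (- 1)"
    by (simp_all add: mat_sp)
  then show "M2 0 1 1 0 \<in> Gam" "M2 1 0 0 (- 1) \<in> Gam"
    using GamI[OF aut_sp[of False "\<lambda>_. True"]] GamI[OF aut_sp[of True "\<lambda>g. g"]] by simp_all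
qed

lemma Gam_lower': "M2 1 0 (- 1) 1 \<in> Gam" and Gam_upper': "M2 1 (- 1) 0 1 \<in> Gam"
  using Gam_minv[OF Gam_lower] Gam_minv[OF Gam_upper] by simp_all

text \<open>Conjugation by elementary matrices changes \<open>p - s\<close> by \<open>2 * q\<close>
  or \<open>2 * r\<close> in either direction; the bounds express that this gains nothing at a
  minimum of the absolute value.\<close>

lemma minimal_conjugate:
  assumes "A \<in> Gam"
  obtains B p q r s where "B \<in> Gam" "cm B A = M2 p q r s"
    "q \<noteq> 0 \<longrightarrow> \<bar>p - s\<bar> \<le> \<bar>q\<bar>" "r \<noteq> 0 \<longrightarrow> \<bar>p - s\<bar> \<le> \<bar>r\<bar>"
proof -
  define \<mu> where "\<mu> C = (case C of M2 p q r s \<Rightarrow> nat \<bar>p - s\<bar>)" for C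
  obtain B where B: "B \<in> Gam" "\<And>C. C \<in> Gam \<Longrightarrow> \<mu> (cm B A) \<le> \<mu> (cm C A)"
    using ex_has_least_nat[of "\<lambda>B. B \<in> Gam" 1 "\<lambda>B. \<mu> (cm B A)"] Gam_one by blast
  obtain p q r s where pqrs: "cm B A = M2 p q r s" by (cases "cm B A")
  have C: "nat \<bar>p - s\<bar> \<le> \<mu> (cm C (M2 p q r s))" if "C \<in> Gam" for C
    using B(2)[OF Gam_mult[OF that B(1)]] that B(1) by (simp add: cm_cm[symmetric] pqrs \<mu>_def)
  have "\<bar>p - s\<bar> \<le> \<bar>p - s - 2 * q\<bar>" "\<bar>p - s\<bar> \<le> \<bar>p - s + 2 * q\<bar>"
    using C[OF Gam_lower] C[OF Gam_lower'] by (simp_all add: cm_def \<mu>_def nat_le_eq_zle algebra_simps)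
  then have "q \<noteq> 0 \<longrightarrow> \<bar>p - s\<bar> \<le> \<bar>q\<bar>" by linarith
  moreover have "\<bar>p - s\<bar> \<le> \<bar>p - s - 2 * r\<bar>" "\<bar>p - s\<bar> \<le> \<bar>p - s + 2 * r\<bar>"
    using C[OF Gam_upper] C[OF Gam_upper'] by (simp_all add: cm_def \<mu>_def nat_le_eq_zle algebra_simps)
  then have "r \<noteq> 0 \<longrightarrow> \<bar>p - s\<bar> \<le> \<bar>r\<bar>" by linarith
  ultimately show ?thesis by (rule that[OF B(1) pqrs])
qed

lemma mat_stw_Cons: "mat (stw (t # ws)) = mat (st t) * mat (stw ws)"
proof -
  have "stw (t # ws) = st t \<circ> stw ws" by (simp add: fun_eq_iff)
  then show ?thesis by (simp only: mat_comp[OF ghom_st ghom_stw])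
qed

lemma mat_stw_Nil: "mat (stw []) = 1"
proof -
  have "stw [] = id" by (simp add: fun_eq_iff)
  then show ?thesis by (simp only: mat_id)
qed

lemma mat_st: "mat (st True) = M2 1 0 1 1" "mat (st False) = M2 1 1 0 1"
  by (simp_all add: mat_def st_gen ghom_plus[OF ghom_ex] ex_gen)

text \<open>The Euclidean algorithm on the rows: the smaller row is subtracted from the larger one.
  Rows that are not comparable occur only for the identity, by the determinant.\<close>

lemma nonneg_word:
  "p \<ge> 0 \<Longrightarrow> q \<ge> 0 \<Longrightarrow> r \<ge> 0 \<Longrightarrow> s \<ge> 0 \<Longrightarrow> p * s - q * r = 1 \<Longrightarrow> \<exists>ws. mat (stw ws) = M2 p q r s"
proof (induction "nat (p + q + r + s)" arbitrary: p q r s rule: less_induct)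
  case less
  have pq: "p + q > 0"
  proof (rule ccontr)
    assume "\<not> ?thesis"
    then have "p = 0" "q = 0" using less.prems by auto
    then show False using less.prems(5) by simp
  qed
  have rs: "r + s > 0"
  proof (rule ccontr)
    assume "\<not> ?thesis"
    then have "r = 0" "s = 0" using less.prems by auto
    then show False using less.prems(5) by simp
  qed
  consider "p \<le> r" "q \<le> s" | "r \<le> p" "s \<le> q" | "r < p" "q < s" | "p < r" "s < q" by linarith
  then show ?case
  proof cases
    case 1
    have "nat (p + q + (r - p) + (s - q)) < nat (p + q + r + s)" using pq 1 less.prems(1-4) by linarith
    moreover have "p * (s - q) - q * (r - p) = 1" using less.prems(5) by (simp add: algebra_simps)
    ultimately obtain ws where "mat (stw ws) = M2 p q (r - p) (s - q)"
      using less.hyps[of p q "r - p" "s - q"] less.prems(1-4) 1 by auto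
    then have "mat (stw (True # ws)) = M2 p q r s" by (simp only: mat_stw_Cons mat_st) simp
    then show ?thesis by blast
  next
    case 2
    have "nat ((p - r) + (q - s) + r + s) < nat (p + q + r + s)" using rs 2 less.prems(1-4) by linarith
    moreover have "(p - r) * s - (q - s) * r = 1" using less.prems(5) by (simp add: algebra_simps)
    ultimately obtain ws where "mat (stw ws) = M2 (p - r) (q - s) r s"
      using less.hyps[of "p - r" "q - s" r s] less.prems(1-4) 2 by auto
    then have "mat (stw (False # ws)) = M2 p q r s" by (simp only: mat_stw_Cons mat_st) simp
    then show ?thesis by blast
  next
    case 3
    have "(r + 1) * (q + 1) \<le> p * s" by (rule mult_mono) (use 3 less.prems in auto)
    then have "r + q \<le> 0" using less.prems(5) by (simp add: algebra_simps)
    then have "r = 0" "q = 0" using less.prems by auto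
    then have "p = 1" "s = 1" using less.prems(1,4,5) zmult_eq_1_iff[of p s] by auto
    then have "mat (stw []) = M2 p q r s" using \<open>r = 0\<close> \<open>q = 0\<close> mat_stw_Nil by (simp add: one_m2_def)
    then show ?thesis by blast
  next
    case 4
    have "p * s \<le> r * q" by (rule mult_mono) (use 4 less.prems in auto)
    then show ?thesis using less.prems(5) by (simp add: algebra_simps)
  qed
qed

lemma mat_stw_missing:
  "True \<notin> set ws \<Longrightarrow> \<exists>q. mat (stw ws) = M2 1 q 0 1" "False \<notin> set ws \<Longrightarrow> \<exists>r. mat (stw ws) = M2 1 0 r 1"
proof -
  show "True \<notin> set ws \<Longrightarrow> \<exists>q. mat (stw ws) = M2 1 q 0 1"
  proof (induction ws)
    case Nil
    show ?case unfolding mat_stw_Nil one_m2_def by blast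
  next
    case (Cons t ws)
    then obtain q where "mat (stw ws) = M2 1 q 0 1" by auto
    moreover have "t = False" using Cons.prems by (cases t) auto
    ultimately have "mat (stw (t # ws)) = M2 1 (q + 1) 0 1" by (simp only: mat_stw_Cons mat_st) simp
    then show ?case by blast
  qed
  show "False \<notin> set ws \<Longrightarrow> \<exists>r. mat (stw ws) = M2 1 0 r 1"
  proof (induction ws)
    case Nil
    show ?case unfolding mat_stw_Nil one_m2_def by blast
  next
    case (Cons t ws)
    then obtain r where "mat (stw ws) = M2 1 0 r 1" by auto
    moreover have "t = True" using Cons.prems by (cases t) auto
    ultimately have "mat (stw (t # ws)) = M2 1 0 (1 + r) 1" by (simp only: mat_stw_Cons mat_st) simp
    then show ?case by blast
  qed
qed

text \<open>The discriminant \<open>(p - s) * (p - s) + 4 * (q * r)\<close> is the square of the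
  trace minus 4 and thus positive. For a minimal conjugate a negative \<open>q * r\<close> would
  make it negative, so \<open>q\<close> and \<open>r\<close> have equal signs, and conjugation by a
  diagonal matrix makes them positive.\<close>

lemma hyperbolic_conjugate:
  assumes A: "A \<in> Gam" "det A = 1" "tr A > 2"
  obtains B ws where "B \<in> Gam" "cm B A = mat (stw ws)" "True \<in> set ws" "False \<in> set ws"
proof -
  obtain B p q r s where B: "B \<in> Gam" "cm B A = M2 p q r s"
    "q \<noteq> 0 \<longrightarrow> \<bar>p - s\<bar> \<le> \<bar>q\<bar>" "r \<noteq> 0 \<longrightarrow> \<bar>p - s\<bar> \<le> \<bar>r\<bar>" by (rule minimal_conjugate[OF A(1)])
  have d: "p * s - q * r = 1" and t: "p + s > 2"
    using det_cm[OF B(1), of A] tr_cm[OF B(1), of A] A by (simp_all add: B(2))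
  have D: "(p - s) * (p - s) + 4 * (q * r) = (p + s) * (p + s) - 4"
  proof -
    have "(p - s) * (p - s) + 4 * (q * r) = (p + s) * (p + s) - 4 * (p * s - q * r)" by (simp add: algebra_simps)
    then show ?thesis by (simp only: d)
  qed
  have "3 * 3 \<le> (p + s) * (p + s)" by (rule mult_mono) (use t in auto)
  with D have pos: "(p - s) * (p - s) + 4 * (q * r) > 0" by simp
  have qr0: "q * r \<noteq> 0"
  proof
    assume "q * r = 0"
    then have "p * s = 1" using d by linarith
    then show False using t zmult_eq_1_iff[of p s] by auto
  qed
  have qr: "q * r > 0"
  proof (rule ccontr)
    assume "\<not> ?thesis"
    then have neg: "q * r < 0" using qr0 by (meson linorder_less_linear)
    have "\<bar>p - s\<bar> * \<bar>p - s\<bar> \<le> \<bar>q\<bar> * \<bar>r\<bar>" by (rule mult_mono) (use B(3,4) qr0 in auto)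
    then have "(p - s) * (p - s) \<le> - (q * r)" using neg by (simp add: abs_mult[symmetric])
    then show False using pos neg by linarith
  qed
  then have "p * s > 0" using d by simp
  then have ps: "p > 0" "s > 0" using t by (auto simp: zero_less_mult_iff)
  note result = that
  have fin: thesis if C: "C \<in> Gam" "cm C A = M2 p q' r' s" "q' > 0" "r' > 0" "p * s - q' * r' = 1" for C q' r'
  proof -
    obtain ws where ws: "mat (stw ws) = M2 p q' r' s" using nonneg_word[of p q' r' s] C ps by auto
    have "True \<in> set ws" using mat_stw_missing(1)[of ws] ws C(4) by fastforce
    moreover have "False \<in> set ws" using mat_stw_missing(2)[of ws] ws C(3) by fastforce
    ultimately show thesis using result[OF C(1), of ws] C(2) ws by simp
  qed
  show thesis
  proof (cases "q > 0")
    case True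
    then show thesis using fin[OF B(1,2)] qr d by (simp add: zero_less_mult_iff)
  next
    case False
    then have "q < 0" "r < 0" using qr by (auto simp: zero_less_mult_iff)
    moreover have "cm (M2 1 0 0 (- 1) * B) A = M2 p (- q) (- r) s"
      unfolding cm_cm[OF Gam_diag B(1), symmetric] B(2) by (simp add: cm_def)
    ultimately show thesis using fin[OF Gam_mult[OF Gam_diag B(1)], of "- q" "- r"] d by simp
  qed
qed

text \<open>The same reduction with discriminant 0 yields \<open>q * r = 0\<close>, a triangular
  matrix.\<close>

lemma parabolic_conjugate:
  assumes A: "A \<in> Gam" "det A = 1" "tr A = 2" "A \<noteq> 1"
  obtains B n where "B \<in> Gam" "cm B A = M2 1 0 n 1" "n \<noteq> 0"
proof -
  obtain B p q r s where B: "B \<in> Gam" "cm B A = M2 p q r s"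
    "q \<noteq> 0 \<longrightarrow> \<bar>p - s\<bar> \<le> \<bar>q\<bar>" "r \<noteq> 0 \<longrightarrow> \<bar>p - s\<bar> \<le> \<bar>r\<bar>" by (rule minimal_conjugate[OF A(1)])
  have d: "p * s - q * r = 1" and t: "p + s = 2"
    using det_cm[OF B(1), of A] tr_cm[OF B(1), of A] A by (simp_all add: B(2))
  have D: "(p - s) * (p - s) + 4 * (q * r) = 0"
  proof -
    have "(p - s) * (p - s) + 4 * (q * r) = (p + s) * (p + s) - 4 * (p * s - q * r)" by (simp add: algebra_simps)
    then show ?thesis by (simp only: d t)
  qed
  have qr: "q * r = 0"
  proof (rule ccontr)
    assume qr0: "q * r \<noteq> 0"
    have sq: "(p - s) * (p - s) \<ge> 0" by simp
    then have neg: "q * r < 0" using D qr0 by linarith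
    have "\<bar>p - s\<bar> * \<bar>p - s\<bar> \<le> \<bar>q\<bar> * \<bar>r\<bar>" by (rule mult_mono) (use B(3,4) qr0 in auto)
    then have "(p - s) * (p - s) \<le> - (q * r)" using neg by (simp add: abs_mult[symmetric])
    then show False using D neg by linarith
  qed
  then have "p * s = 1" using d by linarith
  then have ps: "p = 1" "s = 1" using t zmult_eq_1_iff[of p s] by auto
  have ne: "cm B A \<noteq> 1"
  proof
    assume "cm B A = 1"
    have "cm (minv B * B) A = cm (minv B) (cm B A)" by (rule cm_cm[OF Gam_minv[OF B(1)] B(1), symmetric])
    then have "cm (minv B * B) A = cm (minv B) 1" by (simp only: \<open>cm B A = 1\<close>)
    then have "A = cm (minv B) 1" by (simp only: Gam_minv_mult[OF B(1)] cm_1)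
    then have "A = 1" using Gam_minv_mult(2)[OF Gam_minv[OF B(1)]] by (simp add: cm_def)
    then show False using A(4) by simp
  qed
  show thesis
  proof (cases "q = 0")
    case True
    then show thesis using that[OF B(1), of r] B(2) ps ne by (auto simp: one_m2_def)
  next
    case False
    then have "r = 0" using qr by simp
    moreover have "cm (M2 0 1 1 0 * B) A = M2 s r q p"
      unfolding cm_cm[OF Gam_swap B(1), symmetric] B(2) by (simp add: cm_def)
    ultimately show thesis using that[OF Gam_mult[OF Gam_swap B(1)], of q] ps False by simp
  qed
qed

section \<open>Classification of the matrix groups\<close>

text \<open>What is retained of a McCool group once the family is forgotten: a matrix group with the
  two properties that produce further elements from a parabolic or a hyperbolic one.\<close>

definition admissible :: "m2 set \<Rightarrow> bool" where
  "admissible X \<longleftrightarrow> X \<subseteq> Gam \<and> 1 \<in> X \<and> (\<forall>A\<in>X. \<forall>B\<in>X. A * B \<in> X) \<and> (\<forall>A\<in>X. minv A \<in> X) \<and>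
     (\<forall>m>0. mat (stw (replicate m True)) \<in> X \<longrightarrow> mat (st True) \<in> X) \<and>
     (\<forall>ws. True \<in> set ws \<longrightarrow> False \<in> set ws \<longrightarrow> mat (stw ws) \<in> X \<longrightarrow> {A \<in> Gam. det A = 1} \<subseteq> X)"

lemma admissible_MM: "admissible (MM \<H>)"
  unfolding admissible_def
proof (intro conjI allI impI ballI)
  show "{A \<in> Gam. det A = 1} \<subseteq> MM \<H>"
    if "True \<in> set ws" "False \<in> set ws" "mat (stw ws) \<in> MM \<H>" for ws
    using that by (rule MM_hyperbolic)
  show "mat (st True) \<in> MM \<H>" if "0 < m" "mat (stw (replicate m True)) \<in> MM \<H>" for m
    using that by (rule MM_parabolic)
qed (simp_all only: MM_Gam MM_one MM_mult MM_minv)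

lemma admissibleD:
  assumes "admissible X"
  shows "A \<in> X \<Longrightarrow> A \<in> Gam" "1 \<in> X" "A \<in> X \<Longrightarrow> B \<in> X \<Longrightarrow> A * B \<in> X"
    "A \<in> X \<Longrightarrow> minv A \<in> X"
    "0 < m \<Longrightarrow> mat (stw (replicate m True)) \<in> X \<Longrightarrow> mat (st True) \<in> X"
    "True \<in> set ws \<Longrightarrow> False \<in> set ws \<Longrightarrow> mat (stw ws) \<in> X \<Longrightarrow> {A \<in> Gam. det A = 1} \<subseteq> X"
proof -
  note X = assms[unfolded admissible_def]
  note 1 = X[THEN conjunct1] and X = X[THEN conjunct2]
  note 2 = X[THEN conjunct1] and X = X[THEN conjunct2]
  note 3 = X[THEN conjunct1] and X = X[THEN conjunct2]
  note 4 = X[THEN conjunct1] and X = X[THEN conjunct2]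
  note 5 = X[THEN conjunct1] and 6 = X[THEN conjunct2]
  show "A \<in> X \<Longrightarrow> A \<in> Gam" by (rule subsetD[OF 1])
  show "1 \<in> X" by (rule 2)
  show "A \<in> X \<Longrightarrow> B \<in> X \<Longrightarrow> A * B \<in> X" by (rule 3[rule_format])
  show "A \<in> X \<Longrightarrow> minv A \<in> X" by (rule 4[rule_format])
  show "0 < m \<Longrightarrow> mat (stw (replicate m True)) \<in> X \<Longrightarrow> mat (st True) \<in> X"
    by (rule 5[rule_format])
  show "True \<in> set ws \<Longrightarrow> False \<in> set ws \<Longrightarrow> mat (stw ws) \<in> X \<Longrightarrow> {A \<in> Gam. det A = 1} \<subseteq> X"
    using 6 by (elim allE impE)
qed

text \<open>\<open>admissible\<close> refers to particular matrices and is not visibly invariant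
  under conjugation. It holds for the conjugates because they belong to the moved families.\<close>

lemma cm_MM:
  assumes "B \<in> Gam"
  obtains \<K> where "cm B ` MM \<H> = MM \<K>"
proof -
  obtain f where "aut f" "B = mat f" using assms by (auto simp: Gam_def)
  then have "cm B ` MM \<H> = MM ((`) f ` \<H>)" using MM_image[of f \<H>] unfolding cm_def by simp
  then show ?thesis by (rule that)
qed

definition box :: "m2 set" where
  "box = (\<lambda>(p, q, r, s). M2 p q r s) ` ({- 1..1} \<times> {- 1..1} \<times> {- 1..1} \<times> {- 1..1})"

definition triangular :: "(int \<times> int) set \<Rightarrow> m2 set" where
  "triangular \<Delta> = {M2 p 0 r s | p r s. (p, s) \<in> \<Delta>}"

text \<open>A finite list of matrix sets, to be shown to meet every conjugacy class of the groups in
  question; its members need not be groups.\<close>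

definition fam :: "m2 set set" where
  "fam = {Gam, {A \<in> Gam. det A = 1}} \<union> triangular ` Pow ({- 1, 1} \<times> {- 1, 1}) \<union> Pow box"

lemma finite_fam: "finite fam"
  unfolding fam_def box_def by simp

lemma tr_square: "tr (A * A) = tr A * tr A - 2 * det A"
  by (cases A) (simp add: algebra_simps)

lemma mat_power_lower: "mat (stw (replicate m True)) = M2 1 0 (int m) 1"
proof (induction m)
  case 0
  show ?case using mat_stw_Nil by (simp add: one_m2_def del: stw_simps)
next
  case (Suc m)
  have "mat (stw (replicate (Suc m) True)) = M2 1 0 1 1 * M2 1 0 (int m) 1"
    by (simp only: replicate_Suc mat_stw_Cons mat_st Suc)
  also have "\<dots> = M2 1 0 (int (Suc m)) 1" by simp
  finally show ?case .
qed

text \<open>The matrices of determinant 1 have index 2 in \<open>Gam\<close>, so no group lies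
  strictly between.\<close>

lemma classify_hyperbolic:
  assumes Y: "admissible Y" and SL: "{A \<in> Gam. det A = 1} \<subseteq> Y"
  shows "Y \<in> fam"
proof (cases "\<forall>C\<in>Y. det C = 1")
  case True
  then have "Y = {A \<in> Gam. det A = 1}" using admissibleD(1)[OF Y] SL by blast
  then show ?thesis by (simp add: fam_def)
next
  case False
  then obtain D where D: "D \<in> Y" "det D = - 1" "D \<in> Gam"
    using admissibleD(1)[OF Y] Gam_det by blast
  have "C \<in> Y" if C: "C \<in> Gam" for C
  proof (cases "det C = 1")
    case True
    then show ?thesis using SL C by blast
  next
    case False
    then have "det C = - 1" using Gam_det[OF C] by simp
    then have "C * minv D \<in> {A \<in> Gam. det A = 1}"
      using C D Gam_mult Gam_minv by simp
    then have "C * minv D \<in> Y" using SL by blast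
    then have "C * minv D * D \<in> Y" using admissibleD(3)[OF Y] D(1) by blast
    then show ?thesis using Gam_minv_mult(1)[OF D(3)] by (simp add: mult.assoc)
  qed
  then have "Y = Gam" using admissibleD(1)[OF Y] by blast
  then show ?thesis by (simp add: fam_def)
qed

text \<open>The group contains all lower unipotent matrices. They make the traces unbounded unless
  the upper right entry is 0, and they make the lower left entry arbitrary, so that only the
  diagonals remain as data.\<close>

lemma classify_parabolic:
  assumes Y: "admissible Y" and P: "M2 1 0 n 1 \<in> Y" "n \<noteq> 0"
    and nh: "\<And>A. A \<in> Y \<Longrightarrow> (det A = 1 \<longrightarrow> \<bar>tr A\<bar> \<le> 2) \<and> (det A = - 1 \<longrightarrow> tr A = 0)"
  shows "Y \<in> fam"
proof -
  note mult = admissibleD(3)[OF Y] and inv = admissibleD(4)[OF Y]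
  have "M2 1 0 \<bar>n\<bar> 1 \<in> Y" using P(1) inv[OF P(1)] by (cases "n \<ge> 0") simp_all
  then have "mat (stw (replicate (nat \<bar>n\<bar>) True)) \<in> Y" by (simp only: mat_power_lower) simp
  then have L: "M2 1 0 1 1 \<in> Y" using admissibleD(5)[OF Y, of "nat \<bar>n\<bar>"] P(2) mat_st(1) by simp
  have Ln: "M2 1 0 (int j) 1 \<in> Y" for j
  proof (induction j)
    case 0
    show ?case using admissibleD(2)[OF Y] by (simp add: one_m2_def)
  next
    case (Suc j)
    then show ?case using mult[OF L Suc] by simp
  qed
  have Lj: "M2 1 0 j 1 \<in> Y" for j
    using Ln[of "nat j"] inv[OF Ln[of "nat (- j)"]] by (cases "j \<ge> 0") simp_all
  have form: "q = 0 \<and> p \<in> {- 1, 1} \<and> s \<in> {- 1, 1}" if C: "M2 p q r s \<in> Y" for p q r s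
  proof -
    have d: "p * s - q * r = 1 \<or> p * s - q * r = - 1"
      using Gam_det[OF admissibleD(1)[OF Y C]] by simp
    have t: "\<bar>p + (j * q + s)\<bar> \<le> 2" if "p * s - q * r = 1" for j
      using nh[OF mult[OF Lj[of j] C]] that by (simp add: algebra_simps)
    have t': "p + (j * q + s) = 0" if "p * s - q * r = - 1" for j
      using nh[OF mult[OF Lj[of j] C]] that by (simp add: algebra_simps)
    have q: "q = 0"
    proof (cases "p * s - q * r = 1")
      case True
      \<comment> \<open>Two traces in [-2, 2] differ by at most 4, which excludes a difference
        \<open>5 * q\<close> with nonzero \<open>q\<close>.\<close>
      then show ?thesis using t[OF True, of 0] t[OF True, of 5] by simp
    next
      case False
      then have "p * s - q * r = - 1" using d by simp
      then show ?thesis using t'[of 0] t'[of 1] by simp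
    qed
    then have "p * s = 1 \<or> p * (- s) = 1" using d by auto
    then show ?thesis using q zmult_eq_1_iff[of p s] zmult_eq_1_iff[of p "- s"] by auto
  qed
  define \<Delta> where "\<Delta> = {(p, s). \<exists>r. M2 p 0 r s \<in> Y}"
  have "\<Delta> \<subseteq> {- 1, 1} \<times> {- 1, 1}" using form by (auto simp: \<Delta>_def)
  moreover have "Y = triangular \<Delta>"
  proof (intro equalityI subsetI)
    fix A assume A: "A \<in> Y"
    obtain p q r s where pqrs: "A = M2 p q r s" by (cases A)
    then have "q = 0" using form A by blast
    then show "A \<in> triangular \<Delta>" using A unfolding pqrs triangular_def \<Delta>_def by blast
  next
    fix A assume "A \<in> triangular \<Delta>"
    then obtain p r s r0 where A: "A = M2 p 0 r s" "M2 p 0 r0 s \<in> Y"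
      by (auto simp: triangular_def \<Delta>_def)
    have p: "p * p = 1" using form[OF A(2)] by auto
    \<comment> \<open>Multiplication by a unipotent matrix adds a multiple of \<open>p\<close> to
      \<open>r0\<close>; as \<open>p\<close> is its own inverse, this factor produces the required
      \<open>r\<close>.\<close>
    have "M2 1 0 ((r - r0) * p) 1 * M2 p 0 r0 s = M2 p 0 ((r - r0) * (p * p) + r0) s"
      by (simp add: mult.assoc)
    also have "\<dots> = A" by (simp add: p A(1))
    finally show "A \<in> Y" using mult[OF Lj A(2)] by metis
  qed
  ultimately show ?thesis by (auto simp: fam_def)
qed

text \<open>For integer matrices of determinant 1 or -1 these are the ones of finite order.\<close>

definition elliptic :: "m2 \<Rightarrow> bool" where
  "elliptic A \<longleftrightarrow> det A = 1 \<and> (\<bar>tr A\<bar> < 2 \<or> A = 1 \<or> A = M2 (- 1) 0 0 (- 1)) \<or> det A = - 1 \<and> tr A = 0"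

text \<open>
  The determinant forces the trace to be 2 modulo 9, which excludes trace \<open>- 1\<close>.
\<close>

lemma elliptic_mod_3:
  assumes "elliptic (M2 (1 + 3 * x) (3 * y) (3 * z) (1 + 3 * w))"
  shows "M2 (1 + 3 * x) (3 * y) (3 * z) (1 + 3 * w) = 1"
proof -
  have d: "det (M2 (1 + 3 * x) (3 * y) (3 * z) (1 + 3 * w)) = 1 + 3 * (x + w + 3 * (x * w - y * z))"
    by (simp add: algebra_simps)
  then have "det (M2 (1 + 3 * x) (3 * y) (3 * z) (1 + 3 * w)) \<noteq> - 1" by presburger
  then have d1: "det (M2 (1 + 3 * x) (3 * y) (3 * z) (1 + 3 * w)) = 1"
    and t: "\<bar>tr (M2 (1 + 3 * x) (3 * y) (3 * z) (1 + 3 * w))\<bar> < 2 \<or>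
      M2 (1 + 3 * x) (3 * y) (3 * z) (1 + 3 * w) = 1 \<or>
      M2 (1 + 3 * x) (3 * y) (3 * z) (1 + 3 * w) = M2 (- 1) 0 0 (- 1)"
    using assms unfolding elliptic_def by blast+
  have "1 + 3 * (x + w + 3 * (x * w - y * z)) = 1" using d d1 by (simp only:)
  then have xw: "x + w + 3 * (x * w - y * z) = 0" by simp
  have "\<not> \<bar>2 + 3 * (x + w)\<bar> < 2"
  proof
    define k where "k = x * w - y * z"
    assume *: "\<bar>2 + 3 * (x + w)\<bar> < 2"
    have "x + w = - 3 * k" using xw by (simp add: k_def)
    then have "\<bar>2 - 9 * k\<bar> < 2" using * by simp
    then show False by presburger
  qed
  moreover have "1 + 3 * x \<noteq> - 1" by presburger
  ultimately show ?thesis using t by (auto simp: algebra_simps)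
qed

fun red3 :: "m2 \<Rightarrow> int \<times> int \<times> int \<times> int" where
  "red3 (M2 p q r s) = (p mod 3, q mod 3, r mod 3, s mod 3)"

lemma red3_eq:
  assumes "A \<in> Gam" "red3 A = red3 B"
  obtains x y z w where "minv A * B = M2 (1 + 3 * x) (3 * y) (3 * z) (1 + 3 * w)"
proof -
  obtain p q r s where A: "A = M2 p q r s" by (cases A)
  obtain p' q' r' s' where B: "B = M2 p' q' r' s'" by (cases B)
  have dv: "3 dvd p' - p" "3 dvd q' - q" "3 dvd r' - r" "3 dvd s' - s"
    using assms(2) by (simp_all add: A B mod_eq_dvd_iff dvd_diff_commute)
  then obtain a b c d where e: "p' = p + 3 * a" "q' = q + 3 * b" "r' = r + 3 * c" "s' = s + 3 * d"
    by (auto simp: dvd_def algebra_simps)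
  define D where "D = p * s - q * r"
  have "D * D = 1" using Gam_det[OF assms(1)] by (auto simp: A D_def[symmetric])
  moreover have "minv A * B = M2 (D * D + 3 * (D * (s * a - q * c))) (3 * (D * (s * b - q * d)))
      (3 * (D * (p * c - r * a))) (D * D + 3 * (D * (p * d - r * b)))"
    by (simp add: A B e Let_def D_def algebra_simps)
  ultimately show ?thesis using that by metis
qed

text \<open>Minkowski's argument: reduction modulo 3 is injective, since no elliptic matrix but the
  identity is congruent to it.\<close>

lemma elliptic_finite:
  assumes X: "admissible X" and ell: "\<And>A. A \<in> X \<Longrightarrow> elliptic A"
  shows "finite X"
proof (rule finite_imageD)
  have "red3 ` X \<subseteq> {0..2} \<times> {0..2} \<times> {0..2} \<times> {0..2}"
  proof
    fix v assume "v \<in> red3 ` X"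
    then obtain p q r s where "v = (p mod 3, q mod 3, r mod 3, s mod 3)" by (metis imageE red3.simps m2.exhaust)
    moreover have "n mod 3 \<le> 2" for n :: int by presburger
    ultimately show "v \<in> {0..2} \<times> {0..2} \<times> {0..2} \<times> {0..2 :: int}" by simp
  qed
  then show "finite (red3 ` X)" by (rule finite_subset) simp
  show "inj_on red3 X"
  proof (rule inj_onI)
    fix A B assume AB: "A \<in> X" "B \<in> X" "red3 A = red3 B"
    have G: "A \<in> Gam" by (rule admissibleD(1)[OF X AB(1)])
    obtain x y z w where e: "minv A * B = M2 (1 + 3 * x) (3 * y) (3 * z) (1 + 3 * w)"
      by (rule red3_eq[OF G AB(3)])
    have "minv A * B \<in> X" by (intro admissibleD(3,4)[OF X] AB)
    then have "minv A * B = 1" using elliptic_mod_3 ell unfolding e by blast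
    then have "A * minv A * B = A" by (simp add: mult.assoc)
    then show "A = B" using Gam_minv_mult(2)[OF G] by simp
  qed
qed

section \<open>Invariant binary quadratic forms and their reduction\<close>

fun act :: "m2 \<Rightarrow> int \<times> int \<Rightarrow> int \<times> int" where
  "act (M2 p q r s) (x, y) = (p * x + q * y, r * x + s * y)"

lemma act_mult: "act (A * B) v = act A (act B v)"
  by (cases A; cases B; cases v) (simp add: algebra_simps)

lemma act_1: "act 1 v = v"
  by (cases v) (simp add: one_m2_def)

fun qf :: "int \<Rightarrow> int \<Rightarrow> int \<Rightarrow> int \<times> int \<Rightarrow> int" where
  "qf \<alpha> \<beta> \<gamma> (x, y) = \<alpha> * (x * x) + 2 * \<beta> * (x * y) + \<gamma> * (y * y)"

lemma sum_qf: "finite X \<Longrightarrow> (\<Sum>A\<in>X. qf (a A) (b A) (c A) v) = qf (sum a X) (sum b X) (sum c X) v"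
  by (induction X rule: finite_induct; cases v) (simp_all add: algebra_simps)

lemma norm_act:
  "\<exists>a b c. \<forall>A v. qf 1 0 1 (act A v) = qf (a A) (b A) (c A) v"
proof -
  have "qf 1 0 1 (act A v) = qf (case A of M2 p q r s \<Rightarrow> p * p + r * r)
    (case A of M2 p q r s \<Rightarrow> p * q + r * s) (case A of M2 p q r s \<Rightarrow> q * q + s * s) v" for A v
    by (cases A; cases v) (simp add: algebra_simps)
  then show ?thesis by blast
qed

definition invariant_form :: "m2 set \<Rightarrow> int \<Rightarrow> int \<Rightarrow> int \<Rightarrow> bool" where
  "invariant_form X \<alpha> \<beta> \<gamma> \<longleftrightarrow> (\<forall>v. v \<noteq> (0, 0) \<longrightarrow> qf \<alpha> \<beta> \<gamma> v > 0) \<and>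
     (\<forall>A\<in>X. \<forall>v. qf \<alpha> \<beta> \<gamma> (act A v) = qf \<alpha> \<beta> \<gamma> v)"

text \<open>The sum of the translates of the standard form over the finite group; the translate by 1
  makes it positive.\<close>

lemma invariant_form_exists:
  assumes X: "admissible X" "finite X"
  obtains \<alpha> \<beta> \<gamma> where "invariant_form X \<alpha> \<beta> \<gamma>"
proof -
  obtain a b c where abc: "\<And>A v. qf 1 0 1 (act A v) = qf (a A) (b A) (c A) v" using norm_act by metis
  let ?Q = "\<lambda>v. \<Sum>A\<in>X. qf 1 0 1 (act A v)"
  have Q: "?Q v = qf (sum a X) (sum b X) (sum c X) v" for v
    unfolding abc by (rule sum_qf[OF X(2)])
  have nn: "qf 1 0 1 u \<ge> 0" for u by (cases u) simp
  have "?Q v > 0" if "v \<noteq> (0, 0)" for v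
  proof (rule sum_pos2[OF X(2)])
    show "1 \<in> X" by (rule admissibleD(2)[OF X(1)])
    obtain x y where v: "v = (x, y)" by (cases v)
    have "x * x + y * y > 0" using that by (auto simp: v sum_squares_gt_zero_iff)
    then show "0 < qf 1 0 1 (act 1 v)" by (simp add: act_1 v)
  qed (rule nn)
  moreover have "?Q (act B v) = ?Q v" if B: "B \<in> X" for B v
  proof -
    have G: "B \<in> Gam" by (rule admissibleD(1)[OF X(1) B])
    have "bij_betw (\<lambda>A. A * B) X X"
    proof (rule bij_betw_byWitness[where f' = "\<lambda>A. A * minv B"])
      show "\<forall>A\<in>X. A * B * minv B = A" "\<forall>A\<in>X. A * minv B * B = A"
        using Gam_minv_mult[OF G] by (simp_all add: mult.assoc)
      show "(\<lambda>A. A * B) ` X \<subseteq> X" "(\<lambda>A. A * minv B) ` X \<subseteq> X"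
        using admissibleD(3,4)[OF X(1)] B by blast+
    qed
    then have "(\<Sum>A\<in>X. qf 1 0 1 (act (A * B) v)) = ?Q v"
      by (rule sum.reindex_bij_betw)
    then show ?thesis by (simp add: act_mult)
  qed
  ultimately have "invariant_form X (sum a X) (sum b X) (sum c X)"
    unfolding invariant_form_def Q by blast
  then show ?thesis by (rule that)
qed

lemma invariant_form_cm:
  assumes f: "invariant_form X \<alpha> \<beta> \<gamma>" and B: "B \<in> Gam"
    and e: "\<And>v. qf \<alpha> \<beta> \<gamma> (act (minv B) v) = qf \<alpha>' \<beta>' \<gamma>' v"
  shows "invariant_form (cm B ` X) \<alpha>' \<beta>' \<gamma>'"
  unfolding invariant_form_def
proof (intro conjI allI impI ballI)
  fix v :: "int \<times> int" assume v: "v \<noteq> (0, 0)"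
  have "act (minv B) v \<noteq> (0, 0)"
  proof
    assume z: "act (minv B) v = (0, 0)"
    have "v = act B (act (minv B) v)" using Gam_minv_mult(2)[OF B] by (simp add: act_1 flip: act_mult)
    also have "\<dots> = (0, 0)" unfolding z by (cases B) simp
    finally show False using v by simp
  qed
  then have "0 < qf \<alpha> \<beta> \<gamma> (act (minv B) v)" using f unfolding invariant_form_def by blast
  then show "0 < qf \<alpha>' \<beta>' \<gamma>' v" by (simp only: e)
next
  fix C v assume "C \<in> cm B ` X"
  then obtain A where A: "A \<in> X" "C = B * A * minv B" by (auto simp: cm_def)
  have "minv B * C = minv B * B * A * minv B" by (simp only: A(2) mult.assoc)
  then have "minv B * C = A * minv B" using Gam_minv_mult(1)[OF B] by simp
  then have ac: "act (minv B) (act C v) = act A (act (minv B) v)" by (simp only: act_mult[symmetric])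
  have "qf \<alpha> \<beta> \<gamma> (act A (act (minv B) v)) = qf \<alpha> \<beta> \<gamma> (act (minv B) v)"
    using f A(1) unfolding invariant_form_def by blast
  then show "qf \<alpha>' \<beta>' \<gamma>' (act C v) = qf \<alpha>' \<beta>' \<gamma>' v" by (simp only: e ac[symmetric])
qed

text \<open>Completing the square bounds three times each square by 4.\<close>

lemma abs_le_1_if_square_bound:
  fixes x y :: int
  assumes "x * x - \<bar>x\<bar> * \<bar>y\<bar> + y * y \<le> 1"
  shows "\<bar>x\<bar> \<le> 1 \<and> \<bar>y\<bar> \<le> 1"
proof -
  define a b where "a = \<bar>x\<bar>" and "b = \<bar>y\<bar>"
  have ab: "a \<ge> 0" "b \<ge> 0" "a * a - a * b + b * b \<le> 1"
    using assms by (simp_all add: a_def b_def)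
  have "3 * (a * a) \<le> 4"
  proof -
    have "(2 * b - a) * (2 * b - a) \<ge> 0" by simp
    then have "3 * (a * a) \<le> 4 * (a * a - a * b + b * b)" by (simp add: algebra_simps)
    also have "\<dots> \<le> 4 * 1" by (rule mult_left_mono[OF ab(3)]) simp
    finally show ?thesis by simp
  qed
  moreover have "3 * (b * b) \<le> 4"
  proof -
    have "(2 * a - b) * (2 * a - b) \<ge> 0" by simp
    then have "3 * (b * b) \<le> 4 * (a * a - a * b + b * b)" by (simp add: algebra_simps)
    also have "\<dots> \<le> 4 * 1" by (rule mult_left_mono[OF ab(3)]) simp
    finally show ?thesis by simp
  qed
  moreover have "n \<le> 1" if "n \<ge> 0" "3 * (n * n) \<le> 4" for n :: int
  proof (rule ccontr)
    assume "\<not> n \<le> 1"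
    then have "2 * 2 \<le> n * n" by (intro mult_mono) auto
    then show False using that(2) by simp
  qed
  ultimately show ?thesis using ab(1,2) by (simp add: a_def b_def)
qed

text \<open>The columns of an automorph take the values \<open>\<alpha>\<close> and
  \<open>\<gamma>\<close> of the form. As the middle term is at most \<open>\<alpha>\<close> times
  the product of the absolute values, vectors with such small values have small entries.\<close>

lemma reduced_form_box:
  fixes \<alpha> \<beta> \<gamma> p q r s :: int
  assumes f: "0 < \<alpha>" "\<alpha> \<le> \<gamma>" "\<bar>2 * \<beta>\<bar> \<le> \<alpha>"
    and 1: "\<alpha> * (p * p) + 2 * \<beta> * (p * r) + \<gamma> * (r * r) = \<alpha>"
    and 2: "\<alpha> * (q * q) + 2 * \<beta> * (q * s) + \<gamma> * (s * s) = \<gamma>"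
    and d: "p * s - q * r = 1 \<or> p * s - q * r = - 1"
  shows "\<bar>p\<bar> \<le> 1 \<and> \<bar>q\<bar> \<le> 1 \<and> \<bar>r\<bar> \<le> 1 \<and> \<bar>s\<bar> \<le> 1"
proof -
  have cross: "2 * \<beta> * (x * y) \<ge> - (\<alpha> * (\<bar>x\<bar> * \<bar>y\<bar>))" for x y
  proof -
    have "\<bar>2 * \<beta> * (x * y)\<bar> = \<bar>2 * \<beta>\<bar> * (\<bar>x\<bar> * \<bar>y\<bar>)" by (simp add: abs_mult)
    also have "\<dots> \<le> \<alpha> * (\<bar>x\<bar> * \<bar>y\<bar>)" by (rule mult_right_mono[OF f(3)]) simp
    finally show ?thesis by linarith
  qed
  have "\<alpha> * (r * r) \<le> \<gamma> * (r * r)" by (rule mult_right_mono[OF f(2)]) simp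
  then have "\<alpha> * (p * p) - \<alpha> * (\<bar>p\<bar> * \<bar>r\<bar>) + \<alpha> * (r * r) \<le> \<alpha>"
    using 1 cross[of p r] by linarith
  then have "\<alpha> * (p * p - \<bar>p\<bar> * \<bar>r\<bar> + r * r) \<le> \<alpha> * 1" by (simp add: algebra_simps)
  then have "p * p - \<bar>p\<bar> * \<bar>r\<bar> + r * r \<le> 1" using f(1) by (simp only: mult_le_cancel_left_pos)
  then have pr: "\<bar>p\<bar> \<le> 1 \<and> \<bar>r\<bar> \<le> 1" by (rule abs_le_1_if_square_bound)
  have c2: "\<alpha> * (q * q) - \<alpha> * (\<bar>q\<bar> * \<bar>s\<bar>) + \<gamma> * (s * s) \<le> \<gamma>"
    using 2 cross[of q s] by linarith
  have s: "\<bar>s\<bar> \<le> 1"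
  proof (rule ccontr)
    assume "\<not> \<bar>s\<bar> \<le> 1"
    then have "2 * 2 \<le> \<bar>s\<bar> * \<bar>s\<bar>" by (intro mult_mono) auto
    then have s4: "s * s \<ge> 4" by (simp add: abs_mult[symmetric])
    have "\<alpha> * ((2 * \<bar>q\<bar> - \<bar>s\<bar>) * (2 * \<bar>q\<bar> - \<bar>s\<bar>)) \<ge> 0" using f(1) by simp
    then have "4 * (\<alpha> * (q * q)) - 4 * (\<alpha> * (\<bar>q\<bar> * \<bar>s\<bar>)) + \<alpha> * (s * s) \<ge> 0"
      by (simp add: algebra_simps)
    moreover have "\<alpha> * (s * s) \<le> \<gamma> * (s * s)" by (rule mult_right_mono[OF f(2)]) simp
    ultimately have "3 * (\<gamma> * (s * s)) \<le> 4 * \<gamma>" using c2 by linarith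
    moreover have "\<gamma> * 4 \<le> \<gamma> * (s * s)" by (rule mult_left_mono[OF s4]) (use f in linarith)
    ultimately show False using f(1,2) by linarith
  qed
  have q: "\<bar>q\<bar> \<le> 1"
  \<comment> \<open>For \<open>s = 0\<close> the value \<open>\<gamma>\<close> gives no bound on
    \<open>q\<close>, since \<open>\<alpha>\<close> may be much smaller; here the determinant
    decides.\<close>
  proof (cases "s = 0")
    case True
    then have "q * r = 1 \<or> q * (- r) = 1" using d by auto
    then show ?thesis using zmult_eq_1_iff[of q r] zmult_eq_1_iff[of q "- r"] by auto
  next
    case False
    then have "\<bar>s\<bar> = 1" using s by linarith
    then have ss: "s * s = 1" by (metis abs_mult_self_eq mult_1)
    have "\<alpha> * (q * q) \<le> \<alpha> * \<bar>q\<bar>" using c2 ss \<open>\<bar>s\<bar> = 1\<close> by simp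
    then have "\<bar>q\<bar> * \<bar>q\<bar> \<le> \<bar>q\<bar>" using f(1) by (simp add: abs_mult[symmetric])
    show ?thesis
    proof (rule ccontr)
      assume n: "\<not> \<bar>q\<bar> \<le> 1"
      then have "\<bar>q\<bar> * 1 < \<bar>q\<bar> * \<bar>q\<bar>" by (intro mult_strict_left_mono) auto
      then show False using \<open>\<bar>q\<bar> * \<bar>q\<bar> \<le> \<bar>q\<bar>\<close> by simp
    qed
  qed
  show ?thesis using pr q s by blast
qed

text \<open>A conjugate and an invariant form of it are chosen together so that
  \<open>\<alpha> + \<gamma>\<close> is minimal. Elementary substitutions then yield no smaller sum,
  which says that the form is reduced.\<close>

lemma classify_elliptic:
  assumes X: "admissible X" and ell: "\<And>A. A \<in> X \<Longrightarrow> elliptic A"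
  shows "\<exists>B\<in>Gam. cm B ` X \<subseteq> box"
proof -
  have fin: "finite X" by (rule elliptic_finite[OF X ell])
  define T where "T t \<longleftrightarrow> (case t of (B, \<alpha>, \<beta>, \<gamma>) \<Rightarrow> B \<in> Gam \<and> invariant_form (cm B ` X) \<alpha> \<beta> \<gamma>)" for t
  define \<mu> where "\<mu> t = (case t of (B :: m2, \<alpha>, \<beta> :: int, \<gamma>) \<Rightarrow> nat (\<alpha> + \<gamma>))" for t
  obtain \<alpha>0 \<beta>0 \<gamma>0 where "invariant_form X \<alpha>0 \<beta>0 \<gamma>0" by (rule invariant_form_exists[OF X fin])
  then have "T (1, \<alpha>0, \<beta>0, \<gamma>0)" using Gam_one by (simp add: T_def image_def)
  then obtain t where t: "T t" "\<And>u. T u \<Longrightarrow> \<mu> t \<le> \<mu> u"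
    using ex_has_least_nat[of T "(1, \<alpha>0, \<beta>0, \<gamma>0)" \<mu>] by blast
  obtain B \<alpha> \<beta> \<gamma> where tt: "t = (B, \<alpha>, \<beta>, \<gamma>)" by (cases t) auto
  have B: "B \<in> Gam" and form: "invariant_form (cm B ` X) \<alpha> \<beta> \<gamma>" using t(1) by (simp_all add: tt T_def)
  have pos: "qf \<alpha> \<beta> \<gamma> v > 0" if "v \<noteq> (0, 0)" for v using form that unfolding invariant_form_def by blast
  have ag: "\<alpha> > 0" "\<gamma> > 0" using pos[of "(1, 0)"] pos[of "(0, 1)"] by simp_all
  have step: "\<alpha> + \<gamma> \<le> \<alpha>' + \<gamma>'" if C: "C \<in> Gam"
      "\<And>v. qf \<alpha> \<beta> \<gamma> (act (minv C) v) = qf \<alpha>' \<beta>' \<gamma>' v" for C \<alpha>' \<beta>' \<gamma>'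
  proof -
    have i: "invariant_form (cm C ` cm B ` X) \<alpha>' \<beta>' \<gamma>'" by (rule invariant_form_cm[OF form C])
    have "cm C ` cm B ` X = cm (C * B) ` X" by (simp add: image_image cm_cm[OF C(1) B])
    then have "T (C * B, \<alpha>', \<beta>', \<gamma>')" using i Gam_mult[OF C(1) B] by (simp add: T_def)
    from t(2)[OF this] have "nat (\<alpha> + \<gamma>) \<le> nat (\<alpha>' + \<gamma>')" by (simp add: tt \<mu>_def)
    then show ?thesis using ag by linarith
  qed
  \<comment> \<open>The form after the substitution of \<open>(x, y - x)\<close>; the witness
    \<open>\<beta> - \<gamma>\<close> is its middle coefficient.\<close>
  have "\<alpha> + \<gamma> \<le> (\<alpha> - 2 * \<beta> + \<gamma>) + \<gamma>"
    by (rule step[OF Gam_lower, of _ "\<beta> - \<gamma>"]) (auto simp: algebra_simps)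
  moreover have "\<alpha> + \<gamma> \<le> (\<alpha> + 2 * \<beta> + \<gamma>) + \<gamma>"
    by (rule step[OF Gam_lower', of _ "\<beta> + \<gamma>"]) (auto simp: algebra_simps)
  ultimately have bg: "\<bar>2 * \<beta>\<bar> \<le> \<gamma>" by linarith
  have "\<alpha> + \<gamma> \<le> \<alpha> + (\<alpha> - 2 * \<beta> + \<gamma>)"
    by (rule step[OF Gam_upper, of _ "\<beta> - \<alpha>"]) (auto simp: algebra_simps)
  moreover have "\<alpha> + \<gamma> \<le> \<alpha> + (\<alpha> + 2 * \<beta> + \<gamma>)"
    by (rule step[OF Gam_upper', of _ "\<beta> + \<alpha>"]) (auto simp: algebra_simps)
  ultimately have ba: "\<bar>2 * \<beta>\<bar> \<le> \<alpha>" by linarith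
  have "A \<in> box" if A: "A \<in> cm B ` X" for A
  proof -
    obtain p q r s where pqrs: "A = M2 p q r s" by (cases A)
    have inv: "qf \<alpha> \<beta> \<gamma> (act A v) = qf \<alpha> \<beta> \<gamma> v" for v using form A unfolding invariant_form_def by blast
    have 1: "\<alpha> * (p * p) + 2 * \<beta> * (p * r) + \<gamma> * (r * r) = \<alpha>" using inv[of "(1, 0)"] by (simp add: pqrs)
    have 2: "\<alpha> * (q * q) + 2 * \<beta> * (q * s) + \<gamma> * (s * s) = \<gamma>" using inv[of "(0, 1)"] by (simp add: pqrs)
    obtain A0 where A0: "A0 \<in> X" "A = cm B A0" using A by blast
    have "det A0 = 1 \<or> det A0 = - 1" by (rule Gam_det[OF admissibleD(1)[OF X A0(1)]])
    then have d: "p * s - q * r = 1 \<or> p * s - q * r = - 1" using det_cm[OF B, of A0] by (simp add: A0(2)[symmetric] pqrs)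
    have "\<bar>p\<bar> \<le> 1 \<and> \<bar>q\<bar> \<le> 1 \<and> \<bar>r\<bar> \<le> 1 \<and> \<bar>s\<bar> \<le> 1"
    proof (cases "\<alpha> \<le> \<gamma>")
      case True
      then show ?thesis using reduced_form_box[OF ag(1) _ ba 1 2 d] by blast
    next
      case False
      \<comment> \<open>Exchanging the two coordinates reduces this to the case already
        treated.\<close>
      have "\<gamma> * (s * s) + 2 * \<beta> * (s * q) + \<alpha> * (q * q) = \<gamma>" using 2 by (simp add: algebra_simps)
      moreover have "\<gamma> * (r * r) + 2 * \<beta> * (r * p) + \<alpha> * (p * p) = \<alpha>" using 1 by (simp add: algebra_simps)
      moreover have "s * p - r * q = 1 \<or> s * p - r * q = - 1" using d by (simp add: algebra_simps)
      ultimately show ?thesis using reduced_form_box[OF ag(2) _ bg, of \<alpha> s q r p] False by auto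
    qed
    then have "p \<in> {- 1..1}" "q \<in> {- 1..1}" "r \<in> {- 1..1}" "s \<in> {- 1..1}" by auto
    then show ?thesis unfolding pqrs box_def by (intro image_eqI[of _ _ "(p, q, r, s)"]) auto
  qed
  then show ?thesis using B by blast
qed

text \<open>Squaring turns trace -2 into trace 2. The square is not 1, because a matrix of
  determinant 1 that is its own inverse is 1 or -1 times the identity.\<close>

lemma non_elliptic_square:
  assumes "det A = 1" "\<not> elliptic A" "\<bar>tr A\<bar> \<le> 2"
  shows "det (A * A) = 1" "tr (A * A) = 2" "A * A \<noteq> 1"
proof -
  have "\<bar>tr A\<bar> = 2" using assms by (auto simp: elliptic_def)
  then have "tr A = 2 \<or> tr A = - 2" by linarith
  then have "tr A * tr A = 4" by auto
  then show "tr (A * A) = 2" using tr_square[of A] assms(1) by simp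
  show "det (A * A) = 1" using assms(1) by simp
  show "A * A \<noteq> 1"
  proof
    assume "A * A = 1"
    then have m: "minv A = A" using minv_eqI[of A A] assms(1) by blast
    obtain p q r s where A: "A = M2 p q r s" by (cases A)
    have d: "p * s - q * r = 1" using assms(1) by (simp add: A)
    have mv: "minv A = M2 (1 * s) (- 1 * q) (- 1 * r) (1 * p)"
      unfolding A minv.simps Let_def d by simp
    have "M2 p q r s = M2 (1 * s) (- 1 * q) (- 1 * r) (1 * p)"
      by (rule trans[OF A[symmetric] trans[OF m[symmetric] mv]])
    then have "p = 1 * s \<and> q = - 1 * q \<and> r = - 1 * r \<and> s = 1 * p" unfolding m2.inject .
    then have e: "s = p" "q = 0" "r = 0" by linarith+
    then have "p * p = 1" using d by simp
    then have "p = 1 \<or> p = - 1" using zmult_eq_1_iff[of p p] by auto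
    then show False using e assms(1,2) by (auto simp: A elliptic_def one_m2_def)
  qed
qed

theorem MM_classification: "\<exists>B\<in>Gam. cm B ` MM \<H> \<in> fam"
proof -
  let ?X = "MM \<H>"
  have X: "admissible ?X" by (rule admissible_MM)
  have G: "A \<in> Gam" if "A \<in> ?X" for A using MM_Gam that by blast
  have sq: "A * A \<in> ?X" if "A \<in> ?X" for A using MM_mult that by blast
  have adm: "admissible (cm B ` ?X)" if "B \<in> Gam" for B
    using cm_MM[OF that, of \<H>] admissible_MM by metis
  show ?thesis
  proof (cases "\<exists>A\<in>?X. det A = 1 \<and> \<bar>tr A\<bar> > 2 \<or> det A = - 1 \<and> tr A \<noteq> 0")
    case True
    then obtain A where A: "A \<in> ?X" "det A = 1 \<and> \<bar>tr A\<bar> > 2 \<or> det A = - 1 \<and> tr A \<noteq> 0" by blast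
    \<comment> \<open>The trace of the square is the square of the trace minus twice the
      determinant: at least 7 for determinant 1, and at least 3 for determinant -1.\<close>
    have "tr (A * A) > 2"
    proof (cases "det A = 1")
      case True
      then have "3 * 3 \<le> \<bar>tr A\<bar> * \<bar>tr A\<bar>" using A(2) by (intro mult_mono) auto
      then show ?thesis using True by (simp add: tr_square)
    next
      case False
      then have d: "det A = - 1" "tr A \<noteq> 0" using A(2) by simp_all
      then have "1 * 1 \<le> \<bar>tr A\<bar> * \<bar>tr A\<bar>" by (intro mult_mono) auto
      then show ?thesis using d by (simp add: tr_square)
    qed
    moreover have "det (A * A) = 1" using A(2) by auto
    ultimately obtain B ws where B: "B \<in> Gam" "cm B (A * A) = mat (stw ws)" "True \<in> set ws" "False \<in> set ws"
      using hyperbolic_conjugate[OF G[OF sq[OF A(1)]]] by metis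
    have "mat (stw ws) \<in> cm B ` ?X" using sq[OF A(1)] by (simp flip: B(2))
    then have "{A \<in> Gam. det A = 1} \<subseteq> cm B ` ?X"
      by (rule admissibleD(6)[OF adm[OF B(1)] B(3,4)])
    then show ?thesis using classify_hyperbolic[OF adm[OF B(1)]] B(1) by blast
  next
    case False
    then have nh: "(det A = 1 \<longrightarrow> \<bar>tr A\<bar> \<le> 2) \<and> (det A = - 1 \<longrightarrow> tr A = 0)" if "A \<in> ?X" for A
      using that by force
    show ?thesis
    proof (cases "\<forall>A\<in>?X. elliptic A")
      case True
      then obtain B where "B \<in> Gam" "cm B ` ?X \<subseteq> box" using classify_elliptic[OF X] by blast
      then show ?thesis by (auto simp: fam_def)
    next
      case False
      then obtain A where A: "A \<in> ?X" "\<not> elliptic A" by blast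
      have d: "det A = 1" using A nh[OF A(1)] Gam_det[OF G[OF A(1)]] by (auto simp: elliptic_def)
      note s = non_elliptic_square[OF d A(2)]
      have "\<bar>tr A\<bar> \<le> 2" using nh[OF A(1)] d by simp
      then obtain B n where B: "B \<in> Gam" "cm B (A * A) = M2 1 0 n 1" "n \<noteq> 0"
        using parabolic_conjugate[OF G[OF sq[OF A(1)]]] s by metis
      have "M2 1 0 n 1 \<in> cm B ` ?X" using sq[OF A(1)] by (simp flip: B(2))
      moreover have "(det C = 1 \<longrightarrow> \<bar>tr C\<bar> \<le> 2) \<and> (det C = - 1 \<longrightarrow> tr C = 0)" if "C \<in> cm B ` ?X" for C
        using that nh by (auto simp: det_cm[OF B(1)] tr_cm[OF B(1)])
      ultimately show ?thesis using classify_parabolic[OF adm[OF B(1)] _ B(3)] B(1) by blast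
    qed
  qed
qed

section \<open>Transport to an abstract free group\<close>

context group
begin

lemma conj_set_eq: "k <# M #> inv k = (\<lambda>m. k \<otimes> m \<otimes> inv k) ` M"
  by (auto simp: l_coset_def r_coset_def)

lemma subgroup_conj_class_conj:
  assumes M: "M \<subseteq> carrier G" and k: "k \<in> carrier G"
  shows "subgroup_conj_class G (k <# M #> inv k) = subgroup_conj_class G M"
proof -
  have c: "h <# (k <# M #> inv k) #> inv h = (h \<otimes> k) <# M #> inv (h \<otimes> k)" if h: "h \<in> carrier G" for h
  proof -
    have "h \<otimes> (k \<otimes> m \<otimes> inv k) \<otimes> inv h = h \<otimes> k \<otimes> m \<otimes> inv (h \<otimes> k)" if "m \<in> M" for m
      using h k M that by (simp add: m_assoc inv_mult_group subset_iff)
    then show ?thesis unfolding conj_set_eq image_image by (rule image_cong[OF refl])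
  qed
  show ?thesis
  proof (intro equalityI subsetI)
    fix Y assume "Y \<in> subgroup_conj_class G (k <# M #> inv k)"
    then obtain h where h: "h \<in> carrier G" "Y = h <# (k <# M #> inv k) #> inv h"
      unfolding subgroup_conj_class_def by blast
    then have "Y = (h \<otimes> k) <# M #> inv (h \<otimes> k)" "h \<otimes> k \<in> carrier G" using c k by simp_all
    then show "Y \<in> subgroup_conj_class G M" unfolding subgroup_conj_class_def by blast
  next
    fix Y assume "Y \<in> subgroup_conj_class G M"
    then obtain h where h: "h \<in> carrier G" "Y = h <# M #> inv h"
      unfolding subgroup_conj_class_def by blast
    have "h \<otimes> inv k \<otimes> k = h" using h(1) k by (simp add: m_assoc)
    then have "Y = (h \<otimes> inv k) <# (k <# M #> inv k) #> inv (h \<otimes> inv k)" using c[of "h \<otimes> inv k"] h k by simp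
    moreover have "h \<otimes> inv k \<in> carrier G" using h(1) k by simp
    ultimately show "Y \<in> subgroup_conj_class G (k <# M #> inv k)"
      unfolding subgroup_conj_class_def by blast
  qed
qed

definition Out_class :: "('a \<Rightarrow> 'a) \<Rightarrow> ('a \<Rightarrow> 'a) set" where
  "Out_class \<phi> = inner_auto G #>\<^bsub>AutoGroup G\<^esub> \<phi>"

lemma Out_class_hom: "group_hom (AutoGroup G) (Out G) Out_class"
proof -
  interpret A: group "AutoGroup G" by (rule AutoGroup)
  interpret N: normal "inner_auto G" "AutoGroup G" by (rule inner_auto_normal)
  interpret O: group "Out G" by (rule group_Out)
  show ?thesis unfolding Out_class_def
    by unfold_locales (simp add: Out_def N.r_coset_hom_Mod)
qed

lemma Mc_eq:
  assumes "\<Union> \<H> \<subseteq> carrier G"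
  shows "Mc G \<H> = Out_class ` {\<phi> \<in> auto G. auto_acts_trivially G \<H> \<phi>}"
proof -
  interpret A: group "AutoGroup G" by (rule AutoGroup)
  interpret N: normal "inner_auto G" "AutoGroup G" by (rule inner_auto_normal)
  interpret q: group_hom "AutoGroup G" "Out G" Out_class by (rule Out_class_hom)
  have self: "\<phi> \<in> Out_class \<phi>" if "\<phi> \<in> auto G" for \<phi>
    unfolding Out_class_def using A.rcos_self[OF _ N.subgroup_axioms] that by (simp add: carrier_AutoGroup)
  have cl: "Out_class \<phi> \<in> carrier (Out G)" if "\<phi> \<in> auto G" for \<phi>
    by (rule q.hom_closed) (simp add: carrier_AutoGroup that)
  show ?thesis
  proof (intro equalityI subsetI)
    fix \<Phi> assume "\<Phi> \<in> Mc G \<H>"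
    then obtain \<phi> where \<phi>: "\<Phi> \<in> carrier (Out G)" "\<phi> \<in> \<Phi>" "auto_acts_trivially G \<H> \<phi>"
      by (auto simp: Mc_def)
    obtain \<psi> where \<psi>: "\<psi> \<in> auto G" "\<Phi> = Out_class \<psi>"
      using Out_memE[OF \<phi>(1)] unfolding Out_class_def by metis
    have "\<psi> \<in> \<Phi>" using self[OF \<psi>(1)] by (simp only: \<psi>(2))
    from auto_acts_trivially_coset[OF \<phi>(1,2) this assms \<phi>(3)]
    show "\<Phi> \<in> Out_class ` {\<phi> \<in> auto G. auto_acts_trivially G \<H> \<phi>}" using \<psi> by blast
  next
    fix \<Phi> assume "\<Phi> \<in> Out_class ` {\<phi> \<in> auto G. auto_acts_trivially G \<H> \<phi>}"
    then obtain \<phi> where "\<phi> \<in> auto G" "auto_acts_trivially G \<H> \<phi>" "\<Phi> = Out_class \<phi>" by blast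
    then show "\<Phi> \<in> Mc G \<H>" using self cl unfolding Mc_def by blast
  qed
qed

end

section \<open>Identification of a free group of rank 2 with \<open>f2\<close>\<close>

locale free_group_2 = group G for G (structure) +
  fixes e :: "bool \<Rightarrow> 'a"
  assumes inj_e: "inj e" and basis: "free_basis G (range e)"
begin

lemma e_closed [simp]: "e g \<in> carrier G"
  using basis by (auto simp: free_basis_def)

definition lv :: "bool letter \<Rightarrow> 'a" where
  "lv l = (if fst l then e (snd l) else inv (e (snd l)))"

definition ev :: "bool letter list \<Rightarrow> 'a" where
  "ev w = word_val G (map (map_prod id e) w)"

lemma lv_closed [simp]: "lv l \<in> carrier G" by (simp add: lv_def)

lemma ev_simps [simp]: "ev [] = \<one>" "ev (l # w) = lv l \<otimes> ev w"
  by (simp_all add: ev_def word_val_def letter_val_def lv_def)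

lemma ev_closed [simp]: "ev w \<in> carrier G" by (induction w) simp_all

lemma ev_lcons: "ev (lcons l w) = lv l \<otimes> ev w"
proof (cases "w \<noteq> [] \<and> hd w = linv l")
  case True
  then obtain v where v: "w = linv l # v" by (cases w) auto
  have "lv l \<otimes> (lv (linv l) \<otimes> ev v) = ev v" by (auto simp: lv_def inv_cancel)
  then show ?thesis by (simp add: v lcons_def)
qed (auto simp: lcons_def)

lemma ev_foldr_lcons: "ev (foldr lcons u v) = ev u \<otimes> ev v"
  by (induction u) (simp_all add: ev_lcons m_assoc)

definition \<theta> :: "f2 \<Rightarrow> 'a" where "\<theta> x = ev (rep x)"

lemma \<theta>_closed [simp]: "\<theta> x \<in> carrier G" by (simp add: \<theta>_def)

lemma \<theta>_plus: "\<theta> (x + y) = \<theta> x \<otimes> \<theta> y"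
  by (simp add: \<theta>_def plus_f2.rep_eq ev_foldr_lcons)

lemma \<theta>_bij: "bij_betw \<theta> UNIV (carrier G)"
proof -
  let ?m = "map (map_prod id e) :: bool letter list \<Rightarrow> 'a letter list"
  have red: "reduced_word (?m w) \<longleftrightarrow> reduced_word w" for w
    using inj_e by (induction w) (auto simp: reduced_word_Cons hd_map prod_eq_iff inj_eq reduced_word_def successively_Cons)
  have "inj (map_prod (id :: bool \<Rightarrow> bool) e)" using inj_e by (rule prod.inj_map[OF inj_on_id])
  then have "inj ?m" by (rule inj_mapI)
  moreover have "?m ` {w. reduced_word w} = reduced_words (range e)"
  proof (intro equalityI subsetI)
    fix w assume "w \<in> ?m ` {w. reduced_word w}"
    then show "w \<in> reduced_words (range e)" using red by (auto simp: reduced_words_def)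
  next
    fix w assume w: "w \<in> reduced_words (range e)"
    define v where "v = map (map_prod id (inv_into UNIV e)) w"
    have "map_prod id e (map_prod id (inv_into UNIV e) l) = l" if "l \<in> set w" for l
      using w that by (cases l) (auto simp: reduced_words_def f_inv_into_f)
    then have "?m v = w" by (simp add: v_def map_idI)
    moreover have "reduced_word w" using w by (simp add: reduced_words_def)
    ultimately show "w \<in> ?m ` {w. reduced_word w}" using red[of v] by (metis imageI mem_Collect_eq)
  qed
  ultimately have "bij_betw ?m {w. reduced_word w} (reduced_words (range e))"
    by (auto simp: bij_betw_def intro: inj_on_subset)
  moreover have "bij_betw rep UNIV {w. reduced_word w}"
    by (auto simp: bij_betw_def inj_on_def rep_inject image_def intro: exI[of _ "Abs_f2 _"])
       (metis Abs_f2_inverse mem_Collect_eq)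
  ultimately have "bij_betw (word_val G \<circ> (?m \<circ> rep)) UNIV (carrier G)"
    using basis bij_betw_trans unfolding free_basis_def by metis
  moreover have "word_val G \<circ> (?m \<circ> rep) = \<theta>" by (simp add: fun_eq_iff \<theta>_def ev_def)
  ultimately show ?thesis by simp
qed

definition \<iota> :: "'a \<Rightarrow> f2" where "\<iota> = inv_into UNIV \<theta>"

lemma \<iota>_\<theta> [simp]: "\<iota> (\<theta> x) = x"
  using \<theta>_bij by (simp add: \<iota>_def bij_betw_def)

lemma \<theta>_\<iota> [simp]: "x \<in> carrier G \<Longrightarrow> \<theta> (\<iota> x) = x"
  using \<theta>_bij by (simp add: \<iota>_def bij_betw_def f_inv_into_f)

lemma \<theta>_inject: "\<theta> x = \<theta> y \<longleftrightarrow> x = y"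
  by (metis \<iota>_\<theta>)

lemma \<theta>_zero: "\<theta> 0 = \<one>" by (simp add: \<theta>_def)

lemma \<theta>_uminus: "\<theta> (- x) = inv (\<theta> x)"
proof -
  have "\<theta> (- x) \<otimes> \<theta> x = \<one>" by (simp flip: \<theta>_plus \<theta>_zero)
  then show ?thesis by (simp add: inv_equality)
qed

lemma \<theta>_cj: "\<theta> (cj g x) = \<theta> g \<otimes> \<theta> x \<otimes> inv (\<theta> g)"
  unfolding cj_def diff_conv_add_uminus by (simp only: \<theta>_plus \<theta>_uminus)

definition pull :: "('a \<Rightarrow> 'a) \<Rightarrow> f2 \<Rightarrow> f2" where "pull \<phi> x = \<iota> (\<phi> (\<theta> x))"

definition push :: "(f2 \<Rightarrow> f2) \<Rightarrow> 'a \<Rightarrow> 'a" where "push f = (\<lambda>x\<in>carrier G. \<theta> (f (\<iota> x)))"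

lemma \<theta>_pull: "\<phi> \<in> auto G \<Longrightarrow> \<theta> (pull \<phi> x) = \<phi> (\<theta> x)"
  by (simp add: pull_def auto_closed)

lemma pull_compose: "\<phi> \<in> auto G \<Longrightarrow> \<psi> \<in> auto G \<Longrightarrow> pull (compose (carrier G) \<phi> \<psi>) = pull \<phi> \<circ> pull \<psi>"
  by (simp add: fun_eq_iff pull_def compose_def auto_closed)

lemma pull_mult: "\<phi> \<in> auto G \<Longrightarrow> \<psi> \<in> auto G \<Longrightarrow> pull (\<phi> \<otimes>\<^bsub>AutoGroup G\<^esub> \<psi>) = pull \<phi> \<circ> pull \<psi>"
  by (simp add: mult_AutoGroup pull_compose)

lemma aut_pull:
  assumes "\<phi> \<in> auto G"
  shows "aut (pull \<phi>)"
proof -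
  have "ghom (pull \<phi>)"
  proof (rule ghomI)
    fix x y
    have "\<theta> (pull \<phi> (x + y)) = \<theta> (pull \<phi> x + pull \<phi> y)"
      using assms by (simp add: \<theta>_pull \<theta>_plus auto_mult)
    then show "pull \<phi> (x + y) = pull \<phi> x + pull \<phi> y" by (simp only: \<theta>_inject)
  qed
  moreover have "bij (pull \<phi>)"
  proof -
    have "bij_betw \<phi> (carrier G) (carrier G)" using assms by (simp add: auto_def Bij_def)
    moreover have "bij_betw \<iota> (carrier G) UNIV" unfolding \<iota>_def by (rule bij_betw_inv_into[OF \<theta>_bij])
    ultimately have "bij_betw (\<iota> \<circ> (\<phi> \<circ> \<theta>)) UNIV UNIV"
      by (intro bij_betw_trans[OF bij_betw_trans[OF \<theta>_bij]])
    moreover have "\<iota> \<circ> (\<phi> \<circ> \<theta>) = pull \<phi>" by (simp add: fun_eq_iff pull_def)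
    ultimately show ?thesis by simp
  qed
  ultimately show ?thesis by (simp add: aut_def)
qed

lemma push_auto:
  assumes "aut f"
  shows "push f \<in> auto G"
proof -
  have f: "ghom f" "bij f" using assms by (simp_all add: aut_def)
  have "push f \<in> hom G G"
  proof (rule homI)
    fix x y assume xy: "x \<in> carrier G" "y \<in> carrier G"
    have "\<iota> (x \<otimes> y) = \<iota> x + \<iota> y"
    proof -
      have "\<theta> (\<iota> (x \<otimes> y)) = \<theta> (\<iota> x + \<iota> y)" using xy by (simp add: \<theta>_plus)
      then show ?thesis by (simp only: \<theta>_inject)
    qed
    then show "push f (x \<otimes> y) = push f x \<otimes> push f y"
      using xy by (simp add: push_def ghom_plus[OF f(1)] \<theta>_plus)
  qed (simp add: push_def)
  moreover have "bij_betw (push f) (carrier G) (carrier G)"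
  proof -
    have "bij_betw (\<theta> \<circ> (f \<circ> \<iota>)) (carrier G) (carrier G)"
      unfolding \<iota>_def using bij_betw_inv_into[OF \<theta>_bij] f(2) \<theta>_bij by (blast intro: bij_betw_trans)
    then show ?thesis by (rule bij_betw_cong[THEN iffD1, rotated]) (simp add: push_def)
  qed
  ultimately show ?thesis by (simp add: auto_def Bij_def push_def)
qed

lemma pull_push: "pull (push f) = f"
  by (simp add: fun_eq_iff pull_def push_def)

lemma auto_acts_trivially_iff:
  assumes \<phi>: "\<phi> \<in> auto G" and H: "\<Union> \<H> \<subseteq> carrier G"
  shows "auto_acts_trivially G \<H> \<phi> \<longleftrightarrow> pull \<phi> \<in> MT ((`) \<iota> ` \<H>)"
proof -
  have "(\<exists>g\<in>carrier G. \<forall>h\<in>K. \<phi> h = g \<otimes> h \<otimes> inv g) \<longleftrightarrow> (\<exists>g. \<forall>h\<in>\<iota> ` K. pull \<phi> h = cj g h)"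
    if K: "K \<subseteq> carrier G" for K
  proof
    assume "\<exists>g\<in>carrier G. \<forall>h\<in>K. \<phi> h = g \<otimes> h \<otimes> inv g"
    then obtain g where g: "g \<in> carrier G" "\<forall>h\<in>K. \<phi> h = g \<otimes> h \<otimes> inv g" by blast
    have "pull \<phi> (\<iota> h) = cj (\<iota> g) (\<iota> h)" if h: "h \<in> K" for h
    proof -
      have hc: "h \<in> carrier G" using h K by blast
      have "\<theta> (pull \<phi> (\<iota> h)) = \<theta> (cj (\<iota> g) (\<iota> h))" using g h hc \<phi> by (simp add: \<theta>_pull \<theta>_cj)
      then show ?thesis by (simp only: \<theta>_inject)
    qed
    then show "\<exists>g. \<forall>h\<in>\<iota> ` K. pull \<phi> h = cj g h" by blast
  next
    assume "\<exists>g. \<forall>h\<in>\<iota> ` K. pull \<phi> h = cj g h"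
    then obtain g where g: "\<forall>h\<in>\<iota> ` K. pull \<phi> h = cj g h" by blast
    have "\<phi> h = \<theta> g \<otimes> h \<otimes> inv (\<theta> g)" if h: "h \<in> K" for h
    proof -
      have hc: "h \<in> carrier G" using h K by blast
      have "\<theta> (pull \<phi> (\<iota> h)) = \<theta> (cj g (\<iota> h))" using g h by simp
      then show ?thesis using hc \<phi> by (simp add: \<theta>_pull \<theta>_cj)
    qed
    then show "\<exists>g\<in>carrier G. \<forall>h\<in>K. \<phi> h = g \<otimes> h \<otimes> inv g" by (intro bexI[of _ "\<theta> g"]) simp_all
  qed
  moreover have "\<And>K. K \<in> \<H> \<Longrightarrow> K \<subseteq> carrier G" using H by blast
  ultimately show ?thesis
    using aut_pull[OF \<phi>] by (simp add: auto_acts_trivially_def MT_def)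
qed

text \<open>Defined for arbitrary sets of matrices, so that the finite list \<open>fam\<close> can
  be transported to \<open>Out G\<close> as a whole.\<close>

definition OutM :: "m2 set \<Rightarrow> ('a \<Rightarrow> 'a) set set" where
  "OutM X = Out_class ` {\<phi> \<in> auto G. mat (pull \<phi>) \<in> X}"

lemma Mc_OutM: "\<Union> \<H> \<subseteq> carrier G \<Longrightarrow> Mc G \<H> = OutM (MM ((`) \<iota> ` \<H>))"
  using auto_acts_trivially_iff MM_iff[OF aut_pull] unfolding Mc_eq OutM_def by blast

text \<open>The conjugating matrix lifts to an automorphism, and the class of that automorphism is
  the conjugator in \<open>Out G\<close>.\<close>

lemma OutM_conj:
  assumes "B \<in> Gam"
  obtains k where "k \<in> carrier (Out G)"
    "k <#\<^bsub>Out G\<^esub> OutM X #>\<^bsub>Out G\<^esub> inv\<^bsub>Out G\<^esub> k = OutM (cm B ` X)"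
proof -
  interpret A: group "AutoGroup G" by (rule AutoGroup)
  interpret O: group "Out G" by (rule group_Out)
  interpret q: group_hom "AutoGroup G" "Out G" Out_class by (rule Out_class_hom)
  obtain f where f: "aut f" "B = mat f" using assms by (auto simp: Gam_def)
  define \<phi> where "\<phi> = push f"
  have \<phi>: "\<phi> \<in> carrier (AutoGroup G)" using push_auto[OF f(1)] by (simp add: \<phi>_def carrier_AutoGroup)
  let ?i = "inv\<^bsub>AutoGroup G\<^esub> \<phi>"
  have i: "?i \<in> carrier (AutoGroup G)" using \<phi> by simp
  have matB: "mat (pull \<phi>) = B" by (simp add: \<phi>_def pull_push f(2))
  have mm: "mat (pull (\<alpha> \<otimes>\<^bsub>AutoGroup G\<^esub> \<beta>)) = mat (pull \<alpha>) * mat (pull \<beta>)"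
    if "\<alpha> \<in> carrier (AutoGroup G)" "\<beta> \<in> carrier (AutoGroup G)" for \<alpha> \<beta>
    using that by (simp add: carrier_AutoGroup pull_mult mat_comp aut_ghom aut_pull)
  have "pull \<one>\<^bsub>AutoGroup G\<^esub> = id" by (simp add: fun_eq_iff pull_def one_AutoGroup)
  then have "B * mat (pull ?i) = 1" using mm[OF \<phi> i] A.r_inv[OF \<phi>] by (simp add: matB mat_id)
  then have mati: "mat (pull ?i) = minv B" using minv_eqI[OF Gam_det[OF assms]] by simp
  let ?k = "Out_class \<phi>"
  have k: "?k \<in> carrier (Out G)" using \<phi> by (rule q.hom_closed)
  have conj: "?k \<otimes>\<^bsub>Out G\<^esub> Out_class \<psi> \<otimes>\<^bsub>Out G\<^esub> inv\<^bsub>Out G\<^esub> ?k =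
      Out_class (\<phi> \<otimes>\<^bsub>AutoGroup G\<^esub> \<psi> \<otimes>\<^bsub>AutoGroup G\<^esub> ?i)" if "\<psi> \<in> carrier (AutoGroup G)" for \<psi>
    using that \<phi> i by (simp add: q.hom_inv)
  have matc: "mat (pull (\<phi> \<otimes>\<^bsub>AutoGroup G\<^esub> \<psi> \<otimes>\<^bsub>AutoGroup G\<^esub> ?i)) = cm B (mat (pull \<psi>))"
    if "\<psi> \<in> carrier (AutoGroup G)" for \<psi>
    using that \<phi> i by (simp add: mm matB mati cm_def)
  have "?k <#\<^bsub>Out G\<^esub> OutM X #>\<^bsub>Out G\<^esub> inv\<^bsub>Out G\<^esub> ?k = OutM (cm B ` X)"
    unfolding O.conj_set_eq
  proof (intro equalityI subsetI)
    fix y assume "y \<in> (\<lambda>m. ?k \<otimes>\<^bsub>Out G\<^esub> m \<otimes>\<^bsub>Out G\<^esub> inv\<^bsub>Out G\<^esub> ?k) ` OutM X"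
    then obtain \<psi> where \<psi>: "\<psi> \<in> carrier (AutoGroup G)" "mat (pull \<psi>) \<in> X"
      "y = ?k \<otimes>\<^bsub>Out G\<^esub> Out_class \<psi> \<otimes>\<^bsub>Out G\<^esub> inv\<^bsub>Out G\<^esub> ?k"
      by (auto simp: OutM_def carrier_AutoGroup)
    let ?\<chi> = "\<phi> \<otimes>\<^bsub>AutoGroup G\<^esub> \<psi> \<otimes>\<^bsub>AutoGroup G\<^esub> ?i"
    have "?\<chi> \<in> auto G" using \<phi> i \<psi>(1) by (simp flip: carrier_AutoGroup)
    moreover have "mat (pull ?\<chi>) \<in> cm B ` X" using matc[OF \<psi>(1)] \<psi>(2) by simp
    moreover have "y = Out_class ?\<chi>" using conj[OF \<psi>(1)] \<psi>(3) by simp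
    ultimately show "y \<in> OutM (cm B ` X)" unfolding OutM_def by blast
  next
    fix y assume "y \<in> OutM (cm B ` X)"
    then obtain \<chi> where \<chi>: "\<chi> \<in> carrier (AutoGroup G)" "mat (pull \<chi>) \<in> cm B ` X" "y = Out_class \<chi>"
      by (auto simp: OutM_def carrier_AutoGroup)
    define \<psi> where "\<psi> = ?i \<otimes>\<^bsub>AutoGroup G\<^esub> \<chi> \<otimes>\<^bsub>AutoGroup G\<^esub> \<phi>"
    have \<psi>: "\<psi> \<in> carrier (AutoGroup G)" using \<phi> i \<chi>(1) by (simp add: \<psi>_def)
    have "\<phi> \<otimes>\<^bsub>AutoGroup G\<^esub> \<psi> \<otimes>\<^bsub>AutoGroup G\<^esub> ?i = \<chi>"
      using \<phi> \<chi>(1) by (simp add: \<psi>_def A.m_assoc A.inv_cancel)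
    then have y: "y = ?k \<otimes>\<^bsub>Out G\<^esub> Out_class \<psi> \<otimes>\<^bsub>Out G\<^esub> inv\<^bsub>Out G\<^esub> ?k"
      using conj[OF \<psi>] \<chi>(3) by simp
    obtain C where C: "C \<in> X" "mat (pull \<chi>) = cm B C" using \<chi>(2) by blast
    have "mat (pull \<psi>) = minv B * cm B C * B"
      using \<phi> i \<chi>(1) by (simp add: \<psi>_def mm matB mati C(2))
    also have "\<dots> = (minv B * B) * C * (minv B * B)" by (simp only: cm_def mult.assoc)
    also have "\<dots> = C" by (simp add: Gam_minv_mult[OF assms])
    finally have "mat (pull \<psi>) \<in> X" using C(1) by simp
    then have "Out_class \<psi> \<in> OutM X" using \<psi> by (auto simp: OutM_def carrier_AutoGroup)
    then show "y \<in> (\<lambda>m. ?k \<otimes>\<^bsub>Out G\<^esub> m \<otimes>\<^bsub>Out G\<^esub> inv\<^bsub>Out G\<^esub> ?k) ` OutM X"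
      unfolding y by (rule imageI)
  qed
  with k show ?thesis by (rule that)
qed

lemma OutM_subset: "OutM X \<subseteq> carrier (Out G)"
proof -
  interpret q: group_hom "AutoGroup G" "Out G" Out_class by (rule Out_class_hom)
  show ?thesis using q.hom_closed by (auto simp: OutM_def carrier_AutoGroup)
qed

lemma finite_McCool_classes: "finite {subgroup_conj_class (Out G) M | M. McCool_group G M}"
proof (rule finite_subset)
  interpret O: group "Out G" by (rule group_Out)
  show "finite ((\<lambda>X. subgroup_conj_class (Out G) (OutM X)) ` fam)"
    by (rule finite_imageI[OF finite_fam])
  show "{subgroup_conj_class (Out G) M | M. McCool_group G M} \<subseteq>
      (\<lambda>X. subgroup_conj_class (Out G) (OutM X)) ` fam"
  proof
    fix c assume "c \<in> {subgroup_conj_class (Out G) M | M. McCool_group G M}"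
    then obtain \<H> where H: "\<forall>H\<in>\<H>. fin_gen_subgroup G H" "c = subgroup_conj_class (Out G) (Mc G \<H>)"
      by (auto simp: McCool_group_def)
    have "H \<subseteq> carrier G" if mem: "H \<in> \<H>" for H
    proof -
      obtain S where "S \<subseteq> carrier G" "H = generate G S"
        using bspec[OF H(1) mem] by (auto simp: fin_gen_subgroup_def)
      then show ?thesis using generate_in_carrier by blast
    qed
    then have Mc: "Mc G \<H> = OutM (MM ((`) \<iota> ` \<H>))" by (intro Mc_OutM) blast
    obtain B where B: "B \<in> Gam" "cm B ` MM ((`) \<iota> ` \<H>) \<in> fam" using MM_classification by blast
    obtain k where k: "k \<in> carrier (Out G)"
      "k <#\<^bsub>Out G\<^esub> OutM (MM ((`) \<iota> ` \<H>)) #>\<^bsub>Out G\<^esub> inv\<^bsub>Out G\<^esub> k = OutM (cm B ` MM ((`) \<iota> ` \<H>))"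
      by (rule OutM_conj[OF B(1)])
    have "c = subgroup_conj_class (Out G) (OutM (cm B ` MM ((`) \<iota> ` \<H>)))"
      unfolding H(2) Mc k(2)[symmetric] by (rule O.subgroup_conj_class_conj[OF OutM_subset k(1), symmetric])
    then show "c \<in> (\<lambda>X. subgroup_conj_class (Out G) (OutM X)) ` fam" using B(2) by blast
  qed
qed

end

theorem proposition7p2:
  fixes F2 :: "('a, 'b) monoid_scheme"
  assumes "free_group_of_rank 2 F2"
  shows "finite {subgroup_conj_class (Out F2) M | M. McCool_group F2 M}"
proof -
  obtain X where X: "free_basis F2 X" "card X = 2"
    using assms by (auto simp: free_group_of_rank_def)
  obtain x y where xy: "X = {x, y}" "x \<noteq> y" using X(2) by (auto simp: card_2_iff)
  define e where "e g = (if g then x else y)" for g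
  have "range e = X" by (auto simp: e_def xy(1) image_def)
  moreover have "inj e" using xy(2) by (auto simp: inj_def e_def split: if_splits)
  moreover have "group F2" using X(1) by (simp add: free_basis_def)
  ultimately interpret free_group_2 F2 e
    using X(1) by (simp add: free_group_2_def free_group_2_axioms_def)
  show ?thesis by (rule finite_McCool_classes)
qed

end
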